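(* Let $p\in[2,\infty)$ and $\alpha\in[0,1]$. Then there exist two positive constants $c_p$ and $C_p$ such that for any $f\in\mathcal{S}'$ and $j\in\mathbb{Z}$, we have $$c_p\,2^{\frac{2\alpha j}{p}}\|\Delta_jf\|_p\le \big\|\Lambda^\alpha\big(|\Delta_jf|^{\frac p2}\big)\big\|_2^{\frac 2p}\le C_p\,2^{\frac{2\alpha j}{p}}\|\Delta_jf\|_p.$$
   Context: Here $\mathcal{S}'=\mathcal{S}'(\mathbb{R}^d)$ is the space of tempered distributions on $\mathbb{R}^d$, and $\|\cdot\|_p$ denotes the $L^p(\mathbb{R}^d)$ norm. The Fourier transform is $\hat f(\xi)=\mathcal{F}f(\xi)=(2\pi)^{-d/2}\int_{\mathbb{R}^d}e^{-ix\cdot\xi}f(x)\,dx$. Fix two nonnegative radial functions $\chi,\varphi\in\mathcal{S}(\mathbb{R}^d)$ supported respectively in $\{|\xi|\le \frac43\}$ and $\{\frac34\le|\xi|\le\frac83\}$ such that $\chi(\xi)+\sum_{j\ge0}\varphi(2^{-j}\xi)=1$ for all $\xi\in\mathbb{R}^d$ and $\sum_{j\in\mathbb{Z}}\varphi(2^{-j}\xi)=1$ for all $\xi\in\mathbb{R}^d\setminus\{0\}$. For $j\in\mathbb{Z}$, the frequency localization operator $\Delta_j$ is defined by $\Delta_j f=\varphi(2^{-j}D)f=\mathcal{F}^{-1}(\varphi(2^{-j}\cdot)\hat f)$. The operator $\Lambda^\alpha$ is defined by $\Lambda^\alpha g=\mathcal{F}^{-1}(|\xi|^\alpha\hat g)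$.
   Formalization: The left inequality is proved only for real-valued f, since for complex f and α>0 it fails (e.g. Δ_0 f = e^{ix·ξ₀}A(εx), ε→0); at α=0 it is a trivial identity, also stated only for real f. The right inequality is proved for all complex f in S'. *)

theory Defs
  imports "HOL-Analysis.Analysis"
begin

section \<open>Fourier transform and Schwartz functions\<close>

text \<open>The space \<open>\<real>\<^sup>d\<close> is a type \<open>'a :: euclidean_space\<close> with \<open>d = DIM('a)\<close>.\<close>

definition fourier :: "('a::euclidean_space \<Rightarrow> complex) \<Rightarrow> 'a \<Rightarrow> complex" where
  "fourier f \<xi> = of_real ((2 * pi) powr (- real DIM('a) / 2)) *
     (LINT x|lborel. exp (- \<i> * of_real (x \<bullet> \<xi>)) * f x)"

definition inv_fourier :: "('a::euclidean_space \<Rightarrow> complex) \<Rightarrow> 'a \<Rightarrow> complex" where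
  "inv_fourier f x = of_real ((2 * pi) powr (- real DIM('a) / 2)) *
     (LINT \<xi>|lborel. exp (\<i> * of_real (x \<bullet> \<xi>)) * f \<xi>)"

definition dir_deriv :: "'a::euclidean_space \<Rightarrow> ('a \<Rightarrow> complex) \<Rightarrow> 'a \<Rightarrow> complex" where
  "dir_deriv b f x = vector_derivative (\<lambda>t. f (x + t *\<^sub>R b)) (at 0)"

text \<open>A list of basis vectors plays the role of a multi-index.\<close>

definition iter_deriv :: "'a::euclidean_space list \<Rightarrow> ('a \<Rightarrow> complex) \<Rightarrow> 'a \<Rightarrow> complex" where
  "iter_deriv bs f = foldr dir_deriv bs f"

definition schwartz :: "('a::euclidean_space \<Rightarrow> complex) set" where
  "schwartz = {f. \<forall>bs. set bs \<subseteq> Basis \<longrightarrow>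
     (\<forall>x. iter_deriv bs f differentiable (at x)) \<and>
     (\<forall>k::nat. bdd_above (range (\<lambda>x. (1 + norm x) ^ k * norm (iter_deriv bs f x))))}"

definition schwartz_seminorm ::
    "nat \<Rightarrow> 'a::euclidean_space list \<Rightarrow> ('a \<Rightarrow> complex) \<Rightarrow> real" where
  "schwartz_seminorm k bs f = (SUP x. (1 + norm x) ^ k * norm (iter_deriv bs f x))"

definition schwartz_tendsto ::
    "(nat \<Rightarrow> 'a::euclidean_space \<Rightarrow> complex) \<Rightarrow> ('a \<Rightarrow> complex) \<Rightarrow> bool" where
  "schwartz_tendsto F f \<longleftrightarrow>
     (\<forall>k bs. set bs \<subseteq> Basis \<longrightarrow>
        (\<lambda>n. schwartz_seminorm k bs (\<lambda>x. F n x - f x)) \<longlonglongrightarrow> 0)"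


section \<open>Tempered distributions\<close>

text \<open>
  A distribution is a functional on functions of which only the values on \<^const>\<open>schwartz\<close>
  matter. The Schwartz space is metrizable, so continuity is sequential continuity.
\<close>

type_synonym 'a functional = "('a \<Rightarrow> complex) \<Rightarrow> complex"

definition tempered_distribution :: "'a::euclidean_space functional \<Rightarrow> bool" where
  "tempered_distribution T \<longleftrightarrow>
     (\<forall>f\<in>schwartz. \<forall>g\<in>schwartz. \<forall>a b. T (\<lambda>x. a * f x + b * g x) = a * T f + b * T g) \<and>
     (\<forall>F f. (\<forall>n. F n \<in> schwartz) \<and> f \<in> schwartz \<and> schwartz_tendsto F f \<longrightarrow>
        (\<lambda>n. T (F n)) \<longlonglongrightarrow> T f)"

text \<open>
  Real-valued distributions. A lower bound on the norm of \<open>\<Lambda>\<^sup>\<alpha>(\<bar>f\<bar>\<^sup>r)\<close> by that of a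
  frequency-localized \<open>f\<close> needs them: the modulus of \<open>f(x) = exp(\<i> x \<bullet> \<xi>\<^sub>0) A(\<epsilon> x)\<close> does not
  oscillate, and its norm scales with \<open>\<epsilon>\<close>.
\<close>

definition real_distribution :: "'a::euclidean_space functional \<Rightarrow> bool" where
  "real_distribution T \<longleftrightarrow> (\<forall>\<psi>\<in>schwartz. T (\<lambda>x. cnj (\<psi> x)) = cnj (T \<psi>))"

definition fourier_dist :: "'a::euclidean_space functional \<Rightarrow> 'a functional" where
  "fourier_dist T \<psi> = T (fourier \<psi>)"

definition inv_fourier_dist :: "'a::euclidean_space functional \<Rightarrow> 'a functional" where
  "inv_fourier_dist T \<psi> = T (inv_fourier \<psi>)"

definition mult_dist ::
    "('a::euclidean_space \<Rightarrow> complex) \<Rightarrow> 'a functional \<Rightarrow> 'a functional" where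
  "mult_dist m T \<psi> = T (\<lambda>x. m x * \<psi> x)"

definition fun_dist :: "('a::euclidean_space \<Rightarrow> complex) \<Rightarrow> 'a functional" where
  "fun_dist u \<psi> = (LINT x|lborel. u x * \<psi> x)"

definition represents :: "'a::euclidean_space functional \<Rightarrow> ('a \<Rightarrow> complex) \<Rightarrow> bool" where
  "represents T u \<longleftrightarrow> u \<in> borel_measurable borel \<and>
     (\<forall>\<psi>\<in>schwartz. integrable lborel (\<lambda>x. u x * \<psi> x) \<and> T \<psi> = fun_dist u \<psi>)"

text \<open>
  The function that a distribution is; it is unique up to null sets, and unspecified
  if there is none.
\<close>

definition dist_fun :: "'a::euclidean_space functional \<Rightarrow> 'a \<Rightarrow> complex" where
  "dist_fun T = (SOME u. represents T u)"


section \<open>Lebesgue norms with values in \<open>[0, \<infinity>]\<close>\<close>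

text \<open>Intended for exponents \<open>r > 0\<close>, so that \<open>\<infinity>\<close> to the power \<open>r\<close> is \<open>\<infinity>\<close>.\<close>

definition ennreal_powr :: "ennreal \<Rightarrow> real \<Rightarrow> ennreal" where
  "ennreal_powr x r = (if x = \<infinity> then \<infinity> else ennreal (enn2real x powr r))"

definition Lp_norm :: "real \<Rightarrow> ('a::euclidean_space \<Rightarrow> complex) \<Rightarrow> ennreal" where
  "Lp_norm p u = ennreal_powr (\<integral>\<^sup>+x. ennreal (norm (u x) powr p) \<partial>lborel) (1 / p)"

definition dist_Lp_norm :: "real \<Rightarrow> 'a::euclidean_space functional \<Rightarrow> ennreal" where
  "dist_Lp_norm p T = (if \<exists>u. represents T u then Lp_norm p (dist_fun T) else \<infinity>)"


section \<open>Littlewood--Paley blocks and the operator \<open>\<Lambda>\<^sup>\<alpha>\<close>\<close>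

definition littlewood_paley :: "('a::euclidean_space \<Rightarrow> real) \<Rightarrow> ('a \<Rightarrow> real) \<Rightarrow> bool" where
  "littlewood_paley chi \<phi> \<longleftrightarrow>
     (\<lambda>\<xi>. of_real (chi \<xi>)) \<in> schwartz \<and> (\<lambda>\<xi>. of_real (\<phi> \<xi>)) \<in> schwartz \<and>
     (\<forall>\<xi>. 0 \<le> chi \<xi>) \<and> (\<forall>\<xi>. 0 \<le> \<phi> \<xi>) \<and>
     (\<forall>\<xi> \<eta>. norm \<xi> = norm \<eta> \<longrightarrow> chi \<xi> = chi \<eta> \<and> \<phi> \<xi> = \<phi> \<eta>) \<and>
     closure {\<xi>. chi \<xi> \<noteq> 0} \<subseteq> {\<xi>. norm \<xi> \<le> 4 / 3} \<and>
     closure {\<xi>. \<phi> \<xi> \<noteq> 0} \<subseteq> {\<xi>. 3 / 4 \<le> norm \<xi> \<and> norm \<xi> \<le> 8 / 3} \<and>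
     (\<forall>\<xi>. ((\<lambda>j::int. \<phi> (2 powi (- j) *\<^sub>R \<xi>)) has_sum (1 - chi \<xi>)) {0..}) \<and>
     (\<forall>\<xi>. \<xi> \<noteq> 0 \<longrightarrow> ((\<lambda>j::int. \<phi> (2 powi (- j) *\<^sub>R \<xi>)) has_sum 1) UNIV)"

definition LP_block ::
    "('a::euclidean_space \<Rightarrow> real) \<Rightarrow> int \<Rightarrow> 'a functional \<Rightarrow> 'a functional" where
  "LP_block \<phi> j f =
     inv_fourier_dist (mult_dist (\<lambda>\<xi>. of_real (\<phi> (2 powi (- j) *\<^sub>R \<xi>))) (fourier_dist f))"

text \<open>
  The symbol \<open>\<bar>\<xi>\<bar>\<^sup>\<alpha>\<close> is not smooth at the origin, so it cannot multiply an arbitrary tempered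
  distribution. The operator \<open>\<Lambda>\<^sup>\<alpha>\<close> is taken on those \<open>g\<close> whose Fourier transform is an \<open>L\<^sup>2\<close>
  function (by Plancherel, on \<open>L\<^sup>2\<close>), with values in the tempered distributions. The norm of
  \<open>\<Lambda>\<^sup>\<alpha> g\<close> is \<open>\<infinity>\<close> if \<open>g\<close> is outside this domain or \<open>\<Lambda>\<^sup>\<alpha> g\<close> is not in \<open>L\<^sup>2\<close>.
  The convention \<open>0 powr 0 = 0\<close> affects the symbol only at the null set \<open>{0}\<close>.
\<close>

definition Lambda_domain :: "'a::euclidean_space functional \<Rightarrow> bool" where
  "Lambda_domain g \<longleftrightarrow> (\<exists>h. represents (fourier_dist g) h \<and> Lp_norm 2 h < \<infinity>)"

definition Lambda :: "real \<Rightarrow> 'a::euclidean_space functional \<Rightarrow> 'a functional" where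
  "Lambda \<alpha> g = inv_fourier_dist
     (fun_dist (\<lambda>\<xi>. of_real (norm \<xi> powr \<alpha>) * dist_fun (fourier_dist g) \<xi>))"

definition Lambda_L2_norm :: "real \<Rightarrow> 'a::euclidean_space functional \<Rightarrow> ennreal" where
  "Lambda_L2_norm \<alpha> g = (if Lambda_domain g then dist_Lp_norm 2 (Lambda \<alpha> g) else \<infinity>)"

text \<open>The distribution \<open>\<bar>f\<bar>\<^sup>r\<close>, for a distribution \<open>f\<close> that is a function.\<close>

definition abs_powr_dist :: "'a::euclidean_space functional \<Rightarrow> real \<Rightarrow> 'a functional" where
  "abs_powr_dist f r = fun_dist (\<lambda>x. of_real (norm (dist_fun f x) powr r))"

end

theory Submission
  imports "HOL-Probability.Probability" Defs
begin

text \<open>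
  Finite differences on the Fourier side: if \<open>h\<close> is the transform of \<open>v = \<bar>u\<bar>\<^bsup>p/2\<^esup>\<close>, then by Plancherel
  \<open>v(x + k) - v(x)\<close> has the norm of \<open>(exp(\<i> k \<bullet> \<xi>) - 1) h(\<xi>)\<close>, and
  \<open>\<bar>exp(\<i> k \<bullet> \<xi>) - 1\<bar> \<le> 2 (\<bar>k\<bar>\<bar>\<xi>\<bar>)\<^sup>\<alpha>\<close>. This replaces \<open>\<Lambda>\<^sup>\<alpha>\<close> by differences of \<open>v\<close>, without any
  derivative of the modulus. The block \<open>\<Delta>\<^sub>j f\<close>, rescaled to unit frequency, is a function \<open>U = K * U\<close> with a
  fixed Schwartz kernel \<open>K\<close> of integral zero.

  Upper bound: \<open>U\<close> is locally Lipschitz with a constant \<open>m(x)\<close> whose \<open>L\<^sup>p\<close> norm is bounded by that of \<open>U\<close>,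
  so the differences of \<open>\<bar>U\<bar>\<^bsup>p/2\<^esup>\<close> are \<open>O(\<bar>k\<bar>)\<close> in \<open>L\<^sup>2\<close>. Small \<open>k\<close> control \<open>\<bar>\<xi>\<bar>\<^sup>2\<bar>h\<bar>\<^sup>2\<close>, hence
  \<open>\<bar>\<xi>\<bar>\<^bsup>2\<alpha>\<^esup>\<bar>h\<bar>\<^sup>2\<close>.

  Lower bound: since \<open>K\<close> has integral zero, \<open>U(x)\<close> is the integral of \<open>K(z) (U(x - z) - U(x))\<close>. For real \<open>U\<close>
  such an increment is that of \<open>\<bar>U\<bar>\<close> unless \<open>U\<close> changes sign between the two points; then \<open>U\<close> has a zero on
  the segment, \<open>\<bar>U\<bar>\<close> is small near it by the Lipschitz bound, and \<open>\<bar>U\<bar>\<close> again differs much between \<open>x\<close> and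
  a whole ball of points. Averaging over differences of bounded length bounds \<open>\<bar>U\<bar>\<^sup>p\<close>, up to a small
  multiple that is absorbed; the tail of \<open>K\<close> is absorbed as well.
\<close>

section \<open>Integration on Euclidean spaces\<close>

text \<open>The power |u|^(p/2) is neither smooth nor localized in frequency, so localization can be
  used only for u itself. The kernel K comes from a cutoff that equals one on the support of the
  symbol of the block and vanishes at the origin, whence its integral is zero. After rescaling by
  2^(-j) the same K serves every j, and therefore so do the constants. Differences treat the whole
  range 0 \<le> \<alpha> \<le> 1 at once: \<alpha> = 1 needs no chain rule for the modulus, and
  smaller \<alpha> no interpolation of operators. The Lipschitz majorant m controls U only on balls
  of a fixed radius, which is why the lower bound works with increments of bounded length and splits
  off the tail of K. Absorbing terms requires the p-th power integral of u to be finite beforehand.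
  This is not assumed of f: if |u|^(p/2) lies in the domain of \<open>Lambda\<close>, Plancherel
  supplies it, and otherwise the quantity bounding from above is infinite. The condition 2 \<le> p
  makes the exponent p/2 at least one, so that t^(p/2) is convex and superadditive; one bound rests
  on each of these properties.\<close>

lemma nn_integral_lborel_translate:
  fixes f :: "'a::euclidean_space \<Rightarrow> ennreal"
  assumes [measurable]: "f \<in> borel_measurable borel"
  shows "(\<integral>\<^sup>+x. f (x + a) \<partial>lborel) = (\<integral>\<^sup>+x. f x \<partial>lborel)"
  by (subst (2) lborel_distr_plus[symmetric, of a]) (simp add: nn_integral_distr add.commute)

lemma nn_integral_lborel_scale:
  fixes f :: "'a::euclidean_space \<Rightarrow> ennreal"
  assumes [measurable]: "f \<in> borel_measurable borel" and c: "c \<noteq> 0"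
  shows "(\<integral>\<^sup>+x. f x \<partial>lborel) = ennreal (\<bar>c\<bar> ^ DIM('a)) * (\<integral>\<^sup>+x. f (c *\<^sub>R x) \<partial>lborel)"
  by (subst lborel_affine[OF c, of 0])
     (simp add: nn_integral_density nn_integral_distr nn_integral_cmult)

lemma integrable_lborel_translate:
  fixes f :: "'a::euclidean_space \<Rightarrow> 'b::{banach, second_countable_topology}"
  assumes "integrable lborel f"
  shows "integrable lborel (\<lambda>x. f (x + a))"
proof -
  have "integrable (distr lborel borel ((+) a)) f"
    using assms by (simp add: lborel_distr_plus)
  then show ?thesis
    by (subst (asm) integrable_distr_eq) (use assms in \<open>auto simp: add.commute\<close>)
qed

lemma integral_lborel_translate:
  fixes f :: "'a::euclidean_space \<Rightarrow> 'b::{banach, second_countable_topology}"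
  assumes [measurable]: "f \<in> borel_measurable borel"
  shows "(LINT x|lborel. f (x + a)) = (LINT x|lborel. f x)"
  by (subst (2) lborel_distr_plus[symmetric, of a]) (simp add: integral_distr add.commute)

lemma integrable_lborel_scale:
  fixes f :: "'a::euclidean_space \<Rightarrow> 'b::{banach, second_countable_topology}"
  assumes f: "integrable lborel f" and c: "c \<noteq> 0"
  shows "integrable lborel (\<lambda>x. f (c *\<^sub>R x))"
proof -
  have [measurable]: "f \<in> borel_measurable borel" using f by auto
  have "ennreal (\<bar>c\<bar> ^ DIM('a)) * (\<integral>\<^sup>+x. norm (f (c *\<^sub>R x)) \<partial>lborel) < \<infinity>"
    using f c unfolding integrable_iff_bounded by (subst nn_integral_lborel_scale[symmetric]) auto
  then show ?thesis
    unfolding integrable_iff_bounded using c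
    by (auto simp: ennreal_mult_less_top)
qed

lemma integral_lborel_scale:
  fixes f :: "'a::euclidean_space \<Rightarrow> 'b::{banach, second_countable_topology}"
  assumes [measurable]: "f \<in> borel_measurable borel" and c: "c \<noteq> 0"
  shows "(LINT x|lborel. f x) = (\<bar>c\<bar> ^ DIM('a)) *\<^sub>R (LINT x|lborel. f (c *\<^sub>R x))"
  by (subst lborel_affine[OF c, of 0]) (simp add: integral_density integral_distr)

lemma integral_lborel_reflect:
  fixes f :: "'a::euclidean_space \<Rightarrow> 'b::{banach, second_countable_topology}"
  assumes [measurable]: "f \<in> borel_measurable borel"
  shows "(LINT x|lborel. f (a - x)) = (LINT x|lborel. f x)"
proof -
  have "(LINT x|lborel. f (a - x)) = (LINT x|lborel. f (a + x))"
    by (subst integral_lborel_scale[where c="-1"]) auto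
  then show ?thesis using integral_lborel_translate[of f a] by (simp add: add.commute)
qed

lemma integrable_lborel_reflect:
  fixes f :: "'a::euclidean_space \<Rightarrow> 'b::{banach, second_countable_topology}"
  assumes "integrable lborel f"
  shows "integrable lborel (\<lambda>x. f (a - x))"
  using integrable_lborel_scale[OF integrable_lborel_translate[OF assms, of a], of "-1"] by simp

lemma nn_integral_lborel_reflect:
  fixes f :: "'a::euclidean_space \<Rightarrow> ennreal"
  assumes [measurable]: "f \<in> borel_measurable borel"
  shows "(\<integral>\<^sup>+x. f (a - x) \<partial>lborel) = (\<integral>\<^sup>+x. f x \<partial>lborel)"
proof -
  have "(\<integral>\<^sup>+x. f (a - x) \<partial>lborel) = (\<integral>\<^sup>+x. f (a + x) \<partial>lborel)"
    by (subst nn_integral_lborel_scale[where c="-1"]) auto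
  then show ?thesis using nn_integral_lborel_translate[of f a] by (simp add: add.commute)
qed

text \<open>Lebesgue measure on \<open>'a\<close> is the image of the product of one-dimensional
  Lebesgue measures under \<open>?S\<close>, so products of functions of single coordinates factor.
  Both the polynomial weight and the Gaussian integrals are reduced to dimension one in this
  way.\<close>

lemma
  fixes f :: "'a::euclidean_space \<Rightarrow> real \<Rightarrow> 'b::{real_normed_field, banach, second_countable_topology}"
  assumes f: "\<And>b. b \<in> Basis \<Longrightarrow> integrable lborel (f b)"
  shows integrable_lborel_prod: "integrable lborel (\<lambda>x::'a. \<Prod>b\<in>Basis. f b (x \<bullet> b))"
    and integral_lborel_prod:
      "(LINT x|lborel. (\<Prod>b\<in>(Basis :: 'a set). f b (x \<bullet> b))) = (\<Prod>b\<in>Basis. LINT t|lborel. f b t)"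
proof -
  interpret product_sigma_finite "\<lambda>_::'a. lborel :: real measure" ..
  let ?S = "\<lambda>g. (\<Sum>b\<in>Basis. g b *\<^sub>R b) :: 'a"
  have [measurable]: "\<And>b. b \<in> Basis \<Longrightarrow> f b \<in> borel_measurable borel"
    using borel_measurable_integrable[OF f] by simp
  have S: "?S g \<bullet> b = g b" if "b \<in> Basis" for g b
    using that by (simp add: inner_sum_left_Basis)
  have eq: "(\<Prod>b\<in>Basis. f b (?S g \<bullet> b)) = (\<Prod>b\<in>Basis. f b (g b))" for g
    by (rule prod.cong) (simp_all add: S)
  have m: "(\<lambda>x::'a. \<Prod>b\<in>Basis. f b (x \<bullet> b)) \<in> borel_measurable borel"
    by (rule borel_measurable_prod) measurable
  have Sm: "?S \<in> (\<Pi>\<^sub>M b\<in>Basis. lborel) \<rightarrow>\<^sub>M borel"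
    by (intro borel_measurable_sum borel_measurable_scaleR) auto
  show "integrable lborel (\<lambda>x::'a. \<Prod>b\<in>Basis. f b (x \<bullet> b))"
    by (subst lborel_eq, subst integrable_distr_eq[OF Sm m])
       (unfold eq, rule product_integrable_prod, auto intro: f)
  show "(LINT x|lborel. (\<Prod>b\<in>(Basis :: 'a set). f b (x \<bullet> b))) = (\<Prod>b\<in>Basis. LINT t|lborel. f b t)"
    by (subst lborel_eq, subst integral_distr[OF Sm m])
       (unfold eq, rule product_integral_prod, auto intro: f)
qed

lemma norm_power2_eq_sum_Basis: "(norm (x::'a::euclidean_space))\<^sup>2 = (\<Sum>b\<in>Basis. (x \<bullet> b)\<^sup>2)"
  unfolding power2_norm_eq_inner by (subst euclidean_inner) (simp add: power2_eq_square)

lemma integrable_inverse_one_plus_square: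
  "integrable lborel (\<lambda>x::real. 1 / (1 + x\<^sup>2))"
proof -
  have "set_integrable lborel (einterval (-\<infinity>) \<infinity>) (\<lambda>x. 1 / (1 + x^2))"
    by (rule interval_integral_FTC_nonneg[where F=arctan and A="-pi/2" and B="pi/2"])
       (auto intro!: derivative_eq_intros isCont_divide add_nonneg_eq_0_iff[THEN iffD1]
         simp: field_simps add_nonneg_eq_0_iff
         ereal_tendsto_simps1 tendsto_arctan_at_bot tendsto_arctan_at_top)
  then show ?thesis by (simp add: set_integrable_def)
qed

text \<open>Each of the d factors 1 + (x \<bullet> b)^2 is at most (1 + norm x)^2, so the weight
  lies below a product of one-dimensional functions 1/(1 + t^2). This is the origin of the exponent
  2d, which recurs wherever decay has to give integrability.\<close>

lemma integrable_inverse_one_plus_norm: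
  "integrable lborel (\<lambda>x::'a::euclidean_space. inverse ((1 + norm x) ^ (2 * DIM('a))))"
proof (rule Bochner_Integration.integrable_bound)
  show "integrable lborel (\<lambda>x::'a. \<Prod>b\<in>Basis. 1 / (1 + (x \<bullet> b)\<^sup>2))"
    by (rule integrable_lborel_prod) (rule integrable_inverse_one_plus_square)
  have "(\<Prod>b\<in>Basis. 1 + (x \<bullet> b)\<^sup>2) \<le> (1 + norm x) ^ (2 * DIM('a))" for x :: 'a
  proof -
    have "1 + (x \<bullet> b)\<^sup>2 \<le> (1 + norm x)\<^sup>2" if "b \<in> Basis" for b
    proof -
      have "(x \<bullet> b)\<^sup>2 \<le> (norm x)\<^sup>2"
        using Basis_le_norm[OF that, of x] by (metis abs_le_square_iff abs_norm_cancel)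
      moreover have "(1 + norm x)\<^sup>2 = 1 + 2 * norm x + (norm x)\<^sup>2" by (simp add: power2_sum)
      ultimately show ?thesis using norm_ge_zero[of x] by linarith
    qed
    then have "(\<Prod>b\<in>Basis. 1 + (x \<bullet> b)\<^sup>2) \<le> (\<Prod>b\<in>(Basis::'a set). (1 + norm x)\<^sup>2)"
      by (intro prod_mono) auto
    then show ?thesis by (simp add: power_mult)
  qed
  moreover have "0 < (\<Prod>b\<in>Basis. 1 + (x \<bullet> b)\<^sup>2)" for x :: 'a
    by (intro prod_pos) (auto intro: add_pos_nonneg)
  ultimately have "inverse ((1 + norm x) ^ (2 * DIM('a))) \<le> (\<Prod>b\<in>Basis. 1 / (1 + (x \<bullet> b)\<^sup>2))" for x :: 'a
    using le_imp_inverse_le[of "\<Prod>b\<in>Basis. 1 + (x \<bullet> b)\<^sup>2" "(1 + norm x) ^ (2 * DIM('a))"]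
    by (simp add: prod_dividef inverse_eq_divide)
  then show "AE x in lborel. norm (inverse ((1 + norm x) ^ (2 * DIM('a)))) \<le> norm (\<Prod>b\<in>Basis. 1 / (1 + ((x::'a) \<bullet> b)\<^sup>2))"
    by (auto simp: abs_of_nonneg intro!: order_trans[OF _ abs_ge_self])
qed simp

text \<open>The density of the centred normal distribution with standard deviation \<open>e\<close>
  in every coordinate; for e tending to zero it is an approximate identity.\<close>

definition gauss :: "real \<Rightarrow> 'a::euclidean_space \<Rightarrow> real" where
  "gauss e x = (2 * pi) powr (- real DIM('a) / 2) * inverse (e ^ DIM('a)) * exp (- (norm x)\<^sup>2 / (2 * e\<^sup>2))"

lemma gauss_nonneg: "0 < e \<Longrightarrow> 0 \<le> gauss e x"
  by (simp add: gauss_def)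

lemma gauss_minus: "gauss e (- x) = gauss e x"
  by (simp add: gauss_def)

lemma continuous_gauss [continuous_intros]: "continuous_on A (gauss e)"
  unfolding gauss_def by (cases "e = 0") (auto intro!: continuous_intros)

lemma gauss_measurable [measurable]: "gauss e \<in> borel_measurable borel"
  by (intro borel_measurable_continuous_onI continuous_gauss)

lemma gauss_1_eq_prod:
  "gauss 1 (x::'a::euclidean_space) = (\<Prod>b\<in>Basis. std_normal_density (x \<bullet> b))"
proof -
  have "(\<Prod>b\<in>Basis. std_normal_density (x \<bullet> b))
      = (\<Prod>b\<in>(Basis::'a set). 1 / sqrt (2 * pi)) * (\<Prod>b\<in>Basis. exp (- (x \<bullet> b)\<^sup>2 / 2))"
    unfolding std_normal_density_def by (rule prod.distrib)
  also have "(\<Prod>b\<in>Basis. exp (- (x \<bullet> b)\<^sup>2 / 2)) = exp (- (norm x)\<^sup>2 / 2)"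
    by (simp add: exp_sum[symmetric] sum_negf sum_divide_distrib[symmetric] norm_power2_eq_sum_Basis)
  also have "(\<Prod>b\<in>(Basis::'a set). 1 / sqrt (2 * pi)) = (2 * pi) powr (- real DIM('a) / 2)"
    by (simp add: powr_half_sqrt[symmetric] powr_minus_divide[symmetric] powr_realpow[symmetric]
        powr_powr)
  finally show ?thesis by (simp add: gauss_def)
qed

lemma gauss_scale:
  assumes "0 < e"
  shows "gauss 1 (x::'a::euclidean_space) = e ^ DIM('a) * gauss e (e *\<^sub>R x)"
  using assms by (simp add: gauss_def power_mult_distrib)

text \<open>The integrand is a product over the coordinates, and each factor integrates to the
  characteristic function of the standard normal law.\<close>

lemma
  fixes \<xi> :: "'a::euclidean_space"
  shows integrable_gauss_1_char: "integrable lborel (\<lambda>x. exp (\<i> * of_real (x \<bullet> \<xi>)) * of_real (gauss 1 x))"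
    and integral_gauss_1_char: "(LINT x|lborel. exp (\<i> * of_real (x \<bullet> \<xi>)) * of_real (gauss 1 x))
      = of_real (exp (- (norm \<xi>)\<^sup>2 / 2))"
proof -
  let ?g = "\<lambda>b t. exp (\<i> * of_real (t * (\<xi> \<bullet> b))) * complex_of_real (std_normal_density t)"
  have eq: "exp (\<i> * of_real (x \<bullet> \<xi>)) * of_real (gauss 1 x) = (\<Prod>b\<in>Basis. ?g b (x \<bullet> b))" for x
    by (simp add: gauss_1_eq_prod prod.distrib euclidean_inner[of x \<xi>] sum_distrib_left exp_sum)
  have i: "integrable lborel (?g b)" for b
    by (rule Bochner_Integration.integrable_bound[where f="std_normal_density"])
       (auto simp: norm_mult)
  have v: "(LINT t|lborel. ?g b t) = of_real (exp (- (\<xi> \<bullet> b)\<^sup>2 / 2))" for b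
  proof -
    have "(LINT t|lborel. ?g b t) = (LINT t|lborel. std_normal_density t *\<^sub>R iexp ((\<xi> \<bullet> b) * t))"
      by (rule Bochner_Integration.integral_cong) (auto simp: scaleR_conv_of_real mult_ac)
    also have "\<dots> = char std_normal_distribution (\<xi> \<bullet> b)"
      unfolding char_def by (subst integral_density) auto
    finally show ?thesis by (simp add: char_std_normal_distribution)
  qed
  show "integrable lborel (\<lambda>x. exp (\<i> * of_real (x \<bullet> \<xi>)) * of_real (gauss 1 x))"
    unfolding eq by (intro integrable_lborel_prod i)
  have "(\<Prod>b\<in>Basis. complex_of_real (exp (- (\<xi> \<bullet> b)\<^sup>2 / 2))) = of_real (exp (\<Sum>b\<in>Basis. - (\<xi> \<bullet> b)\<^sup>2 / 2))"
    by (simp add: exp_sum)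
  also have "(\<Sum>b\<in>Basis. - (\<xi> \<bullet> b)\<^sup>2 / 2) = - (norm \<xi>)\<^sup>2 / 2"
    by (simp add: sum_negf sum_divide_distrib[symmetric] norm_power2_eq_sum_Basis)
  finally show "(LINT x|lborel. exp (\<i> * of_real (x \<bullet> \<xi>)) * of_real (gauss 1 x))
      = of_real (exp (- (norm \<xi>)\<^sup>2 / 2))"
    unfolding eq by (subst integral_lborel_prod[OF i]) (simp only: v)
qed

lemma
  assumes e: "0 < e"
  shows integrable_gauss: "integrable lborel (gauss e :: 'a::euclidean_space \<Rightarrow> real)"
    and integral_gauss: "(LINT x|lborel. gauss e (x::'a)) = 1"
proof -
  have c1: "integrable lborel (\<lambda>x::'a. complex_of_real (gauss 1 x))"
    using integrable_gauss_1_char[of "0::'a"] by simp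
  have "(LINT x|lborel. complex_of_real (gauss 1 (x::'a))) = 1"
    using integral_gauss_1_char[of "0::'a"] by simp
  then have v1: "(LINT x|lborel. gauss 1 (x::'a)) = 1"
    unfolding integral_complex_of_real by (simp add: of_real_eq_1_iff)
  have i1: "integrable lborel (gauss 1 :: 'a \<Rightarrow> real)"
    using c1 by (simp add: complex_of_real_integrable_eq)
  have ge: "gauss e (x::'a) = inverse e ^ DIM('a) * gauss 1 (inverse e *\<^sub>R x)" for x
    using gauss_scale[OF e, of "inverse e *\<^sub>R x"] e by (simp add: power_inverse)
  have "integrable lborel (\<lambda>x::'a. gauss 1 (inverse e *\<^sub>R x))"
    using integrable_lborel_scale[OF i1, of "inverse e"] e by simp
  then show "integrable lborel (gauss e :: 'a \<Rightarrow> real)"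
    unfolding ge[abs_def] by (rule integrable_mult_right)
  have "(LINT x|lborel. gauss 1 (x::'a)) = \<bar>inverse e\<bar> ^ DIM('a) *\<^sub>R (LINT x|lborel. gauss 1 (inverse e *\<^sub>R (x::'a)))"
    using e by (intro integral_lborel_scale) auto
  then show "(LINT x|lborel. gauss e (x::'a)) = 1"
    unfolding ge[abs_def] using v1 e by simp
qed

text \<open>A rescaling of the standard Gaussian. As e tends to zero the factor exp(-e^2 |x|^2 / 2)
  increases to one while its transform concentrates at the origin; this is the mechanism of Fourier
  inversion below.\<close>

lemma
  fixes \<xi> :: "'a::euclidean_space"
  assumes e: "0 < e"
  shows integrable_exp_char: "integrable lborel (\<lambda>x::'a. exp (\<i> * of_real (x \<bullet> \<xi>)) * of_real (exp (- (e\<^sup>2 * (norm x)\<^sup>2) / 2)))"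
    and integral_exp_char: "(LINT x|lborel. exp (\<i> * of_real (x \<bullet> \<xi>)) * of_real (exp (- (e\<^sup>2 * (norm x)\<^sup>2) / 2)))
      = of_real ((2 * pi) powr real DIM('a) * gauss e \<xi>)"
proof -
  let ?c = "(2 * pi) powr (- real DIM('a) / 2)"
  let ?C = "(2 * pi) powr (real DIM('a) / 2)"
  have Cc: "?C * ?c = 1" by (simp add: powr_add[symmetric])
  have CC: "?C = (2 * pi) powr real DIM('a) * ?c" by (simp add: powr_add[symmetric])
  define F :: "'a \<Rightarrow> complex" where
    "F = (\<lambda>x. exp (\<i> * of_real (x \<bullet> (\<xi> /\<^sub>R e))) * of_real (gauss 1 x))"
  have iF: "integrable lborel F" unfolding F_def by (rule integrable_gauss_1_char)
  have eq: "exp (\<i> * of_real (x \<bullet> \<xi>)) * of_real (exp (- (e\<^sup>2 * (norm x)\<^sup>2) / 2)) = of_real ?C * F (e *\<^sub>R x)" for x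
  proof -
    have "of_real ?C * F (e *\<^sub>R x) = of_real (?C * ?c) * (exp (\<i> * of_real (x \<bullet> \<xi>)) * of_real (exp (- (e\<^sup>2 * (norm x)\<^sup>2) / 2)))"
      using e by (simp add: F_def gauss_def power_mult_distrib inner_scaleR_left inner_scaleR_right
          mult.assoc[symmetric] of_real_mult[symmetric] del: of_real_mult of_real_inverse)
    then show ?thesis unfolding Cc by simp
  qed
  show "integrable lborel (\<lambda>x::'a. exp (\<i> * of_real (x \<bullet> \<xi>)) * of_real (exp (- (e\<^sup>2 * (norm x)\<^sup>2) / 2)))"
    unfolding eq using integrable_lborel_scale[OF iF, of e] e by (intro integrable_mult_right) auto
  have "(LINT x|lborel. F x) = of_real (e ^ DIM('a)) * (LINT x|lborel. F (e *\<^sub>R x))"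
    using integral_lborel_scale[of F e] iF e by (simp add: scaleR_conv_of_real)
  moreover have "(LINT x|lborel. F x) = of_real (exp (- (norm (\<xi> /\<^sub>R e))\<^sup>2 / 2))"
    unfolding F_def by (rule integral_gauss_1_char)
  ultimately have "(LINT x|lborel. F (e *\<^sub>R x)) = of_real (inverse (e ^ DIM('a)) * exp (- (norm (\<xi> /\<^sub>R e))\<^sup>2 / 2))"
    using e by (simp add: field_simps)
  then have *: "(LINT x|lborel. of_real ?C * F (e *\<^sub>R x)) = of_real (?C * (inverse (e ^ DIM('a)) * exp (- (norm (\<xi> /\<^sub>R e))\<^sup>2 / 2)))"
    by (subst integral_mult_right_zero) (simp only: of_real_mult)
  have **: "?C * (inverse (e ^ DIM('a)) * exp (- (norm (\<xi> /\<^sub>R e))\<^sup>2 / 2)) = (2 * pi) powr real DIM('a) * gauss e \<xi>"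
  proof -
    have "- (norm (\<xi> /\<^sub>R e))\<^sup>2 / 2 = - (norm \<xi>)\<^sup>2 / (2 * e\<^sup>2)"
      using e by (simp add: field_simps)
    then have "(2 * pi) powr real DIM('a) * gauss e \<xi>
        = ((2 * pi) powr real DIM('a) * ?c) * (inverse (e ^ DIM('a)) * exp (- (norm (\<xi> /\<^sub>R e))\<^sup>2 / 2))"
      by (simp only: gauss_def mult.assoc)
    then show ?thesis by (simp only: CC)
  qed
  show "(LINT x|lborel. exp (\<i> * of_real (x \<bullet> \<xi>)) * of_real (exp (- (e\<^sup>2 * (norm x)\<^sup>2) / 2)))
      = of_real ((2 * pi) powr real DIM('a) * gauss e \<xi>)"
    unfolding eq * ** ..
qed

text \<open>The substitution y = x - e z moves the parameter from the Gaussian into the argument of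
  \<open>g\<close>. The integrand is then dominated by \<open>gauss 1 z * B\<close> for all e, and
  continuity at the single point x is enough.\<close>

lemma gauss_mollify_tendsto:
  fixes g :: "'a::euclidean_space \<Rightarrow> complex"
  assumes [measurable]: "g \<in> borel_measurable borel" and bd: "\<And>x. norm (g x) \<le> B"
    and cont: "isCont g x" and e: "\<And>n. 0 < e n" "e \<longlonglongrightarrow> 0"
  shows "(\<lambda>n. LINT y|lborel. of_real (gauss (e n) (x - y)) * g y) \<longlonglongrightarrow> g x"
proof -
  have eq: "(LINT y|lborel. of_real (gauss (e n) (x - y)) * g y)
      = (LINT z|lborel. of_real (gauss 1 z) * g (x - e n *\<^sub>R z))" for n
  proof -
    have "(LINT y|lborel. of_real (gauss (e n) (x - y)) * g y)
        = (LINT z|lborel. of_real (gauss (e n) z) * g (x - z))"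
      by (subst integral_lborel_reflect[symmetric, where a=x]) auto
    also have "\<dots> = (LINT z|lborel. of_real (gauss 1 z) * g (x - e n *\<^sub>R z))"
      using e(1)[of n] by (subst integral_lborel_scale[where c="e n"])
        (auto simp: gauss_scale[OF e(1)[of n]] scaleR_conv_of_real integral_mult_right_zero[symmetric] mult.assoc
          simp del: integral_mult_right_zero)
    finally show ?thesis .
  qed
  have "(\<lambda>n. LINT z|lborel. of_real (gauss 1 z) * g (x - e n *\<^sub>R z))
      \<longlonglongrightarrow> (LINT z|lborel. of_real (gauss 1 (z::'a)) * g x)"
  proof (rule integral_dominated_convergence[where w="\<lambda>z::'a. gauss 1 z * B"
        and f="\<lambda>z::'a. of_real (gauss 1 z) * g x" and s="\<lambda>n z::'a. of_real (gauss 1 z) * g (x - e n *\<^sub>R z)"])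
    show "integrable lborel (\<lambda>z::'a. gauss 1 z * B)"
      by (intro integrable_mult_left integrable_gauss) simp
    show "AE z in lborel. (\<lambda>n. of_real (gauss 1 z) * g (x - e n *\<^sub>R z)) \<longlonglongrightarrow> of_real (gauss 1 z) * g x"
    proof (rule AE_I2)
      fix z :: 'a
      have "(\<lambda>n. x - e n *\<^sub>R z) \<longlonglongrightarrow> x - 0 *\<^sub>R z"
        by (intro tendsto_intros e)
      then have "(\<lambda>n. g (x - e n *\<^sub>R z)) \<longlonglongrightarrow> g x"
        by (intro isCont_tendsto_compose[OF cont]) simp
      then show "(\<lambda>n. of_real (gauss 1 z) * g (x - e n *\<^sub>R z)) \<longlonglongrightarrow> of_real (gauss 1 z) * g x"
        by (intro tendsto_intros)
    qed
    show "AE z in lborel. norm (of_real (gauss 1 z) * g (x - e n *\<^sub>R z)) \<le> gauss 1 z * B" for n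
      using bd by (auto simp: norm_mult gauss_nonneg intro!: mult_left_mono AE_I2)
  qed auto
  moreover have "(LINT z|lborel. of_real (gauss 1 (z::'a)) * g x) = g x"
  proof -
    have "(LINT z|lborel. complex_of_real (gauss 1 (z::'a))) = 1"
      using integral_gauss[of 1, where 'a='a] integral_complex_of_real[of lborel "gauss 1 :: 'a \<Rightarrow> real"]
      by simp
    then show ?thesis by (subst integral_mult_left_zero) simp
  qed
  ultimately show ?thesis unfolding eq by (simp add: integral_gauss)
qed

section \<open>Schwartz functions\<close>

definition rapid :: "('a::euclidean_space \<Rightarrow> complex) \<Rightarrow> bool" where
  "rapid f \<longleftrightarrow> (\<forall>k::nat. bdd_above (range (\<lambda>x. (1 + norm x) ^ k * norm (f x))))"

definition moderate :: "('a::euclidean_space \<Rightarrow> complex) \<Rightarrow> bool" where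
  "moderate f \<longleftrightarrow> (\<exists>k C. \<forall>x. norm (f x) \<le> C * (1 + norm x) ^ k)"

text \<open>The growth condition is a parameter because two instances are needed: with
  \<open>rapid\<close> this is the Schwartz space, with \<open>moderate\<close> the smooth functions
  all of whose derivatives grow polynomially, which multiply the Schwartz space into itself.\<close>

definition smooth_with :: "(('a::euclidean_space \<Rightarrow> complex) \<Rightarrow> bool) \<Rightarrow> ('a \<Rightarrow> complex) set" where
  "smooth_with P = {f. \<forall>bs. set bs \<subseteq> Basis \<longrightarrow>
     (\<forall>x. iter_deriv bs f differentiable (at x)) \<and> P (iter_deriv bs f)}"

lemma schwartz_eq_smooth_with: "schwartz = smooth_with rapid"
  by (auto simp: schwartz_def smooth_with_def rapid_def)

lemma iter_deriv_Nil [simp]: "iter_deriv [] f = f"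
  by (simp add: iter_deriv_def)

lemma iter_deriv_Cons [simp]: "iter_deriv (b # bs) f = dir_deriv b (iter_deriv bs f)"
  by (simp add: iter_deriv_def)

lemma iter_deriv_snoc: "iter_deriv (bs @ [b]) f = iter_deriv bs (dir_deriv b f)"
  by (simp add: iter_deriv_def)

lemma dir_deriv_eq:
  assumes "(f has_derivative f') (at x)"
  shows "dir_deriv b f x = f' b"
proof -
  have "((\<lambda>t. x + t *\<^sub>R b) has_derivative (\<lambda>t. t *\<^sub>R b)) (at 0)"
    by (auto intro!: derivative_eq_intros)
  then have "((\<lambda>t. f (x + t *\<^sub>R b)) has_derivative (\<lambda>t. f' (t *\<^sub>R b))) (at 0)"
    by (rule has_derivative_compose) (use assms in simp)
  moreover have "f' (t *\<^sub>R b) = t *\<^sub>R f' b" for t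
    using has_derivative_bounded_linear[OF assms] by (intro linear_scale bounded_linear.linear)
  ultimately have "((\<lambda>t. f (x + t *\<^sub>R b)) has_vector_derivative f' b) (at 0)"
    by (simp add: has_vector_derivative_def)
  then show ?thesis unfolding dir_deriv_def by (rule vector_derivative_at)
qed

text \<open>It suffices to exhibit a class that contains the function, is stable under the partial
  derivatives and whose members satisfy the growth bound. This avoids every formula for higher
  derivatives.\<close>

lemma smooth_with_coinduct:
  assumes "f \<in> X"
    and "\<And>g x. g \<in> X \<Longrightarrow> g differentiable (at x)"
    and "\<And>g. g \<in> X \<Longrightarrow> P g"
    and "\<And>g b. g \<in> X \<Longrightarrow> b \<in> Basis \<Longrightarrow> dir_deriv b g \<in> X"
  shows "f \<in> smooth_with P"
proof -
  have "iter_deriv bs f \<in> X" if "set bs \<subseteq> Basis" for bs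
    using that by (induction bs) (auto intro: assms)
  then show ?thesis using assms by (auto simp: smooth_with_def)
qed

lemma smooth_with_dir_deriv: "f \<in> smooth_with P \<Longrightarrow> b \<in> Basis \<Longrightarrow> dir_deriv b f \<in> smooth_with P"
  unfolding smooth_with_def by (auto simp flip: iter_deriv_snoc)

lemma smooth_withD:
  assumes "f \<in> smooth_with P"
  shows "f differentiable (at x)" and "P f"
proof -
  have "(\<forall>x. iter_deriv [] f differentiable (at x)) \<and> P (iter_deriv [] f)"
    using assms unfolding smooth_with_def by (auto simp del: iter_deriv_Nil)
  then show "f differentiable (at x)" "P f" by auto
qed

lemma smooth_with_has_derivative:
  assumes "f \<in> smooth_with P"
  obtains f' where "(f has_derivative f') (at x)" "\<And>b. dir_deriv b f x = f' b"
proof -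
  obtain f' where f': "(f has_derivative f') (at x)"
    using smooth_withD(1)[OF assms, of x] unfolding differentiable_def by blast
  show thesis by (rule that[OF f' dir_deriv_eq[OF f']])
qed

lemma smooth_with_mono: "(\<And>f. P f \<Longrightarrow> Q f) \<Longrightarrow> smooth_with P \<subseteq> smooth_with Q"
  by (auto simp: smooth_with_def)

lemma smooth_with_add:
  assumes f: "f \<in> smooth_with P" and g: "g \<in> smooth_with P"
    and add: "\<And>f g. P f \<Longrightarrow> P g \<Longrightarrow> P (\<lambda>x. f x + g x)"
  shows "(\<lambda>x. f x + g x) \<in> smooth_with P"
proof (rule smooth_with_coinduct[where X="{\<lambda>x. f x + g x | f g. f \<in> smooth_with P \<and> g \<in> smooth_with P}"])
  fix h b assume "h \<in> {\<lambda>x. f x + g x | f g. f \<in> smooth_with P \<and> g \<in> smooth_with P}" and b: "b \<in> (Basis::'a set)"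
  then obtain f g where h: "h = (\<lambda>x. f x + g x)" "f \<in> smooth_with P" "g \<in> smooth_with P" by auto
  have "dir_deriv b h = (\<lambda>x. dir_deriv b f x + dir_deriv b g x)"
  proof
    fix x
    obtain f' where f': "(f has_derivative f') (at x)" "\<And>b. dir_deriv b f x = f' b"
      by (rule smooth_with_has_derivative[OF h(2), of x]) blast
    obtain g' where g': "(g has_derivative g') (at x)" "\<And>b. dir_deriv b g x = g' b"
      by (rule smooth_with_has_derivative[OF h(3), of x]) blast
    show "dir_deriv b h x = dir_deriv b f x + dir_deriv b g x"
      unfolding h f' g' by (rule dir_deriv_eq) (rule has_derivative_add[OF f'(1) g'(1)])
  qed
  then show "dir_deriv b h \<in> {\<lambda>x. f x + g x | f g. f \<in> smooth_with P \<and> g \<in> smooth_with P}"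
    using h b by (blast intro: smooth_with_dir_deriv)
next
  show "(\<lambda>x. f x + g x) \<in> {\<lambda>x. f x + g x | f g. f \<in> smooth_with P \<and> g \<in> smooth_with P}"
    using f g by blast
next
  fix h x assume "h \<in> {\<lambda>x. f x + g x | f g. f \<in> smooth_with P \<and> g \<in> smooth_with P}"
  then show "h differentiable (at x)"
    by (auto intro!: derivative_intros dest: smooth_withD(1))
next
  fix h assume "h \<in> {\<lambda>x. f x + g x | f g. f \<in> smooth_with P \<and> g \<in> smooth_with P}"
  then show "P h" by (auto intro!: add dest: smooth_withD(2))
qed

text \<open>Sums of products are stable under differentiation by the product rule alone. Used as the
  invariant class, they take the place of the general Leibniz formula.\<close>

inductive_set prod_span :: "('a::euclidean_space \<Rightarrow> complex) set \<Rightarrow> ('a \<Rightarrow> complex) set \<Rightarrow> ('a \<Rightarrow> complex) set"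
  for A B where
  prod: "a \<in> A \<Longrightarrow> g \<in> B \<Longrightarrow> (\<lambda>x. a x * g x) \<in> prod_span A B"
| add: "f \<in> prod_span A B \<Longrightarrow> g \<in> prod_span A B \<Longrightarrow> (\<lambda>x. f x + g x) \<in> prod_span A B"

lemma smooth_with_mult:
  assumes f: "f \<in> smooth_with P" and g: "g \<in> smooth_with Q"
    and mult: "\<And>f g. P f \<Longrightarrow> Q g \<Longrightarrow> R (\<lambda>x. f x * g x)"
    and add: "\<And>f g. R f \<Longrightarrow> R g \<Longrightarrow> R (\<lambda>x. f x + g x)"
  shows "(\<lambda>x. f x * g x) \<in> smooth_with R"
proof (rule smooth_with_coinduct[where X="prod_span (smooth_with P) (smooth_with Q)"])
  show "(\<lambda>x. f x * g x) \<in> prod_span (smooth_with P) (smooth_with Q)"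
    using f g by (rule prod_span.prod)
next
  fix h x assume "h \<in> prod_span (smooth_with P) (smooth_with Q)"
  then show "h differentiable (at x)"
    by induction (auto intro!: derivative_intros dest: smooth_withD(1))
next
  fix h assume "h \<in> prod_span (smooth_with P) (smooth_with Q)"
  then show "R h"
    by induction (auto intro!: mult add dest: smooth_withD(2))
next
  fix h b assume h: "h \<in> prod_span (smooth_with P) (smooth_with Q)" and b: "b \<in> (Basis::'a set)"
  have "dir_deriv b h \<in> prod_span (smooth_with P) (smooth_with Q) \<and> (\<forall>x. h differentiable (at x))"
    using h
  proof induction
    case (prod f g)
    have "dir_deriv b (\<lambda>x. f x * g x) = (\<lambda>x. f x * dir_deriv b g x + dir_deriv b f x * g x)"
    proof
      fix x
      obtain f' where f': "(f has_derivative f') (at x)" "\<And>b. dir_deriv b f x = f' b"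
        by (rule smooth_with_has_derivative[OF prod(1), of x]) blast
      obtain g' where g': "(g has_derivative g') (at x)" "\<And>b. dir_deriv b g x = g' b"
        by (rule smooth_with_has_derivative[OF prod(2), of x]) blast
      show "dir_deriv b (\<lambda>x. f x * g x) x = f x * dir_deriv b g x + dir_deriv b f x * g x"
        unfolding f' g' by (rule dir_deriv_eq) (rule has_derivative_mult[OF f'(1) g'(1)])
    qed
    then show ?case
      using prod b smooth_with_dir_deriv
      by (auto intro!: prod_span.intros derivative_intros dest: smooth_withD(1))
  next
    case (add f g)
    have "dir_deriv b (\<lambda>x. f x + g x) = (\<lambda>x. dir_deriv b f x + dir_deriv b g x)"
    proof
      fix x
      obtain f' where f': "(f has_derivative f') (at x)"
        using add unfolding differentiable_def by blast
      obtain g' where g': "(g has_derivative g') (at x)"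
        using add unfolding differentiable_def by blast
      show "dir_deriv b (\<lambda>x. f x + g x) x = dir_deriv b f x + dir_deriv b g x"
        unfolding dir_deriv_eq[OF f'] dir_deriv_eq[OF g']
        by (rule dir_deriv_eq) (rule has_derivative_add[OF f' g'])
    qed
    then show ?case
      using add by (auto intro!: prod_span.add derivative_intros)
  qed
  then show "dir_deriv b h \<in> prod_span (smooth_with P) (smooth_with Q)" ..
qed

section \<open>Growth conditions and closure properties of the Schwartz space\<close>

lemma rapid_iff: "rapid f \<longleftrightarrow> (\<forall>k. \<exists>C. \<forall>x. (1 + norm x) ^ k * norm (f x) \<le> C)"
  by (auto simp: rapid_def bdd_above_def)

lemma rapid_bound:
  assumes "rapid f"
  obtains C where "0 \<le> C" "\<And>x. (1 + norm x) ^ k * norm (f x) \<le> C"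
proof -
  obtain C where C: "\<And>x. (1 + norm x) ^ k * norm (f x) \<le> C"
    using assms unfolding rapid_iff by blast
  have "norm (f 0) \<le> C" using C[of 0] by simp
  then have "0 \<le> C" using norm_ge_zero[of "f 0"] by linarith
  with C show ?thesis using that by blast
qed

lemma rapid_bound_divide:
  assumes "rapid f"
  obtains C where "0 \<le> C" "\<And>x. norm (f x) \<le> C * inverse ((1 + norm x) ^ k)"
proof -
  obtain C where C: "0 \<le> C" "\<And>x. (1 + norm x) ^ k * norm (f x) \<le> C"
    using assms rapid_bound[where k=k] by metis
  have "norm (f x) \<le> C * inverse ((1 + norm x) ^ k)" for x
  proof -
    have "0 < (1 + norm x) ^ k" by (intro zero_less_power) (auto intro: add_pos_nonneg)
    then show ?thesis using C(2)[of x] by (simp add: field_simps)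
  qed
  then show ?thesis using C(1) that by blast
qed

lemma rapid_add: "rapid f \<Longrightarrow> rapid g \<Longrightarrow> rapid (\<lambda>x. f x + g x)"
  unfolding rapid_iff
proof
  fix k assume "\<forall>k. \<exists>C. \<forall>x. (1 + norm x) ^ k * norm (f x) \<le> C" "\<forall>k. \<exists>C. \<forall>x. (1 + norm x) ^ k * norm (g x) \<le> C"
  then obtain C D where "\<forall>x. (1 + norm x) ^ k * norm (f x) \<le> C" "\<forall>x. (1 + norm x) ^ k * norm (g x) \<le> D"
    by blast
  moreover have "(1 + norm x) ^ k * norm (f x + g x) \<le> (1 + norm x) ^ k * norm (f x) + (1 + norm x) ^ k * norm (g x)" for x
    unfolding distrib_left[symmetric] by (intro mult_left_mono norm_triangle_ineq) auto
  ultimately have "\<forall>x. (1 + norm x) ^ k * norm (f x + g x) \<le> C + D"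
    by (meson add_mono order_trans)
  then show "\<exists>C. \<forall>x. (1 + norm x) ^ k * norm (f x + g x) \<le> C" ..
qed

lemma moderate_mult_rapid: "moderate f \<Longrightarrow> rapid g \<Longrightarrow> rapid (\<lambda>x. f x * g x)"
proof -
  assume "moderate f" and g: "rapid g"
  then obtain l C where C: "\<And>x. norm (f x) \<le> C * (1 + norm x) ^ l"
    unfolding moderate_def by blast
  have C0: "0 \<le> C" using order_trans[OF norm_ge_zero C[of 0]] by simp
  show ?thesis unfolding rapid_iff
  proof
    fix k
    obtain D where D: "\<And>x. (1 + norm x) ^ (k + l) * norm (g x) \<le> D"
      using rapid_bound[OF g, of "k + l"] by blast
    have "(1 + norm x) ^ k * norm (f x * g x) \<le> C * D" for x
    proof -
      have "(1 + norm x) ^ k * norm (f x * g x) \<le> (1 + norm x) ^ k * (C * (1 + norm x) ^ l * norm (g x))"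
        unfolding norm_mult by (intro mult_left_mono mult_right_mono C) auto
      also have "\<dots> = C * ((1 + norm x) ^ (k + l) * norm (g x))"
        by (simp add: power_add)
      also have "\<dots> \<le> C * D" by (intro mult_left_mono D C0)
      finally show ?thesis .
    qed
    then show "\<exists>C. \<forall>x. (1 + norm x) ^ k * norm (f x * g x) \<le> C" by blast
  qed
qed

lemma moderate_mult: "moderate f \<Longrightarrow> moderate g \<Longrightarrow> moderate (\<lambda>x. f x * g x)"
proof -
  assume "moderate f" "moderate g"
  then obtain k l C D where C: "\<And>x. norm (f x) \<le> C * (1 + norm x) ^ k" and D: "\<And>x. norm (g x) \<le> D * (1 + norm x) ^ l"
    unfolding moderate_def by blast
  have "norm (f x * g x) \<le> (C * D) * (1 + norm x) ^ (k + l)" for x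
  proof -
    have "norm (f x * g x) \<le> (C * (1 + norm x) ^ k) * (D * (1 + norm x) ^ l)"
      unfolding norm_mult using order_trans[OF norm_ge_zero C] by (intro mult_mono C D) auto
    then show ?thesis by (simp add: power_add mult_ac)
  qed
  then show ?thesis unfolding moderate_def by blast
qed

lemma moderate_add: "moderate f \<Longrightarrow> moderate g \<Longrightarrow> moderate (\<lambda>x. f x + g x)"
proof -
  assume "moderate f" "moderate g"
  then obtain k l C D where C: "\<And>x. norm (f x) \<le> C * (1 + norm x) ^ k" and D: "\<And>x. norm (g x) \<le> D * (1 + norm x) ^ l"
    unfolding moderate_def by blast
  have C0: "0 \<le> C" using order_trans[OF norm_ge_zero C[of 0]] by simp
  have D0: "0 \<le> D" using order_trans[OF norm_ge_zero D[of 0]] by simp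
  have "norm (f x + g x) \<le> (C + D) * (1 + norm x) ^ (k + l)" for x
  proof -
    have "C * (1 + norm x) ^ k \<le> C * (1 + norm x) ^ (k + l)" "D * (1 + norm x) ^ l \<le> D * (1 + norm x) ^ (k + l)"
      by (intro mult_left_mono power_increasing C0 D0; simp)+
    then show ?thesis
      using norm_triangle_ineq[of "f x" "g x"] C[of x] D[of x] by (simp add: algebra_simps)
  qed
  then show ?thesis unfolding moderate_def by blast
qed

lemma moderateI: "(\<And>x. norm (f x) \<le> C * (1 + norm x) ^ k) \<Longrightarrow> moderate f"
  unfolding moderate_def by blast

lemma rapid_imp_moderate: "rapid f \<Longrightarrow> moderate f"
  using rapid_bound[of f 0] by (metis moderateI mult.right_neutral mult_1 power_0)

lemma schwartz_differentiable: "f \<in> schwartz \<Longrightarrow> f differentiable (at x)"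
  unfolding schwartz_eq_smooth_with by (rule smooth_withD)

lemma schwartz_rapid: "f \<in> schwartz \<Longrightarrow> rapid f"
  unfolding schwartz_eq_smooth_with by (rule smooth_withD)

lemma schwartz_dir_deriv: "f \<in> schwartz \<Longrightarrow> b \<in> Basis \<Longrightarrow> dir_deriv b f \<in> schwartz"
  unfolding schwartz_eq_smooth_with by (rule smooth_with_dir_deriv)

lemma schwartz_iter_deriv: "f \<in> schwartz \<Longrightarrow> set bs \<subseteq> Basis \<Longrightarrow> iter_deriv bs f \<in> schwartz"
  by (induction bs) (auto intro: schwartz_dir_deriv)

lemma schwartz_add: "f \<in> schwartz \<Longrightarrow> g \<in> schwartz \<Longrightarrow> (\<lambda>x. f x + g x) \<in> schwartz"
  unfolding schwartz_eq_smooth_with by (rule smooth_with_add) (auto intro: rapid_add)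

lemma schwartz_moderate_mult: "a \<in> smooth_with moderate \<Longrightarrow> g \<in> schwartz \<Longrightarrow> (\<lambda>x. a x * g x) \<in> schwartz"
  unfolding schwartz_eq_smooth_with by (rule smooth_with_mult[where P=moderate and Q=rapid]) (auto intro: rapid_add moderate_mult_rapid)

lemma schwartz_smooth_moderate: "f \<in> schwartz \<Longrightarrow> f \<in> smooth_with moderate"
  unfolding schwartz_eq_smooth_with using smooth_with_mono[of rapid moderate] rapid_imp_moderate by blast

lemma schwartz_mult: "f \<in> schwartz \<Longrightarrow> g \<in> schwartz \<Longrightarrow> (\<lambda>x. f x * g x) \<in> schwartz"
  by (intro schwartz_moderate_mult schwartz_smooth_moderate)

lemma smooth_moderate_mult:
  "f \<in> smooth_with moderate \<Longrightarrow> g \<in> smooth_with moderate \<Longrightarrow> (\<lambda>x. f x * g x) \<in> smooth_with moderate"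
  by (rule smooth_with_mult[where P=moderate and Q=moderate]) (auto intro: moderate_add moderate_mult)

lemma smooth_moderate_add:
  "f \<in> smooth_with moderate \<Longrightarrow> g \<in> smooth_with moderate \<Longrightarrow> (\<lambda>x. f x + g x) \<in> smooth_with moderate"
  by (rule smooth_with_add) (auto intro: moderate_add)

lemma smooth_moderate_affine:
  "(\<lambda>x. c * of_real (x \<bullet> b) + d) \<in> smooth_with moderate"
proof (rule smooth_with_coinduct[where X="{\<lambda>x. c * of_real (x \<bullet> b) + d | c d. True}"])
  fix g :: "'a \<Rightarrow> complex" assume "g \<in> {\<lambda>x. c * of_real (x \<bullet> b) + d | c d. True}"
  then obtain c d where g: "g = (\<lambda>x. c * of_real (x \<bullet> b) + d)" by auto
  have D: "(g has_derivative (\<lambda>h. c * of_real (h \<bullet> b))) (at x)" for x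
    unfolding g by (auto intro!: derivative_eq_intros)
  show "g differentiable (at x)" for x using D differentiable_def by blast
  have "norm (g x) \<le> (norm c * norm b + norm d) * (1 + norm x) ^ 1" for x
  proof -
    have "norm (g x) \<le> norm c * \<bar>x \<bullet> b\<bar> + norm d"
      unfolding g by (rule order_trans[OF norm_triangle_ineq]) (simp add: norm_mult)
    also have "\<dots> \<le> norm c * (norm x * norm b) + norm d"
      by (intro add_mono mult_left_mono Cauchy_Schwarz_ineq2) auto
    also have "\<dots> \<le> (norm c * norm b + norm d) * (1 + norm x) ^ 1"
      by (simp add: algebra_simps)
    finally show ?thesis .
  qed
  then show "moderate g" by (rule moderateI)
  fix b' :: 'a
  have "dir_deriv b' g = (\<lambda>x. 0 * of_real (x \<bullet> b) + c * of_real (b' \<bullet> b))"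
    by (rule ext) (simp add: dir_deriv_eq[OF D])
  then show "dir_deriv b' g \<in> {\<lambda>x. c * of_real (x \<bullet> b) + d | c d. True}" by blast
qed auto

lemma schwartz_cmult: "f \<in> schwartz \<Longrightarrow> (\<lambda>x. c * f x) \<in> schwartz"
  using schwartz_moderate_mult[OF smooth_moderate_affine[of 0 _ c]] by simp

lemma schwartz_coord_mult: "f \<in> schwartz \<Longrightarrow> (\<lambda>x. of_real (x \<bullet> b) * f x) \<in> schwartz"
  using schwartz_moderate_mult[OF smooth_moderate_affine[of 1 b 0]] by simp

lemma smooth_moderate_exp:
  "(\<lambda>x. exp (\<i> * of_real (x \<bullet> y))) \<in> smooth_with moderate"
proof (rule smooth_with_coinduct[where X="{\<lambda>x. c * exp (\<i> * of_real (x \<bullet> y)) | c. True}"])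
  show "(\<lambda>x. exp (\<i> * of_real (x \<bullet> y))) \<in> {\<lambda>x. c * exp (\<i> * of_real (x \<bullet> y)) | c. True}"
    by (auto intro!: exI[of _ 1])
  fix g :: "'a \<Rightarrow> complex" assume "g \<in> {\<lambda>x. c * exp (\<i> * of_real (x \<bullet> y)) | c. True}"
  then obtain c where g: "g = (\<lambda>x. c * exp (\<i> * of_real (x \<bullet> y)))" by auto
  have e: "(exp has_derivative (\<lambda>h. exp z * h)) (at z)" for z :: complex
    using DERIV_exp[of z] by (simp add: has_field_derivative_def)
  have D: "(g has_derivative (\<lambda>h. c * (exp (\<i> * of_real (x \<bullet> y)) * (\<i> * of_real (h \<bullet> y))))) (at x)" for x
    unfolding g
    by (intro has_derivative_mult_right has_derivative_compose[OF _ e]) (auto intro!: derivative_eq_intros)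
  show "g differentiable (at x)" for x using D differentiable_def by blast
  show "moderate g" by (rule moderateI[of _ "norm c" 0]) (simp add: g norm_mult)
  fix b :: 'a
  have "dir_deriv b g = (\<lambda>x. (c * \<i> * of_real (b \<bullet> y)) * exp (\<i> * of_real (x \<bullet> y)))"
    by (rule ext) (simp add: dir_deriv_eq[OF D])
  then show "dir_deriv b g \<in> {\<lambda>x. c * exp (\<i> * of_real (x \<bullet> y)) | c. True}" by blast
qed

lemma schwartz_modulate: "f \<in> schwartz \<Longrightarrow> (\<lambda>x. exp (\<i> * of_real (x \<bullet> y)) * f x) \<in> schwartz"
  by (intro schwartz_moderate_mult smooth_moderate_exp)

text \<open>The scalar multiples k f(c x + a) with f a Schwartz function form the invariant class: a
  derivative replaces k by k c and f by its derivative.\<close>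

lemma schwartz_affine:
  assumes f: "f \<in> schwartz" and c: "c \<noteq> 0"
  shows "(\<lambda>x. f (c *\<^sub>R x + a)) \<in> schwartz"
  unfolding schwartz_eq_smooth_with
proof (rule smooth_with_coinduct[where X="{\<lambda>x. k * f (c *\<^sub>R x + a) | k f. f \<in> schwartz}"])
  show "(\<lambda>x. f (c *\<^sub>R x + a)) \<in> {\<lambda>x. k * f (c *\<^sub>R x + a) | k f. f \<in> schwartz}"
    using f by (auto intro!: exI[of _ 1] exI[of _ f])
  fix g assume "g \<in> {\<lambda>x. k * f (c *\<^sub>R x + a) | k f. f \<in> schwartz}"
  then obtain k f where g: "g = (\<lambda>x. k * f (c *\<^sub>R x + a))" and f: "f \<in> schwartz" by auto
  have D: "\<exists>f'. (g has_derivative (\<lambda>h. k * f' (c *\<^sub>R h))) (at x) \<and> (\<forall>b. dir_deriv b f (c *\<^sub>R x + a) = f' b) \<and> bounded_linear f'" for x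
  proof -
    obtain f' where f': "(f has_derivative f') (at (c *\<^sub>R x + a))" "\<And>b. dir_deriv b f (c *\<^sub>R x + a) = f' b"
      by (rule smooth_with_has_derivative[OF f[unfolded schwartz_eq_smooth_with], of "c *\<^sub>R x + a"]) blast
    have "((\<lambda>x. c *\<^sub>R x + a) has_derivative (\<lambda>h. c *\<^sub>R h)) (at x)"
      by (auto intro!: derivative_eq_intros)
    from has_derivative_compose[OF this f'(1)] f' show ?thesis
      unfolding g by (intro exI[of _ f'] conjI has_derivative_mult_right) (auto intro: has_derivative_bounded_linear)
  qed
  show "g differentiable (at x)" for x using D differentiable_def by blast
  show "rapid g" unfolding rapid_iff
  proof
    fix n
    obtain C where C: "0 \<le> C" "\<And>x. (1 + norm x) ^ n * norm (f x) \<le> C"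
      using rapid_bound[OF schwartz_rapid[OF f], of n] by blast
    \<comment> \<open>This constant turns decay in c x + a into decay in x, since norm x is at most
      (norm (c x + a) + norm a) / \<bar>c\<bar>.\<close>
    let ?L = "1 + (1 + norm a) / \<bar>c\<bar>"
    have L: "1 + norm x \<le> ?L * (1 + norm (c *\<^sub>R x + a))" for x
    proof -
      have "\<bar>c\<bar> * norm x = norm (c *\<^sub>R x)" by simp
      also have "\<dots> \<le> norm (c *\<^sub>R x + a) + norm a"
        using norm_triangle_ineq4[of "c *\<^sub>R x + a" a] by simp
      finally have "norm x \<le> (norm (c *\<^sub>R x + a) + norm a) / \<bar>c\<bar>"
        using c by (simp add: field_simps)
      also have "\<dots> \<le> (1 + norm a) * (1 + norm (c *\<^sub>R x + a)) / \<bar>c\<bar>"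
        by (intro divide_right_mono) (auto simp: algebra_simps)
      finally have "1 + norm x \<le> 1 * (1 + norm (c *\<^sub>R x + a)) + (1 + norm a) / \<bar>c\<bar> * (1 + norm (c *\<^sub>R x + a))"
        unfolding times_divide_eq_left by (intro add_mono) auto
      then show ?thesis by (simp only: distrib_right)
    qed
    have "(1 + norm x) ^ n * norm (g x) \<le> norm k * (?L ^ n * C)" for x
    proof -
      have "(1 + norm x) ^ n * norm (g x) \<le> (?L * (1 + norm (c *\<^sub>R x + a))) ^ n * norm (g x)"
        by (intro mult_right_mono power_mono L) auto
      also have "\<dots> = norm k * (?L ^ n * ((1 + norm (c *\<^sub>R x + a)) ^ n * norm (f (c *\<^sub>R x + a))))"
        by (simp add: g norm_mult power_mult_distrib mult_ac)
      also have "\<dots> \<le> norm k * (?L ^ n * C)"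
        by (intro mult_left_mono C) auto
      finally show ?thesis .
    qed
    then show "\<exists>C. \<forall>x. (1 + norm x) ^ n * norm (g x) \<le> C" by blast
  qed
  fix b :: 'a assume b: "b \<in> Basis"
  have "dir_deriv b g = (\<lambda>x. (k * of_real c) * dir_deriv b f (c *\<^sub>R x + a))"
  proof
    fix x
    obtain f' where f': "(g has_derivative (\<lambda>h. k * f' (c *\<^sub>R h))) (at x)"
      "\<forall>b. dir_deriv b f (c *\<^sub>R x + a) = f' b" "bounded_linear f'"
      using D by blast
    show "dir_deriv b g x = (k * of_real c) * dir_deriv b f (c *\<^sub>R x + a)"
      by (simp add: dir_deriv_eq[OF f'(1)] f'(2) linear_scale[OF bounded_linear.linear[OF f'(3)]] scaleR_conv_of_real)
  qed
  then show "dir_deriv b g \<in> {\<lambda>x. k * f (c *\<^sub>R x + a) | k f. f \<in> schwartz}"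
    using schwartz_dir_deriv[OF f b] by blast
qed

lemma schwartz_reflect: "f \<in> schwartz \<Longrightarrow> (\<lambda>x. f (a - x)) \<in> schwartz"
  using schwartz_affine[of f "-1" a] by simp

lemma schwartz_translate: "f \<in> schwartz \<Longrightarrow> (\<lambda>x. f (x - a)) \<in> schwartz"
  using schwartz_affine[of f "1" "-a"] by simp

text \<open>The left side is, up to the factorial, a single term of the exponential series with
  nonnegative terms.\<close>

lemma power_one_plus_norm_le_exp: "(1 + r) ^ k \<le> fact k * exp (1 + r)" if "0 \<le> r" for r :: real
proof -
  have "(\<Sum>n\<in>{k}. (1 + r) ^ n /\<^sub>R fact n) \<le> (\<Sum>n. (1 + r) ^ n /\<^sub>R fact n)"
    by (rule sum_le_suminf[OF summable_exp_generic]) (use that in auto)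
  then have "(1 + r) ^ k / fact k \<le> exp (1 + r)"
    by (simp add: exp_def divide_inverse mult.commute)
  then show ?thesis by (simp add: field_simps)
qed

text \<open>The invariant class consists of the Gaussian times smooth functions of moderate growth;
  differentiating the Gaussian only produces the linear factor - (x \<bullet> b).\<close>

lemma schwartz_gauss_1: "(\<lambda>x::'a::euclidean_space. complex_of_real (exp (- (x \<bullet> x) / 2))) \<in> schwartz"
  unfolding schwartz_eq_smooth_with
proof (rule smooth_with_coinduct[where X="{\<lambda>x. a x * of_real (exp (- (x \<bullet> x) / 2)) | a. a \<in> smooth_with moderate}"])
  show "(\<lambda>x::'a. complex_of_real (exp (- (x \<bullet> x) / 2))) \<in> {\<lambda>x. a x * of_real (exp (- (x \<bullet> x) / 2)) | a. a \<in> smooth_with moderate}"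
    using smooth_moderate_affine[of 0 "0::'a" 1] by (auto intro!: exI[of _ "\<lambda>x. 1"])
  fix g :: "'a \<Rightarrow> complex" assume "g \<in> {\<lambda>x. a x * of_real (exp (- (x \<bullet> x) / 2)) | a. a \<in> smooth_with moderate}"
  then obtain a where g: "g = (\<lambda>x. a x * of_real (exp (- (x \<bullet> x) / 2)))" and a: "a \<in> smooth_with moderate" by auto
  have e: "((\<lambda>x. complex_of_real (exp (- (x \<bullet> x) / 2))) has_derivative
      (\<lambda>h. of_real (exp (- (x \<bullet> x) / 2) * (- (x \<bullet> h))))) (at x)" for x :: 'a
    by (intro has_derivative_of_real) (auto intro!: derivative_eq_intros simp: inner_commute)
  have D: "\<exists>a'. (g has_derivative (\<lambda>h. a x * of_real (exp (- (x \<bullet> x) / 2) * (- (x \<bullet> h))) + a' h * of_real (exp (- (x \<bullet> x) / 2)))) (at x) \<and> (\<forall>b. dir_deriv b a x = a' b)" for x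
  proof -
    obtain a' where a': "(a has_derivative a') (at x)" "\<And>b. dir_deriv b a x = a' b"
      by (rule smooth_with_has_derivative[OF a, of x]) blast
    show ?thesis unfolding g using has_derivative_mult[OF a'(1) e] a'(2) by blast
  qed
  show "g differentiable (at x)" for x using D differentiable_def by blast
  have "rapid (\<lambda>x::'a. complex_of_real (exp (- (x \<bullet> x) / 2)))"
    unfolding rapid_iff
  proof
    fix k
    have "(1 + norm x) ^ k * norm (complex_of_real (exp (- (x \<bullet> x) / 2))) \<le> fact k * exp (3 / 2)" for x :: 'a
    proof -
      have "(1 + norm x) ^ k * norm (complex_of_real (exp (- (x \<bullet> x) / 2))) \<le> fact k * exp (1 + norm x) * exp (- (x \<bullet> x) / 2)"
        using power_one_plus_norm_le_exp[of "norm x" k] by (simp add: mult_right_mono)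
      also have "\<dots> = fact k * exp (1 + norm x - (norm x)\<^sup>2 / 2)"
        by (simp add: mult_exp_exp power2_norm_eq_inner)
      \<comment> \<open>Completing the square, from (norm x - 1)^2 \<ge> 0; hence the constant
        \<open>exp (3 / 2)\<close>.\<close>
      also have "1 + norm x - (norm x)\<^sup>2 / 2 \<le> 3 / 2"
        using zero_le_power2[of "norm x - 1"] by (simp add: power2_diff field_simps)
      finally show ?thesis by simp
    qed
    then show "\<exists>C. \<forall>x::'a. (1 + norm x) ^ k * norm (complex_of_real (exp (- (x \<bullet> x) / 2))) \<le> C" by blast
  qed
  then show "rapid g" unfolding g by (intro moderate_mult_rapid smooth_withD[OF a])
  fix b :: 'a assume b: "b \<in> Basis"
  have "dir_deriv b g = (\<lambda>x. (dir_deriv b a x + ((-1) * of_real (x \<bullet> b) + 0) * a x) * of_real (exp (- (x \<bullet> x) / 2)))"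
  proof
    fix x
    obtain a' where a': "(g has_derivative (\<lambda>h. a x * of_real (exp (- (x \<bullet> x) / 2) * (- (x \<bullet> h))) + a' h * of_real (exp (- (x \<bullet> x) / 2)))) (at x)" "\<forall>b. dir_deriv b a x = a' b"
      using D by blast
    show "dir_deriv b g x = (dir_deriv b a x + ((-1) * of_real (x \<bullet> b) + 0) * a x) * of_real (exp (- (x \<bullet> x) / 2))"
      by (simp add: dir_deriv_eq[OF a'(1)] a'(2) algebra_simps)
  qed
  moreover have "(\<lambda>x. dir_deriv b a x + ((-1) * of_real (x \<bullet> b) + 0) * a x) \<in> smooth_with moderate"
    using a b by (intro smooth_moderate_add smooth_moderate_mult smooth_moderate_affine smooth_with_dir_deriv)
  ultimately show "dir_deriv b g \<in> {\<lambda>x. a x * of_real (exp (- (x \<bullet> x) / 2)) | a. a \<in> smooth_with moderate}"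
    by (intro CollectI exI[of _ "\<lambda>x. dir_deriv b a x + ((-1) * of_real (x \<bullet> b) + 0) * a x"] conjI)
qed

lemma schwartz_gauss:
  assumes "0 < e"
  shows "(\<lambda>x. complex_of_real (gauss e (a - x))) \<in> schwartz"
proof -
  have "(\<lambda>x. complex_of_real (gauss e (a - x))) = (\<lambda>x. of_real ((2 * pi) powr (- real DIM('a) / 2) * inverse (e ^ DIM('a))) *
      complex_of_real (exp (- (((- inverse e) *\<^sub>R x + a /\<^sub>R e) \<bullet> ((- inverse e) *\<^sub>R x + a /\<^sub>R e)) / 2)))"
  proof
    fix x
    have "(- inverse e) *\<^sub>R x + a /\<^sub>R e = (a - x) /\<^sub>R e"
      by (simp add: scaleR_diff_right)
    moreover have "((a - x) /\<^sub>R e) \<bullet> ((a - x) /\<^sub>R e) / 2 = (norm (a - x))\<^sup>2 / (2 * e\<^sup>2)"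
      unfolding power2_norm_eq_inner inner_scaleR_left inner_scaleR_right
      using assms by (simp add: field_simps power2_eq_square)
    ultimately have "- (((- inverse e) *\<^sub>R x + a /\<^sub>R e) \<bullet> ((- inverse e) *\<^sub>R x + a /\<^sub>R e)) / 2 = - (norm (a - x))\<^sup>2 / (2 * e\<^sup>2)"
      by (simp only: minus_divide_left[symmetric])
    then show "complex_of_real (gauss e (a - x)) = of_real ((2 * pi) powr (- real DIM('a) / 2) * inverse (e ^ DIM('a))) *
      complex_of_real (exp (- (((- inverse e) *\<^sub>R x + a /\<^sub>R e) \<bullet> ((- inverse e) *\<^sub>R x + a /\<^sub>R e)) / 2))"
      unfolding gauss_def by (simp only: of_real_mult)
  qed
  then show ?thesis
    using schwartz_cmult[OF schwartz_affine[OF schwartz_gauss_1, of "- inverse e" "a /\<^sub>R e"]] assms by simp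
qed

section \<open>The Fourier transform on Schwartz functions\<close>

lemma has_derivative_imp_difference_quotient:
  assumes "(f has_derivative f') (at x)"
  shows "((\<lambda>t. (f (x + t *\<^sub>R b) - f x) /\<^sub>R t) \<longlongrightarrow> f' b) (at (0::real))"
proof -
  have lin: "linear f'" using has_derivative_bounded_linear[OF assms] by (rule bounded_linear.linear)
  have "((\<lambda>t. x + t *\<^sub>R b) has_derivative (\<lambda>t. t *\<^sub>R b)) (at 0)"
    by (auto intro!: derivative_eq_intros)
  then have "((\<lambda>t. f (x + t *\<^sub>R b)) has_derivative (\<lambda>t. f' (t *\<^sub>R b))) (at 0)"
    by (rule has_derivative_compose) (use assms in simp)
  then have "((\<lambda>t. norm (f (x + t *\<^sub>R b) - f x - t *\<^sub>R f' b) / norm t) \<longlongrightarrow> 0) (at 0)"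
    unfolding has_derivative_at by (simp add: linear_scale[OF lin])
  then have "((\<lambda>t. norm ((f (x + t *\<^sub>R b) - f x) /\<^sub>R t - f' b)) \<longlongrightarrow> 0) (at 0)"
  proof (rule Lim_transform_eventually)
    have "norm (f (x + t *\<^sub>R b) - f x - t *\<^sub>R f' b) / norm t = norm ((f (x + t *\<^sub>R b) - f x) /\<^sub>R t - f' b)"
      if "t \<noteq> 0" for t
    proof -
      have "(f (x + t *\<^sub>R b) - f x) /\<^sub>R t - f' b = (f (x + t *\<^sub>R b) - f x - t *\<^sub>R f' b) /\<^sub>R t"
        using that by (simp add: scaleR_diff_right)
      then show ?thesis by (simp add: divide_inverse mult.commute)
    qed
    then show "\<forall>\<^sub>F t in at 0. norm (f (x + t *\<^sub>R b) - f x - t *\<^sub>R f' b) / norm t = norm ((f (x + t *\<^sub>R b) - f x) /\<^sub>R t - f' b)"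
      by (auto simp: eventually_at intro!: exI[of _ 1])
  qed
  then show ?thesis unfolding tendsto_norm_zero_iff by (rule Lim_null[THEN iffD2])
qed

lemma integrable_lborel_pair_mult:
  fixes f g :: "'a::euclidean_space \<Rightarrow> complex"
  assumes f: "integrable lborel f" and g: "integrable lborel g"
  shows "integrable (lborel \<Otimes>\<^sub>M lborel) (\<lambda>(x, y). f x * g y)"
proof (rule lborel_pair.Fubini_integrable)
  have [measurable]: "f \<in> borel_measurable borel" "g \<in> borel_measurable borel" using f g by auto
  show "(\<lambda>(x, y). f x * g y) \<in> borel_measurable (lborel \<Otimes>\<^sub>M lborel)" by measurable
  show "integrable lborel (\<lambda>x. LINT y|lborel. norm (case (x, y) of (x, y) \<Rightarrow> f x * g y))"
    using f g by (simp add: norm_mult)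
  show "AE x in lborel. integrable lborel (\<lambda>y. case (x, y) of (x, y) \<Rightarrow> f x * g y)"
    using g by simp
qed

lemma norm_scaleR_inverse_le: "0 < t \<Longrightarrow> norm v \<le> t * c \<Longrightarrow> norm (v /\<^sub>R t) \<le> c" for t c :: real
  by (simp add: field_simps)

text \<open>The increments of \<open>F\<close> at x, rather than its derivatives near x, are
  dominated. This one bound passes to \<open>D y h\<close> as a limit of difference quotients, which
  also shows that \<open>D\<close> is measurable in y, and it majorizes the normalized remainder by
  \<open>2 * B y\<close>.\<close>

lemma has_derivative_integral:
  fixes F :: "'a::euclidean_space \<Rightarrow> 'b::euclidean_space \<Rightarrow> complex"
  assumes D: "\<And>y. ((\<lambda>x. F x y) has_derivative D y) (at x)"
    and bound: "\<And>h y. norm (F (x + h) y - F x y) \<le> norm h * B y"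
    and B: "integrable lborel B"
    and F: "\<And>x. integrable lborel (F x)"
  shows "((\<lambda>x. LINT y|lborel. F x y) has_derivative (\<lambda>h. LINT y|lborel. D y h)) (at x)"
    and "integrable lborel (\<lambda>y. D y h)"
proof -
  have lin: "bounded_linear (D y)" for y
    using D by (rule has_derivative_bounded_linear)
  have DQ: "(\<lambda>n. (F (x + inverse (real (Suc n)) *\<^sub>R h) y - F x y) /\<^sub>R inverse (real (Suc n))) \<longlonglongrightarrow> D y h" for h y
  proof -
    show ?thesis
      by (rule filterlim_compose[OF has_derivative_imp_difference_quotient[OF D]])
         (auto simp: filterlim_at simp del: of_nat_Suc intro!: LIMSEQ_inverse_real_of_nat)
  qed
  have meas [measurable]: "(\<lambda>y. D y h) \<in> borel_measurable borel" for h
    by (rule borel_measurable_LIMSEQ_metric[OF _ DQ])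
       (intro borel_measurable_scaleR borel_measurable_diff borel_measurable_const, use F in \<open>auto intro: borel_measurable_integrable\<close>)
  have Dbd: "norm (D y h) \<le> norm h * B y" for y h
  proof (rule tendsto_upperbound[OF tendsto_norm[OF DQ]])
    show "\<forall>\<^sub>F n in sequentially. norm ((F (x + inverse (real (Suc n)) *\<^sub>R h) y - F x y) /\<^sub>R inverse (real (Suc n))) \<le> norm h * B y"
    proof (rule always_eventually, rule allI)
      fix n
      have "norm (F (x + inverse (real (Suc n)) *\<^sub>R h) y - F x y) \<le> inverse (real (Suc n)) * (norm h * B y)"
        using bound[of "inverse (real (Suc n)) *\<^sub>R h" y] by (simp add: mult.assoc)
      then show "norm ((F (x + inverse (real (Suc n)) *\<^sub>R h) y - F x y) /\<^sub>R inverse (real (Suc n))) \<le> norm h * B y"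
        by (intro norm_scaleR_inverse_le) simp_all
    qed
  qed simp
  have Dint: "integrable lborel (\<lambda>y. D y h)" for h
    by (rule Bochner_Integration.integrable_bound[of _ "\<lambda>y. norm h * B y"])
       (use B in \<open>auto intro!: AE_I2 order_trans[OF Dbd] \<close>)
  then show "integrable lborel (\<lambda>y. D y h)" .
  have bl: "bounded_linear (\<lambda>h. LINT y|lborel. D y h)"
  proof (rule bounded_linear_intro[where K="LINT y|lborel. B y"])
    fix h k and r :: real
    show "(LINT y|lborel. D y (h + k)) = (LINT y|lborel. D y h) + (LINT y|lborel. D y k)"
      by (simp add: linear_add[OF bounded_linear.linear[OF lin]] Dint)
    show "(LINT y|lborel. D y (r *\<^sub>R h)) = r *\<^sub>R (LINT y|lborel. D y h)"
      by (simp add: linear_scale[OF bounded_linear.linear[OF lin]] Dint)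
    show "norm (LINT y|lborel. D y h) \<le> norm h * (LINT y|lborel. B y)"
    proof -
      have "norm (LINT y|lborel. D y h) \<le> (LINT y|lborel. norm (D y h))"
        by (rule integral_norm_bound)
      also have "\<dots> \<le> (LINT y|lborel. norm h * B y)"
        using B Dint by (intro integral_mono Dbd) auto
      finally show ?thesis by simp
    qed
  qed
  show "((\<lambda>x. LINT y|lborel. F x y) has_derivative (\<lambda>h. LINT y|lborel. D y h)) (at x)"
    unfolding has_derivative_at
  proof (intro conjI bl)
    show "(\<lambda>h. norm ((LINT y|lborel. F (x + h) y) - (LINT y|lborel. F x y) - (LINT y|lborel. D y h)) / norm h) \<midarrow>0\<rightarrow> 0"
      unfolding tendsto_at_iff_sequentially comp_def
    proof (intro allI impI)
      fix X :: "nat \<Rightarrow> 'a" assume X: "\<forall>i. X i \<in> UNIV - {0}" "X \<longlonglongrightarrow> 0"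
      let ?R = "\<lambda>i y. (F (x + X i) y - F x y - D y (X i)) /\<^sub>R norm (X i)"
      have eq: "norm ((LINT y|lborel. F (x + X i) y) - (LINT y|lborel. F x y) - (LINT y|lborel. D y (X i))) / norm (X i)
         = norm (LINT y|lborel. ?R i y)" for i
      proof -
        have "(LINT y|lborel. ?R i y) = ((LINT y|lborel. F (x + X i) y) - (LINT y|lborel. F x y) - (LINT y|lborel. D y (X i))) /\<^sub>R norm (X i)"
          by (simp add: F Dint)
        then show ?thesis
          by (simp only: norm_scaleR norm_inverse real_norm_def abs_norm_cancel abs_inverse divide_inverse mult.commute)
      qed
      have "(\<lambda>i. LINT y|lborel. ?R i y) \<longlonglongrightarrow> (LINT y|(lborel :: 'b measure). 0)"
      proof (rule integral_dominated_convergence[where w="\<lambda>y. 2 * B y"])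
        show "integrable lborel (\<lambda>y. 2 * B y)" using B by simp
        show "AE y in lborel. (\<lambda>i. ?R i y) \<longlonglongrightarrow> 0"
        proof (rule AE_I2)
          fix y
          have "((\<lambda>h. norm (F (x + h) y - F x y - D y h) / norm h) \<longlongrightarrow> 0) (at 0)"
            using D[of y] unfolding has_derivative_at by blast
          then have "(\<lambda>i. norm (F (x + X i) y - F x y - D y (X i)) / norm (X i)) \<longlonglongrightarrow> 0"
            using X unfolding tendsto_at_iff_sequentially comp_def by blast
          then show "(\<lambda>i. ?R i y) \<longlonglongrightarrow> 0"
            by (subst tendsto_norm_zero_iff[symmetric]) (simp add: divide_inverse mult.commute)
        qed
        show "AE y in lborel. norm (?R i y) \<le> 2 * B y" for i
        proof (rule AE_I2)
          fix y
          have "norm (F (x + X i) y - F x y - D y (X i)) \<le> norm (X i) * B y + norm (X i) * B y"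
            by (rule order_trans[OF norm_triangle_ineq4]) (intro add_mono bound Dbd)
          moreover have "0 < norm (X i)" using X(1) by auto
          ultimately show "norm (?R i y) \<le> 2 * B y"
            by (intro norm_scaleR_inverse_le) (simp_all add: algebra_simps)
        qed
      qed (use F meas in \<open>auto intro!: borel_measurable_integrable borel_measurable_scaleR borel_measurable_diff\<close>)
      then show "(\<lambda>i. norm ((LINT y|lborel. F (x + X i) y) - (LINT y|lborel. F x y) - (LINT y|lborel. D y (X i))) / norm (X i)) \<longlonglongrightarrow> 0"
        unfolding eq by (intro tendsto_norm_zero) simp
    qed
  qed
qed

section \<open>Integrability and increments of Schwartz functions\<close>

lemma schwartz_continuous: "f \<in> schwartz \<Longrightarrow> continuous_on A f"
  using schwartz_differentiable differentiable_imp_continuous_within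
  by (metis continuous_at_imp_continuous_on)

lemma schwartz_measurable: "f \<in> schwartz \<Longrightarrow> f \<in> borel_measurable borel"
  by (intro borel_measurable_continuous_onI schwartz_continuous)

lemma rapid_integrable:
  assumes "rapid f" and [measurable]: "f \<in> borel_measurable borel"
  shows "integrable lborel f"
proof -
  obtain C where C: "0 \<le> C" "\<And>x. norm (f x) \<le> C * inverse ((1 + norm x) ^ (2 * DIM('a)))"
    using rapid_bound_divide[OF assms(1)] by blast
  show ?thesis
    by (rule Bochner_Integration.integrable_bound[OF integrable_mult_right[OF integrable_inverse_one_plus_norm, of C]])
       (auto intro!: AE_I2 order_trans[OF C(2)] order_trans[OF _ abs_ge_self])
qed

lemma schwartz_integrable: "f \<in> schwartz \<Longrightarrow> integrable lborel f"
  by (intro rapid_integrable schwartz_rapid schwartz_measurable)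

lemma schwartz_bounded:
  assumes "f \<in> schwartz"
  obtains C where "0 \<le> C" "\<And>x. norm (f x) \<le> C"
  using rapid_bound[OF schwartz_rapid[OF assms], of 0] by auto

lemma one_plus_norm_add_le: "1 + norm (x + y) \<le> (1 + norm x) * (1 + norm (y::'a::real_normed_vector))"
  unfolding distrib_left distrib_right mult_1_left mult_1_right
  using norm_triangle_ineq[of x y] mult_nonneg_nonneg[OF norm_ge_zero[of x] norm_ge_zero[of y]] by linarith

lemma schwartz_has_derivative_bound:
  assumes f: "f \<in> schwartz"
  obtains C where "0 \<le> C" "\<And>x f' h. (f has_derivative f') (at x) \<Longrightarrow> norm (f' h) \<le> C * inverse ((1 + norm x) ^ N) * norm h"
proof -
  have "\<exists>C. 0 \<le> C \<and> (\<forall>x. norm (dir_deriv b f x) \<le> C * inverse ((1 + norm x) ^ N))" if "b \<in> Basis" for b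
    using rapid_bound_divide[OF schwartz_rapid[OF schwartz_dir_deriv[OF f that]], of N] by blast
  then obtain C where C: "\<And>b. b \<in> Basis \<Longrightarrow> 0 \<le> C b"
    "\<And>b x. b \<in> Basis \<Longrightarrow> norm (dir_deriv b f x) \<le> C b * inverse ((1 + norm x) ^ N)"
    by metis
  show ?thesis
  proof (rule that[of "\<Sum>b\<in>Basis. C b"])
    show "0 \<le> (\<Sum>b\<in>Basis. C b)" by (intro sum_nonneg C)
    fix x f' h assume f': "(f has_derivative f') (at x)"
    have lin: "linear f'" using has_derivative_bounded_linear[OF f'] by (rule bounded_linear.linear)
    have "f' h = f' (\<Sum>b\<in>Basis. (h \<bullet> b) *\<^sub>R b)" by (simp add: euclidean_representation)
    also have "\<dots> = (\<Sum>b\<in>Basis. (h \<bullet> b) *\<^sub>R f' b)"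
      by (simp add: linear_sum[OF lin] linear_scale[OF lin])
    also have "norm \<dots> \<le> (\<Sum>b\<in>Basis. norm h * (C b * inverse ((1 + norm x) ^ N)))"
    proof (rule sum_norm_le)
      fix b :: 'a assume b: "b \<in> Basis"
      have "norm (f' b) \<le> C b * inverse ((1 + norm x) ^ N)"
        using C(2)[OF b, of x] by (simp add: dir_deriv_eq[OF f'])
      then show "norm ((h \<bullet> b) *\<^sub>R f' b) \<le> norm h * (C b * inverse ((1 + norm x) ^ N))"
        using Basis_le_norm[OF b, of h] by (simp add: mult_mono)
    qed
    also have "\<dots> = (\<Sum>b\<in>Basis. C b) * inverse ((1 + norm x) ^ N) * norm h"
      by (simp add: sum_distrib_left sum_distrib_right mult_ac)
    finally show "norm (f' h) \<le> (\<Sum>b\<in>Basis. C b) * inverse ((1 + norm x) ^ N) * norm h" .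
  qed
qed

text \<open>The mean value theorem on the segment from x to x + a. The factor (1 + norm a)^N is the
  price of replacing the decay at an intermediate point by the decay at x. For N = 2d the bound is
  integrable in x, for N = 0 it is a global Lipschitz bound.\<close>

lemma schwartz_mean_value:
  assumes f: "f \<in> schwartz"
  obtains C where "0 \<le> C"
    "\<And>x a. norm (f (x + a) - f x) \<le> C * norm a * (1 + norm a) ^ N * inverse ((1 + norm x) ^ N)"
proof -
  obtain C where C: "0 \<le> C" "\<And>x f' h. (f has_derivative f') (at x) \<Longrightarrow> norm (f' h) \<le> C * inverse ((1 + norm x) ^ N) * norm h"
    using schwartz_has_derivative_bound[OF f, of N] by blast
  show ?thesis
  proof (rule that[OF C(1)])
    fix x a
    have "\<exists>f'. (f has_derivative f') (at z)" for z
      using schwartz_differentiable[OF f] differentiable_def by blast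
    then obtain f' where f': "\<And>z. (f has_derivative f' z) (at z)" by metis
    have "norm (f (x + a) - f x) \<le> C * ((1 + norm a) ^ N * inverse ((1 + norm x) ^ N)) * norm (x + a - x)"
    proof (rule differentiable_bound[where S="closed_segment x (x + a)" and f'=f'])
      fix z assume z: "z \<in> closed_segment x (x + a)"
      show "(f has_derivative f' z) (at z within closed_segment x (x + a))"
        using f' by (rule has_derivative_at_withinI)
      obtain t where t: "0 \<le> t" "t \<le> 1" "z = (1 - t) *\<^sub>R x + t *\<^sub>R (x + a)"
        using z by (auto simp: in_segment)
      then have "x = z + (- t *\<^sub>R a)" by (simp add: algebra_simps)
      then have "1 + norm x \<le> (1 + norm z) * (1 + norm (- t *\<^sub>R a))"
        by (metis one_plus_norm_add_le)
      also have "\<dots> \<le> (1 + norm z) * (1 + norm a)"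
        using t by (intro mult_left_mono add_left_mono) (auto simp: mult_left_le_one_le)
      finally have "(1 + norm x) ^ N \<le> (1 + norm z) ^ N * (1 + norm a) ^ N"
        unfolding power_mult_distrib[symmetric] by (intro power_mono) auto
      moreover have "0 < (1 + norm x) ^ N" "0 < (1 + norm z) ^ N"
        by (intro zero_less_power; simp add: add_pos_nonneg)+
      ultimately have "inverse ((1 + norm z) ^ N) \<le> (1 + norm a) ^ N * inverse ((1 + norm x) ^ N)"
        by (simp add: field_simps)
      then have "C * inverse ((1 + norm z) ^ N) * norm h \<le> C * ((1 + norm a) ^ N * inverse ((1 + norm x) ^ N)) * norm h" for h :: 'a
        using C(1) by (intro mult_right_mono mult_left_mono) auto
      then show "onorm (f' z) \<le> C * ((1 + norm a) ^ N * inverse ((1 + norm x) ^ N))"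
        using C(2)[OF f'] order_trans by (intro onorm_le) blast
    qed auto
    then show "norm (f (x + a) - f x) \<le> C * norm a * (1 + norm a) ^ N * inverse ((1 + norm x) ^ N)"
      by (simp add: mult_ac)
  qed
qed

text \<open>Every difference quotient has integral zero by translation invariance, and the mean
  value estimate allows passing to the limit by dominated convergence.\<close>

lemma integral_dir_deriv_schwartz:
  assumes f: "f \<in> schwartz"
  shows "(LINT x|lborel. dir_deriv b f x) = 0"
proof -
  obtain C where C: "0 \<le> C"
    "\<And>x a. norm (f (x + a) - f x) \<le> C * norm a * (1 + norm a) ^ (2 * DIM('a)) * inverse ((1 + norm x) ^ (2 * DIM('a)))"
    using schwartz_mean_value[OF f, of "2 * DIM('a)"] by blast
  let ?t = "\<lambda>n. inverse (real (Suc n))"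
  let ?Q = "\<lambda>n x. (f (x + ?t n *\<^sub>R b) - f x) /\<^sub>R ?t n"
  have fm [measurable]: "f \<in> borel_measurable borel" using f by (rule schwartz_measurable)
  have "(\<lambda>n. LINT x|lborel. ?Q n x) \<longlonglongrightarrow> (LINT x|lborel. dir_deriv b f x)"
  proof (rule integral_dominated_convergence[where w="\<lambda>x::'a. C * norm b * (1 + norm b) ^ (2 * DIM('a)) * inverse ((1 + norm x) ^ (2 * DIM('a)))"])
    have lim: "(\<lambda>n. ?Q n x) \<longlonglongrightarrow> dir_deriv b f x" for x
    proof -
      obtain f' where f': "(f has_derivative f') (at x)"
        using schwartz_differentiable[OF f] differentiable_def by blast
      show ?thesis unfolding dir_deriv_eq[OF f']
        by (rule filterlim_compose[OF has_derivative_imp_difference_quotient[OF f']])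
           (auto simp: filterlim_at simp del: of_nat_Suc intro!: LIMSEQ_inverse_real_of_nat)
    qed
    then show "AE x in lborel. (\<lambda>n. ?Q n x) \<longlonglongrightarrow> dir_deriv b f x" by simp
    show "dir_deriv b f \<in> borel_measurable lborel"
      by (rule borel_measurable_LIMSEQ_metric[OF _ lim]) measurable
    show "AE x in lborel. norm (?Q n x) \<le> C * norm b * (1 + norm b) ^ (2 * DIM('a)) * inverse ((1 + norm x) ^ (2 * DIM('a)))" for n
    proof (rule AE_I2)
      fix x :: 'a
      have t: "0 < ?t n" "?t n \<le> 1" by (auto simp: field_simps)
      have "norm (f (x + ?t n *\<^sub>R b) - f x) \<le> C * norm (?t n *\<^sub>R b) * (1 + norm (?t n *\<^sub>R b)) ^ (2 * DIM('a)) * inverse ((1 + norm x) ^ (2 * DIM('a)))"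
        by (rule C)
      also have "\<dots> \<le> C * norm (?t n *\<^sub>R b) * (1 + norm b) ^ (2 * DIM('a)) * inverse ((1 + norm x) ^ (2 * DIM('a)))"
        using t C(1) mult_right_mono[OF t(2), of "norm b"] by (intro mult_right_mono mult_left_mono power_mono) auto
      also have "\<dots> = ?t n * (C * norm b * (1 + norm b) ^ (2 * DIM('a)) * inverse ((1 + norm x) ^ (2 * DIM('a))))"
        using t by simp
      finally show "norm (?Q n x) \<le> C * norm b * (1 + norm b) ^ (2 * DIM('a)) * inverse ((1 + norm x) ^ (2 * DIM('a)))"
        using t(1) by (intro norm_scaleR_inverse_le)
    qed
  qed (auto intro!: integrable_mult_right integrable_inverse_one_plus_norm)
  moreover have "(LINT x|lborel. ?Q n x) = 0" for n
  proof -
    have "(LINT x|lborel. f (x + ?t n *\<^sub>R b) - f x) = 0"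
      using integral_lborel_translate[of f "?t n *\<^sub>R b"] integrable_lborel_translate[OF schwartz_integrable[OF f]]
        schwartz_integrable[OF f] by (subst Bochner_Integration.integral_diff) auto
    then show ?thesis by (subst integral_scaleR_right) simp
  qed
  ultimately show ?thesis by (simp add: LIMSEQ_const_iff)
qed

abbreviation fourier_const :: "'a::euclidean_space itself \<Rightarrow> complex" where
  "fourier_const _ \<equiv> complex_of_real ((2 * pi) powr (- real DIM('a) / 2))"

lemma inv_fourier_eq_fourier: "inv_fourier f x = fourier f (- x)"
  by (simp add: inv_fourier_def fourier_def inner_commute)

lemma norm_exp_i_times_of_real [simp]: "norm (exp (\<i> * complex_of_real t)) = 1"
  "norm (exp (- (\<i> * complex_of_real t))) = 1"
  by (simp_all add: norm_exp_eq_Re)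

lemma exp_i_measurable [measurable]: "(\<lambda>x. exp (\<i> * complex_of_real (x \<bullet> y))) \<in> borel_measurable borel"
  "(\<lambda>x. exp (- (\<i> * complex_of_real (x \<bullet> y)))) \<in> borel_measurable borel"
  by (auto intro!: borel_measurable_continuous_onI continuous_intros)

lemma integrable_exp_mult:
  assumes "integrable lborel f"
  shows "integrable lborel (\<lambda>x. exp (\<i> * complex_of_real (x \<bullet> y)) * f x)"
    and "integrable lborel (\<lambda>x. exp (- (\<i> * complex_of_real (x \<bullet> y))) * f x)"
proof -
  have [measurable]: "f \<in> borel_measurable borel" using assms by auto
  show "integrable lborel (\<lambda>x. exp (\<i> * complex_of_real (x \<bullet> y)) * f x)"
    by (rule Bochner_Integration.integrable_bound[OF assms]) (auto simp: norm_mult)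
  show "integrable lborel (\<lambda>x. exp (- (\<i> * complex_of_real (x \<bullet> y))) * f x)"
    by (rule Bochner_Integration.integrable_bound[OF assms]) (auto simp: norm_mult)
qed

lemma norm_exp_i_minus_one_le: "norm (exp (\<i> * complex_of_real t) - 1) \<le> \<bar>t\<bar>"
  using iexp_approx1[of t 0] by simp

text \<open>Differentiation under the integral: since \<bar>exp(\<i> t) - 1\<bar> \<le>
  \<bar>t\<bar>, the increments in \<xi> are dominated by norm y times norm (f y), which is
  integrable by rapid decrease.\<close>

lemma fourier_has_derivative:
  assumes f: "f \<in> schwartz"
  shows "(fourier f has_derivative (\<lambda>h. fourier (\<lambda>y. - \<i> * of_real (y \<bullet> h) * f y) \<xi>)) (at \<xi>)"
proof -
  have e: "(exp has_derivative (\<lambda>h. exp z * h)) (at z)" for z :: complex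
    using DERIV_exp[of z] by (simp add: has_field_derivative_def)
  have "((\<lambda>\<xi>. LINT y|lborel. exp (- \<i> * of_real (y \<bullet> \<xi>)) * f y) has_derivative
      (\<lambda>h. LINT y|lborel. exp (- \<i> * of_real (y \<bullet> \<xi>)) * (- \<i> * of_real (y \<bullet> h)) * f y)) (at \<xi>)"
  proof (rule has_derivative_integral(1)[where B="\<lambda>y. norm y * norm (f y)"])
    fix y
    show "((\<lambda>\<xi>. exp (- \<i> * of_real (y \<bullet> \<xi>)) * f y) has_derivative
        (\<lambda>h. exp (- \<i> * of_real (y \<bullet> \<xi>)) * (- \<i> * of_real (y \<bullet> h)) * f y)) (at \<xi>)"
      by (intro has_derivative_mult_left has_derivative_compose[OF _ e]) (auto intro!: derivative_eq_intros)
    fix h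
    have "exp (- \<i> * of_real (y \<bullet> (\<xi> + h))) * f y - exp (- \<i> * of_real (y \<bullet> \<xi>)) * f y
      = exp (- (\<i> * of_real (y \<bullet> \<xi>))) * (exp (\<i> * of_real (- (y \<bullet> h))) - 1) * f y"
      by (simp add: inner_add_right exp_add[symmetric] algebra_simps)
    also have "norm \<dots> = norm (exp (\<i> * of_real (- (y \<bullet> h))) - 1) * norm (f y)"
      by (simp only: norm_mult norm_exp_i_times_of_real mult_1_left)
    also have "\<dots> \<le> \<bar>- (y \<bullet> h)\<bar> * norm (f y)"
      by (intro mult_right_mono norm_exp_i_minus_one_le norm_ge_zero)
    also have "\<dots> \<le> (norm y * norm h) * norm (f y)"
      using Cauchy_Schwarz_ineq2[of y h] by (intro mult_right_mono) auto
    finally show "norm (exp (- \<i> * of_real (y \<bullet> (\<xi> + h))) * f y - exp (- \<i> * of_real (y \<bullet> \<xi>)) * f y) \<le> norm h * (norm y * norm (f y))"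
      by (simp add: mult_ac)
  next
    have "rapid (\<lambda>y. complex_of_real (norm y) * f y)"
      by (intro moderate_mult_rapid schwartz_rapid f moderateI[of _ 1 1]) simp
    then have "integrable lborel (\<lambda>y. complex_of_real (norm y) * f y)"
      using schwartz_measurable[OF f] by (intro rapid_integrable) auto
    from integrable_norm[OF this] show "integrable lborel (\<lambda>y. norm y * norm (f y))"
      by (simp add: norm_mult)
    show "integrable lborel (\<lambda>y. exp (- \<i> * of_real (y \<bullet> x)) * f y)" for x
      using integrable_exp_mult(2)[OF schwartz_integrable[OF f]] by simp
  qed
  from has_derivative_mult_right[OF this, of "fourier_const TYPE('a)"] show ?thesis
    unfolding fourier_def by (simp add: mult.assoc)
qed

lemma fourier_dir_deriv_left:
  assumes f: "f \<in> schwartz"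
  shows "dir_deriv b (fourier f) = fourier (\<lambda>y. - \<i> * of_real (y \<bullet> b) * f y)"
  by (rule ext) (rule dir_deriv_eq[OF fourier_has_derivative[OF f]])

text \<open>Integration by parts: the derivative of the product of f with the exponential is the
  derivative of a Schwartz function and so has integral zero.\<close>

lemma fourier_dir_deriv_right:
  assumes f: "f \<in> schwartz" and b: "b \<in> Basis"
  shows "fourier (dir_deriv b f) \<xi> = \<i> * of_real (\<xi> \<bullet> b) * fourier f \<xi>"
proof -
  let ?e = "\<lambda>y. exp (\<i> * of_real (y \<bullet> (- \<xi>)))"
  have g: "(\<lambda>y. ?e y * f y) \<in> schwartz" using schwartz_modulate[OF f, of "- \<xi>"] by simp
  have D: "dir_deriv b (\<lambda>y. ?e y * f y) y = ?e y * dir_deriv b f y - \<i> * of_real (\<xi> \<bullet> b) * (?e y * f y)" for y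
  proof -
    have e: "(exp has_derivative (\<lambda>h. exp z * h)) (at z)" for z :: complex
      using DERIV_exp[of z] by (simp add: has_field_derivative_def)
    obtain f' where f': "(f has_derivative f') (at y)"
      using schwartz_differentiable[OF f] differentiable_def by blast
    have e': "(?e has_derivative (\<lambda>h. ?e y * (\<i> * of_real (h \<bullet> (- \<xi>))))) (at y)"
      by (intro has_derivative_compose[OF _ e]) (auto intro!: derivative_eq_intros)
    show ?thesis
      unfolding dir_deriv_eq[OF f'] by (subst dir_deriv_eq[OF has_derivative_mult[OF e' f']])
        (simp add: algebra_simps inner_commute)
  qed
  have i1: "integrable lborel (\<lambda>y. ?e y * dir_deriv b f y)"
    by (intro integrable_exp_mult schwartz_integrable schwartz_dir_deriv f b)
  have i2: "integrable lborel (\<lambda>y. ?e y * f y)"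
    by (intro integrable_exp_mult schwartz_integrable f)
  have "0 = (LINT y|lborel. ?e y * dir_deriv b f y - \<i> * of_real (\<xi> \<bullet> b) * (?e y * f y))"
    using integral_dir_deriv_schwartz[OF g, of b] unfolding D by simp
  also have "\<dots> = (LINT y|lborel. ?e y * dir_deriv b f y) - \<i> * of_real (\<xi> \<bullet> b) * (LINT y|lborel. ?e y * f y)"
    using i1 i2 by (subst Bochner_Integration.integral_diff) auto
  finally show ?thesis unfolding fourier_def by (simp add: mult_ac)
qed

lemma norm_fourier_le:
  "norm (fourier f \<xi>) \<le> (2 * pi) powr (- real DIM('a) / 2) * (LINT y|lborel. norm (f (y::'a::euclidean_space)))"
proof -
  have "norm (LINT y|lborel. exp (- \<i> * of_real (y \<bullet> \<xi>)) * f y) \<le> (LINT y|lborel. norm (exp (- \<i> * of_real (y \<bullet> \<xi>)) * f y))"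
    by (rule integral_norm_bound)
  then show ?thesis by (simp add: fourier_def norm_mult mult_left_mono)
qed

text \<open>The transforms of Schwartz functions are an invariant class, since differentiating a
  transform multiplies the function by a coordinate. Decay is dual to this: a power of a coordinate
  times the transform is, in modulus, the transform of an iterated derivative and hence
  bounded.\<close>

lemma schwartz_fourier:
  assumes "f \<in> schwartz"
  shows "fourier f \<in> schwartz"
  unfolding schwartz_eq_smooth_with
proof (rule smooth_with_coinduct[where X="fourier ` schwartz"])
  fix g :: "'a \<Rightarrow> complex" assume "g \<in> fourier ` schwartz"
  then obtain f where f: "f \<in> schwartz" and g: "g = fourier f" by auto
  show "g differentiable (at x)" for x
    unfolding g using fourier_has_derivative[OF f] differentiable_def by blast
  show "dir_deriv b g \<in> fourier ` schwartz" for b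
  proof -
    have "(\<lambda>y. - \<i> * of_real (y \<bullet> b) * f y) = (\<lambda>y. (- \<i>) * (of_real (y \<bullet> b) * f y))"
      by (simp add: mult.assoc)
    moreover have "(\<lambda>y. (- \<i>) * (of_real (y \<bullet> b) * f y)) \<in> schwartz"
      by (intro schwartz_cmult schwartz_coord_mult f)
    ultimately show ?thesis
      unfolding g fourier_dir_deriv_left[OF f] by simp
  qed
  show "rapid g" unfolding rapid_iff
  proof
    fix k
    have it: "\<exists>C. \<forall>\<xi>. \<bar>\<xi> \<bullet> b\<bar> ^ k * norm (g \<xi>) \<le> C" if b: "b \<in> Basis" for b
    proof -
      have "\<bar>\<xi> \<bullet> b\<bar> ^ k * norm (g \<xi>) = norm (fourier (((dir_deriv b) ^^ k) f) \<xi>) \<and> ((dir_deriv b) ^^ k) f \<in> schwartz" for \<xi>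
        by (induction k)
           (auto simp: g f fourier_dir_deriv_right[OF _ b] norm_mult schwartz_dir_deriv[OF _ b] mult.assoc)
      then have "\<bar>\<xi> \<bullet> b\<bar> ^ k * norm (g \<xi>) \<le> (2 * pi) powr (- real DIM('a) / 2) * (LINT y|lborel. norm ((((dir_deriv b) ^^ k) f) y))" for \<xi>
        by (metis norm_fourier_le)
      then show ?thesis by blast
    qed
    then obtain C where C: "\<And>b \<xi>. b \<in> Basis \<Longrightarrow> \<bar>\<xi> \<bullet> b\<bar> ^ k * norm (g \<xi>) \<le> C b" by metis
    obtain C0 where C0: "\<And>\<xi>. norm (g \<xi>) \<le> C0"
      unfolding g using norm_fourier_le by blast
    \<comment> \<open>Decay in each coordinate separately gives decay in the norm: for the
      coordinate b of largest modulus, norm \<xi> is at most d times \<bar>\<xi> \<bullet> b\<bar>.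
      The maximum with 1 takes care of small \<xi>.\<close>
    have main: "(1 + norm \<xi>) ^ k \<le> (1 + real DIM('a)) ^ k * (1 + (\<Sum>b\<in>Basis. \<bar>\<xi> \<bullet> b\<bar> ^ k))" for \<xi> :: 'a
    proof -
      obtain b where b: "b \<in> Basis" "\<And>b'. b' \<in> Basis \<Longrightarrow> \<bar>\<xi> \<bullet> b'\<bar> \<le> \<bar>\<xi> \<bullet> b\<bar>"
      proof -
        have "Max ((\<lambda>b. \<bar>\<xi> \<bullet> b\<bar>) ` Basis) \<in> (\<lambda>b. \<bar>\<xi> \<bullet> b\<bar>) ` Basis"
          by (intro Max_in) auto
        then obtain b where "b \<in> Basis" "Max ((\<lambda>b. \<bar>\<xi> \<bullet> b\<bar>) ` Basis) = \<bar>\<xi> \<bullet> b\<bar>" by (rule imageE) blast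
        moreover have "\<bar>\<xi> \<bullet> b'\<bar> \<le> Max ((\<lambda>b. \<bar>\<xi> \<bullet> b\<bar>) ` Basis)" if "b' \<in> Basis" for b'
          using that by (intro Max_ge) auto
        ultimately show ?thesis using that by metis
      qed
      let ?m = "max 1 \<bar>\<xi> \<bullet> b\<bar>"
      have "norm \<xi> \<le> (\<Sum>b\<in>Basis. \<bar>\<xi> \<bullet> b\<bar>)" by (rule norm_le_l1)
      also have "\<dots> \<le> (\<Sum>b'\<in>(Basis::'a set). \<bar>\<xi> \<bullet> b\<bar>)" by (intro sum_mono b)
      finally have "norm \<xi> \<le> real DIM('a) * \<bar>\<xi> \<bullet> b\<bar>" by simp
      also have "\<dots> \<le> real DIM('a) * ?m" by (intro mult_left_mono) auto
      finally have "1 + norm \<xi> \<le> (1 + real DIM('a)) * ?m" by (simp add: algebra_simps)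
      then have "(1 + norm \<xi>) ^ k \<le> (1 + real DIM('a)) ^ k * ?m ^ k"
        unfolding power_mult_distrib[symmetric] by (intro power_mono) auto
      also have "?m ^ k \<le> 1 + \<bar>\<xi> \<bullet> b\<bar> ^ k" by (auto simp: max_def)
      also have "\<bar>\<xi> \<bullet> b\<bar> ^ k \<le> (\<Sum>b\<in>Basis. \<bar>\<xi> \<bullet> b\<bar> ^ k)"
        using b(1) by (intro member_le_sum) auto
      finally show ?thesis by (simp add: mult_left_mono)
    qed
    have "(1 + norm \<xi>) ^ k * norm (g \<xi>) \<le> (1 + real DIM('a)) ^ k * (C0 + (\<Sum>b\<in>Basis. C b))" for \<xi>
    proof -
      have "(1 + norm \<xi>) ^ k * norm (g \<xi>) \<le> (1 + real DIM('a)) ^ k * (1 + (\<Sum>b\<in>Basis. \<bar>\<xi> \<bullet> b\<bar> ^ k)) * norm (g \<xi>)"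
        by (intro mult_right_mono main) auto
      also have "\<dots> = (1 + real DIM('a)) ^ k * (norm (g \<xi>) + (\<Sum>b\<in>Basis. \<bar>\<xi> \<bullet> b\<bar> ^ k * norm (g \<xi>)))"
        by (simp add: algebra_simps sum_distrib_left sum_distrib_right)
      also have "\<dots> \<le> (1 + real DIM('a)) ^ k * (C0 + (\<Sum>b\<in>Basis. C b))"
        by (intro mult_left_mono add_mono sum_mono C C0) auto
      finally show ?thesis .
    qed
    then show "\<exists>C. \<forall>x. (1 + norm x) ^ k * norm (g x) \<le> C" by blast
  qed
qed (use assms in auto)

lemma schwartz_inv_fourier: "f \<in> schwartz \<Longrightarrow> inv_fourier f \<in> schwartz"
  using schwartz_reflect[OF schwartz_fourier, of f 0] by (simp add: inv_fourier_eq_fourier[abs_def])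

text \<open>Both sides are iterated integrals of one function whose kernel is symmetric and of
  modulus one, so Fubini applies to any two integrable functions.\<close>

lemma fourier_duality:
  fixes f g :: "'a::euclidean_space \<Rightarrow> complex"
  assumes f: "integrable lborel f" and g: "integrable lborel g"
  shows "(LINT x|lborel. fourier f x * g x) = (LINT x|lborel. f x * fourier g x)"
proof -
  have [measurable]: "f \<in> borel_measurable borel" "g \<in> borel_measurable borel"
    using f g by auto
  let ?F = "\<lambda>(x, y). exp (- \<i> * of_real (y \<bullet> x)) * f y * g x"
  have em [measurable]: "(\<lambda>z::'a \<times> 'a. exp (- \<i> * of_real (snd z \<bullet> fst z))) \<in> borel_measurable (lborel \<Otimes>\<^sub>M lborel)"
    unfolding lborel_prod measurable_lborel2 by (intro borel_measurable_continuous_onI continuous_intros)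
  have int: "integrable (lborel \<Otimes>\<^sub>M lborel) ?F"
  proof (rule Bochner_Integration.integrable_bound)
    show "integrable (lborel \<Otimes>\<^sub>M lborel) (\<lambda>(x, y). g x * f y)"
      by (rule integrable_lborel_pair_mult[OF g f])
    show "?F \<in> borel_measurable (lborel \<Otimes>\<^sub>M lborel)"
      unfolding split_beta by (intro borel_measurable_times em) measurable
  qed (auto simp: norm_mult)
  have "(LINT x|lborel. fourier f x * g x) = fourier_const TYPE('a) * (LINT x|lborel. (LINT y|lborel. ?F (x, y)))"
  proof -
    have "(LINT y|lborel. ?F (x, y)) = (LINT y|lborel. exp (- \<i> * of_real (y \<bullet> x)) * f y) * g x" for x
      by simp
    then show ?thesis unfolding fourier_def by (simp only: mult.assoc integral_mult_right_zero)
  qed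
  also have "(LINT x|lborel. (LINT y|lborel. ?F (x, y))) = (LINT y|lborel. (LINT x|lborel. ?F (x, y)))"
    using lborel_pair.Fubini_integral[of "\<lambda>x y. ?F (x, y)"] int by simp
  also have "(LINT y|lborel. (LINT x|lborel. ?F (x, y))) = (LINT y|lborel. f y * (LINT x|lborel. exp (- \<i> * of_real (x \<bullet> y)) * g x))"
    by (subst integral_mult_right_zero[symmetric]) (simp add: mult_ac inner_commute)
  also have "fourier_const TYPE('a) * (LINT y|lborel. f y * (LINT x|lborel. exp (- \<i> * of_real (x \<bullet> y)) * g x))
      = (LINT x|lborel. f x * fourier g x)"
    unfolding fourier_def by (subst integral_mult_right_zero[symmetric]) (simp only: mult.left_commute)
  finally show ?thesis .
qed

section \<open>Fourier inversion by Gaussian summation\<close>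

definition damp :: "real \<Rightarrow> 'a::euclidean_space \<Rightarrow> complex" where
  "damp e \<xi> = of_real (exp (- (e\<^sup>2 * (norm \<xi>)\<^sup>2) / 2))"

lemma norm_damp_le: "norm (damp e \<xi>) \<le> 1"
  by (simp add: damp_def)

lemma damp_measurable [measurable]: "damp e \<in> borel_measurable borel"
  unfolding damp_def by measurable

lemma damp_tendsto:
  assumes "e \<longlonglongrightarrow> 0"
  shows "(\<lambda>n. damp (e n) \<xi>) \<longlonglongrightarrow> 1"
proof -
  have "(\<lambda>n. complex_of_real (exp (- ((e n)\<^sup>2 * (norm \<xi>)\<^sup>2) / 2))) \<longlonglongrightarrow> of_real (exp (- (0\<^sup>2 * (norm \<xi>)\<^sup>2) / 2))"
    by (intro tendsto_intros assms) simp
  then show ?thesis by (simp add: damp_def)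
qed

lemma fourier_const_square:
  "fourier_const TYPE('a::euclidean_space) * (fourier_const TYPE('a) * of_real ((2 * pi) powr real DIM('a) * t)) = of_real t"
proof -
  have "(2 * pi) powr (- real DIM('a) / 2) * ((2 * pi) powr (- real DIM('a) / 2) * (2 * pi) powr real DIM('a)) = 1"
    by (simp add: powr_add[symmetric])
  then have "complex_of_real ((2 * pi) powr (- real DIM('a) / 2) * ((2 * pi) powr (- real DIM('a) / 2) * (2 * pi) powr real DIM('a)) * t) = of_real t"
    by simp
  then show ?thesis by (simp only: of_real_mult mult.assoc)
qed

lemma
  fixes x :: "'a::euclidean_space"
  assumes e: "0 < e"
  shows integrable_exp_damp: "integrable lborel (\<lambda>\<xi>. exp (\<i> * of_real (\<xi> \<bullet> x)) * damp e \<xi>)"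
    and fourier_exp_damp: "fourier (\<lambda>\<xi>. exp (\<i> * of_real (\<xi> \<bullet> x)) * damp e \<xi>) y
      = fourier_const TYPE('a) * of_real ((2 * pi) powr real DIM('a) * gauss e (x - y))"
proof -
  show "integrable lborel (\<lambda>\<xi>. exp (\<i> * of_real (\<xi> \<bullet> x)) * damp e \<xi>)"
    unfolding damp_def by (rule integrable_exp_char[OF e])
  have "exp (- \<i> * of_real (\<xi> \<bullet> y)) * (exp (\<i> * of_real (\<xi> \<bullet> x)) * damp e \<xi>)
      = exp (\<i> * of_real (\<xi> \<bullet> (x - y))) * damp e \<xi>" for \<xi>
  proof -
    have "\<i> * of_real (\<xi> \<bullet> (x - y)) = - \<i> * of_real (\<xi> \<bullet> y) + \<i> * complex_of_real (\<xi> \<bullet> x)"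
      by (simp add: inner_diff_right algebra_simps)
    then show ?thesis by (simp only: exp_add mult.assoc)
  qed
  then show "fourier (\<lambda>\<xi>. exp (\<i> * of_real (\<xi> \<bullet> x)) * damp e \<xi>) y
      = fourier_const TYPE('a) * of_real ((2 * pi) powr real DIM('a) * gauss e (x - y))"
    unfolding fourier_def damp_def by (simp only: integral_exp_char[OF e])
qed

text \<open>Duality against the damped exponential, whose transform is a multiple of a translated
  Gaussian. The damping makes the inversion integral converge absolutely for every integrable f,
  even if its transform is not integrable, and the result is a Gaussian average of f.\<close>

lemma regularized_inversion:
  fixes f :: "'a::euclidean_space \<Rightarrow> complex"
  assumes e: "0 < e" and f: "integrable lborel f"
  shows "fourier_const TYPE('a) * (LINT \<xi>|lborel. fourier f \<xi> * (exp (\<i> * of_real (\<xi> \<bullet> x)) * damp e \<xi>))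
    = (LINT y|lborel. of_real (gauss e (x - y)) * f y)"
proof -
  have "fourier_const TYPE('a) * (LINT \<xi>|lborel. fourier f \<xi> * (exp (\<i> * of_real (\<xi> \<bullet> x)) * damp e \<xi>))
    = fourier_const TYPE('a) * (LINT y|lborel. f y * (fourier_const TYPE('a) * of_real ((2 * pi) powr real DIM('a) * gauss e (x - y))))"
    using fourier_duality[OF f integrable_exp_damp[OF e, of x]] by (simp only: fourier_exp_damp[OF e])
  also have "\<dots> = (LINT y|lborel. f y * (fourier_const TYPE('a) * (fourier_const TYPE('a) * of_real ((2 * pi) powr real DIM('a) * gauss e (x - y)))))"
    by (subst integral_mult_right_zero[symmetric]) (simp only: mult.left_commute)
  finally show ?thesis unfolding fourier_const_square by (simp only: mult.commute)
qed

text \<open>Both sides of \<open>regularized_inversion\<close> converge as e tends to zero: the left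
  one by dominated convergence, because the transform of a Schwartz function is integrable, the
  right one because Gaussians are an approximate identity.\<close>

theorem inv_fourier_fourier:
  assumes f: "f \<in> schwartz"
  shows "inv_fourier (fourier f) = f"
proof
  fix x :: 'a
  define ee where "ee n = inverse (real (Suc n))" for n
  have e: "ee n > 0" "ee \<longlonglongrightarrow> 0" for n
    using LIMSEQ_inverse_real_of_nat by (auto simp: ee_def[abs_def])
  have F: "integrable lborel (fourier f)" by (intro schwartz_integrable schwartz_fourier f)
  have [measurable]: "f \<in> borel_measurable borel" "fourier f \<in> borel_measurable borel"
    using f by (auto intro: schwartz_measurable schwartz_fourier)
  obtain B where B: "\<And>x. norm (f x) \<le> B" using schwartz_bounded[OF f] by blast
  have "(\<lambda>n. LINT \<xi>|lborel. fourier f \<xi> * (exp (\<i> * of_real (\<xi> \<bullet> x)) * damp (ee n) \<xi>))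
      \<longlonglongrightarrow> (LINT \<xi>|lborel. exp (\<i> * of_real (x \<bullet> \<xi>)) * fourier f \<xi>)"
  proof (rule integral_dominated_convergence[where w="\<lambda>\<xi>. norm (fourier f \<xi>)"])
    show "AE \<xi> in lborel. (\<lambda>n. fourier f \<xi> * (exp (\<i> * of_real (\<xi> \<bullet> x)) * damp (ee n) \<xi>)) \<longlonglongrightarrow> exp (\<i> * of_real (x \<bullet> \<xi>)) * fourier f \<xi>"
    proof (rule AE_I2)
      fix \<xi>
      have "(\<lambda>n. fourier f \<xi> * (exp (\<i> * of_real (\<xi> \<bullet> x)) * damp (ee n) \<xi>)) \<longlonglongrightarrow> fourier f \<xi> * (exp (\<i> * of_real (\<xi> \<bullet> x)) * 1)"
        by (intro tendsto_intros damp_tendsto e)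
      then show "(\<lambda>n. fourier f \<xi> * (exp (\<i> * of_real (\<xi> \<bullet> x)) * damp (ee n) \<xi>)) \<longlonglongrightarrow> exp (\<i> * of_real (x \<bullet> \<xi>)) * fourier f \<xi>"
        by (simp add: inner_commute mult.commute)
    qed
    show "AE \<xi> in lborel. norm (fourier f \<xi> * (exp (\<i> * of_real (\<xi> \<bullet> x)) * damp (ee n) \<xi>)) \<le> norm (fourier f \<xi>)" for n
      using norm_damp_le by (auto simp: norm_mult intro!: mult_left_le AE_I2)
    show "(\<lambda>\<xi>. exp (\<i> * of_real (x \<bullet> \<xi>)) * fourier f \<xi>) \<in> borel_measurable lborel"
      by (subst inner_commute) measurable
  qed (use F in auto)
  then have "(\<lambda>n. LINT y|lborel. of_real (gauss (ee n) (x - y)) * f y) \<longlonglongrightarrow> inv_fourier (fourier f) x"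
    unfolding inv_fourier_def regularized_inversion[OF e(1) schwartz_integrable[OF f], symmetric]
    by (intro tendsto_mult_left)
  moreover have "(\<lambda>n. LINT y|lborel. of_real (gauss (ee n) (x - y)) * f y) \<longlonglongrightarrow> f x"
    using B e schwartz_continuous[OF f, of UNIV]
    by (intro gauss_mollify_tendsto[where B=B]) (auto simp: continuous_on_eq_continuous_at)
  ultimately show "inv_fourier (fourier f) x = f x" by (rule LIMSEQ_unique)
qed

lemma fourier_reflect:
  assumes [measurable]: "g \<in> borel_measurable borel"
  shows "fourier (\<lambda>x. g (- x)) \<xi> = fourier g (- \<xi>)"
  unfolding fourier_def
  using integral_lborel_reflect[of "\<lambda>x. exp (- \<i> * of_real (x \<bullet> - \<xi>)) * g x" 0] by simp

theorem fourier_inv_fourier: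
  assumes f: "f \<in> schwartz"
  shows "fourier (inv_fourier f) = f"
proof -
  have "fourier (inv_fourier f) = inv_fourier (fourier f)"
    using fourier_reflect[OF schwartz_measurable[OF schwartz_fourier[OF f]]]
    by (auto simp: inv_fourier_eq_fourier[abs_def])
  then show ?thesis using inv_fourier_fourier[OF f] by simp
qed

section \<open>Uniqueness of representing functions\<close>

text \<open>Gaussian averages approximate bounded continuous functions, and these approximate
  indicators of closed sets. So U integrates to zero over closed sets, which are stable under
  intersection and generate the Borel sets; hence it does so over every Borel set.\<close>

lemma AE_zero_of_gauss_integrals:
  fixes U :: "'a::euclidean_space \<Rightarrow> complex"
  assumes U: "integrable lborel U"
    and zero: "\<And>e y. 0 < e \<Longrightarrow> (LINT x|lborel. of_real (gauss e (x - y)) * U x) = 0"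
  shows "AE x in lborel. U x = 0"
proof -
  have [measurable]: "U \<in> borel_measurable borel" using U by auto
  define ee where "ee n = inverse (real (Suc n))" for n
  have e: "ee n > 0" "ee \<longlonglongrightarrow> 0" for n
    using LIMSEQ_inverse_real_of_nat by (auto simp: ee_def[abs_def])
  have cont0: "(LINT x|lborel. U x * of_real (g x)) = 0"
    if g: "continuous_on UNIV g" "\<And>x. \<bar>g x\<bar> \<le> 1" for g :: "'a \<Rightarrow> real"
  proof -
    have [measurable]: "g \<in> borel_measurable borel" using g(1) by (rule borel_measurable_continuous_onI)
    let ?\<psi> = "\<lambda>n x. LINT y|lborel. complex_of_real (gauss (ee n) (x - y)) * of_real (g y)"
    have ig: "integrable lborel (\<lambda>y. gauss (ee n) (x - y))" for n and x :: 'a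
      using integrable_lborel_reflect[OF integrable_gauss[OF e(1)]] .
    have ig1: "(LINT y|lborel. gauss (ee n) (x - y)) = 1" for n and x :: 'a
      using integral_lborel_reflect[of "gauss (ee n)" x] integral_gauss[OF e(1)[of n], where 'a='a] by simp
    have gle: "norm (complex_of_real (gauss (ee n) (x - y)) * of_real (g y)) \<le> gauss (ee n) (x - y)" for n and x y :: 'a
      using g(2)[of y] gauss_nonneg[OF e(1)[of n], of "x - y"] by (simp add: norm_mult mult_left_le)
    have bd: "norm (?\<psi> n x) \<le> 1" for n x
    proof -
      have "norm (?\<psi> n x) \<le> (LINT y|lborel. norm (complex_of_real (gauss (ee n) (x - y)) * of_real (g y)))"
        by (rule integral_norm_bound)
      also have "\<dots> \<le> (LINT y|lborel. gauss (ee n) (x - y))"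
      proof (rule integral_mono)
        have le: "norm (complex_of_real (gauss (ee n) (x - y)) * of_real (g y)) \<le> gauss (ee n) (x - y)" for y
          using g(2)[of y] gauss_nonneg[OF e(1)[of n], of "x - y"] by (simp add: norm_mult mult_left_le)
        then show "norm (complex_of_real (gauss (ee n) (x - y)) * of_real (g y)) \<le> gauss (ee n) (x - y)" for y .
        show "integrable lborel (\<lambda>y. norm (complex_of_real (gauss (ee n) (x - y)) * of_real (g y)))"
          by (rule Bochner_Integration.integrable_bound[OF ig[of n x]]) (auto intro!: AE_I2 order_trans[OF le abs_ge_self] simp del: of_nat_Suc)
      qed (rule ig)
      also have "\<dots> = 1" by (rule ig1)
      finally show ?thesis .
    qed
    have meas: "?\<psi> n \<in> borel_measurable borel" for n
      by measurable
    have "(\<lambda>n. LINT x|lborel. U x * ?\<psi> n x) \<longlonglongrightarrow> (LINT x|lborel. U x * of_real (g x))"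
    proof (rule integral_dominated_convergence[where w="\<lambda>x. norm (U x)"])
      show "AE x in lborel. (\<lambda>n. U x * ?\<psi> n x) \<longlonglongrightarrow> U x * of_real (g x)"
      proof (intro AE_I2 tendsto_mult_left)
        fix x
        show "(\<lambda>n. ?\<psi> n x) \<longlonglongrightarrow> of_real (g x)"
          using g e by (intro gauss_mollify_tendsto[where B=1]) (auto simp: continuous_on_eq_continuous_at intro!: continuous_intros)
      qed
      show "AE x in lborel. norm (U x * ?\<psi> n x) \<le> norm (U x)" for n
        unfolding norm_mult using bd by (intro AE_I2 mult_left_le) auto
    qed (use U meas in auto)
    \<comment> \<open>After exchanging the integrals, the inner one is the hypothesis with the
      Gaussian centred at y.\<close>
    moreover have "(LINT x|lborel. U x * ?\<psi> n x) = 0" for n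
    proof -
      let ?F = "\<lambda>(x, y). U x * (complex_of_real (gauss (ee n) (x - y)) * of_real (g y))"
      have int: "integrable (lborel \<Otimes>\<^sub>M lborel) ?F"
      proof (rule lborel_pair.Fubini_integrable)
        show "?F \<in> borel_measurable (lborel \<Otimes>\<^sub>M lborel)" by measurable
        have I: "integrable lborel (\<lambda>y. complex_of_real (gauss (ee n) (x - y)) * of_real (g y))" for x
          by (rule Bochner_Integration.integrable_bound[OF ig[of n x]])
             (use g(2) gauss_nonneg[OF e(1)[of n]] in \<open>auto simp: norm_mult intro!: AE_I2 mult_left_le\<close>)
        then show "AE x in lborel. integrable lborel (\<lambda>y. ?F (x, y))" by simp
        have le: "(LINT y|lborel. norm (?F (x, y))) \<le> norm (U x)" for x
        proof -
          have "(LINT y|lborel. norm (?F (x, y))) \<le> (LINT y|lborel. norm (U x) * gauss (ee n) (x - y))"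
          proof (rule integral_mono)
            show "integrable lborel (\<lambda>y. norm (?F (x, y)))"
              using integrable_norm[OF integrable_mult_right[OF I[of x], of "U x"]] by simp
            show "norm (?F (x, y)) \<le> norm (U x) * gauss (ee n) (x - y)" for y
              using mult_left_mono[OF gle[of n x y] norm_ge_zero[of "U x"]] by (simp only: prod.case norm_mult)
          qed (intro integrable_mult_right ig)
          then show ?thesis by (simp add: ig1)
        qed
        show "integrable lborel (\<lambda>x. LINT y|lborel. norm (?F (x, y)))"
        proof (rule Bochner_Integration.integrable_bound[OF integrable_norm[OF U]])
          show "AE x in lborel. norm (LINT y|lborel. norm (?F (x, y))) \<le> norm (norm (U x))"
            using le by (auto simp: abs_of_nonneg integral_nonneg_AE)
        qed measurable
      qed
      have "(LINT x|lborel. U x * ?\<psi> n x) = (LINT x|lborel. (LINT y|lborel. ?F (x, y)))" by simp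
      also have "\<dots> = (LINT y|lborel. (LINT x|lborel. ?F (x, y)))"
        using lborel_pair.Fubini_integral[of "\<lambda>x y. ?F (x, y)"] int by simp
      also have "(LINT y|lborel. (LINT x|lborel. ?F (x, y))) = (LINT y|(lborel :: 'a measure). 0)"
      proof (rule Bochner_Integration.integral_cong)
        fix y
        have "(LINT x|lborel. ?F (x, y)) = (LINT x|lborel. of_real (g y) * (of_real (gauss (ee n) (x - y)) * U x))"
          by (simp add: mult_ac)
        then show "(LINT x|lborel. ?F (x, y)) = 0"
          by (simp only: integral_mult_right_zero zero[OF e(1)] mult_zero_right)
      qed simp
      finally show ?thesis by simp
    qed
    ultimately show ?thesis by (simp add: LIMSEQ_const_iff)
  qed
  have closed0: "(LINT x:A|lborel. U x) = 0" if A: "closed A" for A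
  proof (cases "A = {}")
    case False
    \<comment> \<open>These continuous functions are one on A and eventually zero at each point
      outside, because the distance to a closed set is positive there.\<close>
    let ?g = "\<lambda>k x. max 0 (1 - real k * infdist x A)"
    have gc: "continuous_on UNIV (?g k)" for k by (intro continuous_intros)
    have [measurable]: "?g k \<in> borel_measurable borel" for k
      using gc by (rule borel_measurable_continuous_onI)
    have [measurable]: "A \<in> sets borel" using A by auto
    have gb: "\<bar>?g k x\<bar> \<le> 1" for k x using infdist_nonneg[of x A] by (auto simp: max_def)
    have "(\<lambda>k. LINT x|lborel. U x * of_real (?g k x)) \<longlonglongrightarrow> (LINT x|lborel. indicat_real A x *\<^sub>R U x)"
    proof (rule integral_dominated_convergence[where w="\<lambda>x. norm (U x)"])
      show "AE x in lborel. (\<lambda>k. U x * of_real (?g k x)) \<longlonglongrightarrow> indicat_real A x *\<^sub>R U x"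
      proof (rule AE_I2)
        fix x
        have "(\<lambda>k. ?g k x) \<longlonglongrightarrow> indicat_real A x"
        proof (cases "x \<in> A")
          case True
          then show ?thesis using False by simp
        next
          case notin: False
          then have pos: "0 < infdist x A"
            using A False in_closed_iff_infdist_zero infdist_nonneg[of x A] by fastforce
          have "\<forall>\<^sub>F k in sequentially. ?g k x = 0"
            using eventually_ge_at_top[of "nat \<lceil>1 / infdist x A\<rceil>"]
          proof eventually_elim
            case (elim k)
            then have "1 / infdist x A \<le> real k" by linarith
            then show ?case using pos by (simp add: field_simps)
          qed
          then show ?thesis using notin by (simp add: tendsto_eventually)
        qed
        then have "(\<lambda>k. U x * of_real (?g k x)) \<longlonglongrightarrow> U x * of_real (indicat_real A x)"
          by (intro tendsto_intros)
        then show "(\<lambda>k. U x * of_real (?g k x)) \<longlonglongrightarrow> indicat_real A x *\<^sub>R U x"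
          by (simp add: scaleR_conv_of_real mult.commute)
      qed
      show "AE x in lborel. norm (U x * of_real (?g k x)) \<le> norm (U x)" for k
        unfolding norm_mult norm_of_real using gb by (intro AE_I2 mult_left_le) auto
    qed (use U in auto)
    then show ?thesis
      using cont0[OF gc gb] by (simp add: set_lebesgue_integral_def LIMSEQ_const_iff)
  qed (simp add: set_lebesgue_integral_def)
  have all: "(LINT x:A|lborel. U x) = 0" if "A \<in> sets borel" for A
  proof -
    have sub: "set_integrable lborel B U" if "B \<in> sigma_sets UNIV (Collect closed)" for B
      using that U unfolding set_integrable_def
      by (intro integrable_mult_indicator) (auto simp: borel_eq_closed)
    have "Int_stable (Collect closed :: 'a set set)" "Collect closed \<subseteq> Pow (UNIV :: 'a set)"
      "A \<in> sigma_sets UNIV (Collect closed)"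
      using that by (auto simp: borel_eq_closed Int_stable_def)
    then show ?thesis
    proof (induction rule: sigma_sets_induct_disjoint)
      case (basic A)
      then show ?case using closed0 by simp
    next
      case empty
      show ?case by (simp add: set_lebesgue_integral_def)
    next
      case (compl A)
      have "(LINT x:UNIV|lborel. U x) = (LINT x:A|lborel. U x) + (LINT x:UNIV - A|lborel. U x)"
        using set_integral_Un[of A "UNIV - A" lborel U] sub[OF compl(1)] sub[OF sigma_sets.Compl[OF compl(1)]] by simp
      then show ?case using compl(2) closed0[of UNIV] by simp
    next
      case (union A)
      have "(LINT x:(\<Union>i. A i)|lborel. U x) = (\<Sum>i. (LINT x:(A i)|lborel. U x))"
      proof (rule lebesgue_integral_countable_add)
        show "A i \<in> sets lborel" for i using union(2) by (auto simp: borel_eq_closed)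
        show "set_integrable lborel (\<Union>i. A i) U" using union(2) by (intro sub sigma_sets.Union) auto
      qed (use union(1) in \<open>auto simp: disjoint_family_on_def\<close>)
      then show ?case using union(3) by simp
    qed
  qed
  show ?thesis
    by (rule sigma_finite_measure.density_zero[OF sigma_finite_lborel U]) (use all in simp)
qed

text \<open>Here u need not be integrable, but its product with a Gaussian is, and further Gaussians
  times that one are still Schwartz functions. Dividing by the Gaussian is harmless because it never
  vanishes.\<close>

lemma AE_zero_of_schwartz_integrals:
  fixes u :: "'a::euclidean_space \<Rightarrow> complex"
  assumes [measurable]: "u \<in> borel_measurable borel"
    and int: "\<And>\<psi>. \<psi> \<in> schwartz \<Longrightarrow> integrable lborel (\<lambda>x. u x * \<psi> x)"
    and zero: "\<And>\<psi>. \<psi> \<in> schwartz \<Longrightarrow> (LINT x|lborel. u x * \<psi> x) = 0"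
  shows "AE x in lborel. u x = 0"
proof -
  let ?g = "\<lambda>x::'a. complex_of_real (gauss 1 (0 - x))"
  have g: "?g \<in> schwartz" by (rule schwartz_gauss) simp
  have "AE x in lborel. u x * ?g x = 0"
  proof (rule AE_zero_of_gauss_integrals[OF int[OF g]])
    fix e :: real and y :: 'a assume e: "0 < e"
    have "(\<lambda>x. complex_of_real (gauss e (y - x)) * ?g x) \<in> schwartz"
      by (intro schwartz_mult schwartz_gauss e) simp
    note zero[OF this]
    moreover have "of_real (gauss e (x - y)) * (u x * ?g x) = u x * (of_real (gauss e (y - x)) * ?g x)" for x
      using gauss_minus[of e "y - x"] by (simp add: mult_ac)
    ultimately show "(LINT x|lborel. of_real (gauss e (x - y)) * (u x * ?g x)) = 0" by presburger
  qed
  then show ?thesis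
    by eventually_elim (auto simp: gauss_def)
qed

lemma AE_eq_of_schwartz_integrals:
  fixes u v :: "'a::euclidean_space \<Rightarrow> complex"
  assumes u: "u \<in> borel_measurable borel" and v: "v \<in> borel_measurable borel"
    and iu: "\<And>\<psi>. \<psi> \<in> schwartz \<Longrightarrow> integrable lborel (\<lambda>x. u x * \<psi> x)"
    and iv: "\<And>\<psi>. \<psi> \<in> schwartz \<Longrightarrow> integrable lborel (\<lambda>x. v x * \<psi> x)"
    and eq: "\<And>\<psi>. \<psi> \<in> schwartz \<Longrightarrow> (LINT x|lborel. u x * \<psi> x) = (LINT x|lborel. v x * \<psi> x)"
  shows "AE x in lborel. u x = v x"
proof -
  have "AE x in lborel. u x - v x = 0"
    by (rule AE_zero_of_schwartz_integrals) (use assms in \<open>auto simp: left_diff_distrib\<close>)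
  then show ?thesis by eventually_elim simp
qed

section \<open>The Fourier transform on square-integrable functions\<close>

definition sqnorm :: "('a::euclidean_space \<Rightarrow> complex) \<Rightarrow> ennreal" where
  "sqnorm v = (\<integral>\<^sup>+x. ennreal ((norm (v x))\<^sup>2) \<partial>lborel)"

lemma sqnorm_cong_AE: "AE x in lborel. u x = v x \<Longrightarrow> sqnorm u = sqnorm v"
  unfolding sqnorm_def by (rule nn_integral_cong_AE) auto

lemma norm_integral_le_nn_integral:
  "ennreal (norm (LINT x|M. f x)) \<le> (\<integral>\<^sup>+x. ennreal (norm (f x)) \<partial>M)"
  using integral_norm_bound_ennreal[of M f] by (cases "integrable M f") (auto simp: not_integrable_integral_eq)

lemma norm_mult_integral_le:
  assumes [measurable]: "u \<in> borel_measurable borel" "v \<in> borel_measurable borel"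
  shows "(\<integral>\<^sup>+x. ennreal (norm (u x * v x)) \<partial>lborel)\<^sup>2 \<le> sqnorm u * sqnorm v"
  using Cauchy_Schwarz_nn_integral[of "\<lambda>x. ennreal (norm (u x))" lborel "\<lambda>x. ennreal (norm (v x))"]
  by (simp add: sqnorm_def norm_mult ennreal_mult ennreal_power)

lemma integrable_mult_of_sqnorm:
  assumes [measurable]: "u \<in> borel_measurable borel" "v \<in> borel_measurable borel"
    and "sqnorm u < \<infinity>" "sqnorm v < \<infinity>"
  shows "integrable lborel (\<lambda>x. u x * v x)"
proof (rule integrableI_bounded)
  have "(\<integral>\<^sup>+x. ennreal (norm (u x * v x)) \<partial>lborel)\<^sup>2 < \<infinity>"
    using norm_mult_integral_le[of u v] assms by (auto intro: order_le_less_trans simp: ennreal_mult_less_top)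
  then show "(\<integral>\<^sup>+x. ennreal (norm (u x * v x)) \<partial>lborel) < \<infinity>"
    by (simp add: power_less_top_ennreal)
qed measurable

lemma schwartz_sqnorm: "f \<in> schwartz \<Longrightarrow> sqnorm f < \<infinity>"
proof -
  assume f: "f \<in> schwartz"
  have "integrable lborel (\<lambda>x. f x * f x)" by (intro schwartz_integrable schwartz_mult f)
  then show ?thesis
    by (simp add: sqnorm_def integrable_iff_bounded norm_mult power2_eq_square)
qed

lemma fourier_measurable [measurable]:
  assumes [measurable]: "f \<in> borel_measurable borel"
  shows "fourier f \<in> borel_measurable borel"
proof -
  have em [measurable]: "(\<lambda>z::'a \<times> 'a. exp (- \<i> * of_real (snd z \<bullet> fst z))) \<in> borel_measurable (lborel \<Otimes>\<^sub>M lborel)"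
    unfolding lborel_prod measurable_lborel2 by (intro borel_measurable_continuous_onI continuous_intros)
  have "(\<lambda>z::'a \<times> 'a. exp (- \<i> * of_real (snd z \<bullet> fst z)) * f (snd z)) \<in> borel_measurable (lborel \<Otimes>\<^sub>M lborel)"
    by (intro borel_measurable_times em) measurable
  then have "(\<lambda>\<xi>. LINT y|lborel. exp (- \<i> * of_real (y \<bullet> \<xi>)) * f y) \<in> borel_measurable lborel"
    by (intro lborel.borel_measurable_lebesgue_integral) (simp add: split_beta)
  then show ?thesis unfolding fourier_def[abs_def] by simp
qed

lemma fourier_diff:
  assumes "integrable lborel f" "integrable lborel g"
  shows "fourier (\<lambda>x. f x - g x) \<xi> = fourier f \<xi> - fourier g \<xi>"
  using integrable_exp_mult(2)[OF assms(1), of \<xi>] integrable_exp_mult(2)[OF assms(2), of \<xi>]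
  by (simp add: fourier_def right_diff_distrib)

text \<open>Schur's test: ab \<le> (a^2 + b^2)/2 separates the variables, and the symmetric kernel
  has mass one in each of them.\<close>

lemma nn_integral_gauss_convolution_le:
  assumes [measurable]: "v \<in> borel_measurable borel" and e: "0 < e"
  shows "(\<integral>\<^sup>+x. (\<integral>\<^sup>+y. ennreal (norm (v x)) * ennreal (norm (v y)) * ennreal (gauss e (x - y)) \<partial>lborel) \<partial>lborel) \<le> sqnorm (v::'a::euclidean_space \<Rightarrow> complex)"
proof -
  have g1: "(\<integral>\<^sup>+y. ennreal (gauss e (x - y)) \<partial>lborel) = 1" for x :: 'a
  proof -
    have "(\<integral>\<^sup>+y. ennreal (gauss e (x - y)) \<partial>lborel) = (\<integral>\<^sup>+y. ennreal (gauss e (y::'a)) \<partial>lborel)"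
      by (rule nn_integral_lborel_reflect) measurable
    also have "\<dots> = ennreal (LINT y|lborel. gauss e (y::'a))"
      by (rule nn_integral_eq_integral) (use e gauss_nonneg in \<open>auto intro: integrable_gauss\<close>)
    finally show ?thesis using integral_gauss[OF e, where 'a='a] by simp
  qed
  have sym: "gauss e (x - y) = gauss e (y - x)" for x y :: 'a
    using gauss_minus[of e "y - x"] by simp
  let ?A = "\<lambda>x y. ennreal ((norm (v x))\<^sup>2) * ennreal (gauss e (x - y))"
  have "ennreal (norm (v x)) * ennreal (norm (v y)) * ennreal (gauss e (x - y))
      \<le> ennreal (1/2) * ?A x y + ennreal (1/2) * ?A y x" for x y
  proof -
    have "norm (v x) * norm (v y) \<le> 1/2 * (norm (v x))\<^sup>2 + 1/2 * (norm (v y))\<^sup>2"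
      using zero_le_power2[of "norm (v x) - norm (v y)"] by (simp add: power2_diff)
    then have "norm (v x) * norm (v y) * gauss e (x - y)
        \<le> 1/2 * ((norm (v x))\<^sup>2 * gauss e (x - y)) + 1/2 * ((norm (v y))\<^sup>2 * gauss e (x - y))"
      using mult_right_mono[OF _ gauss_nonneg[OF e, of "x - y"]] by (fastforce simp: distrib_right)
    then have "ennreal (norm (v x) * norm (v y) * gauss e (x - y))
        \<le> ennreal (1/2 * ((norm (v x))\<^sup>2 * gauss e (x - y)) + 1/2 * ((norm (v y))\<^sup>2 * gauss e (x - y)))"
      by (rule ennreal_leI)
    also have "\<dots> = ennreal (1/2) * ennreal ((norm (v x))\<^sup>2 * gauss e (x - y)) + ennreal (1/2) * ennreal ((norm (v y))\<^sup>2 * gauss e (x - y))"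
      using gauss_nonneg[OF e, of "x - y"] by (simp only: ennreal_plus ennreal_mult' mult_nonneg_nonneg zero_le_power2 zero_le_divide_1_iff zero_le_numeral)
    finally show ?thesis
      unfolding sym[of y x] using gauss_nonneg[OF e, of "x - y"]
      by (simp only: ennreal_mult' norm_ge_zero mult_nonneg_nonneg zero_le_power2)
  qed
  then have "(\<integral>\<^sup>+x. (\<integral>\<^sup>+y. ennreal (norm (v x)) * ennreal (norm (v y)) * ennreal (gauss e (x - y)) \<partial>lborel) \<partial>lborel)
    \<le> (\<integral>\<^sup>+x. (\<integral>\<^sup>+y. ennreal (1/2) * ?A x y + ennreal (1/2) * ?A y x \<partial>lborel) \<partial>lborel)"
    by (intro nn_integral_mono)
  also have "\<dots> = ennreal (1/2) * (\<integral>\<^sup>+x. (\<integral>\<^sup>+y. ?A x y \<partial>lborel) \<partial>lborel) + ennreal (1/2) * (\<integral>\<^sup>+x. (\<integral>\<^sup>+y. ?A y x \<partial>lborel) \<partial>lborel)"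
    by (simp add: nn_integral_add nn_integral_cmult)
  also have "(\<integral>\<^sup>+x. (\<integral>\<^sup>+y. ?A y x \<partial>lborel) \<partial>lborel) = (\<integral>\<^sup>+x. (\<integral>\<^sup>+y. ?A x y \<partial>lborel) \<partial>lborel)"
    by (rule lborel_pair.Fubini') measurable
  also have "(\<integral>\<^sup>+x. (\<integral>\<^sup>+y. ?A x y \<partial>lborel) \<partial>lborel) = sqnorm v"
    by (simp add: nn_integral_cmult g1 sqnorm_def)
  also have "ennreal (1/2) * sqnorm v + ennreal (1/2) * sqnorm v = sqnorm v"
  proof -
    have "ennreal (1/2) + ennreal (1/2) = 1" by (subst ennreal_plus[symmetric]) auto
    then show ?thesis by (simp only: distrib_right[symmetric] mult_1_left)
  qed
  finally show ?thesis .
qed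

text \<open>The regularized Parseval identity expresses the damped \<open>L\<^sup>2\<close> norm of the transform by
  a Gaussian average of \<open>v(x) cnj(v(y))\<close>.\<close>

lemma sqnorm_fourier_le:
  assumes v: "integrable lborel v"
  shows "sqnorm (fourier v) \<le> sqnorm (v::'a::euclidean_space \<Rightarrow> complex)"
proof -
  have [measurable]: "v \<in> borel_measurable borel" using v by auto
  have damped: "(\<integral>\<^sup>+\<xi>. ennreal ((norm (fourier v \<xi>))\<^sup>2 * norm (damp e \<xi>)) \<partial>lborel) \<le> sqnorm v" if e: "0 < e" for e
  proof -
    \<comment> \<open>The transform of v is only known to be bounded; the damping makes
      \<open>?g\<close> integrable, so that duality applies. By regularized inversion the transform
      of \<open>?g\<close> is the conjugate of a Gaussian average of v.\<close>
    let ?g = "\<lambda>\<xi>. cnj (fourier v \<xi>) * damp e \<xi>"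
    obtain B where B: "\<And>\<xi>. norm (fourier v \<xi>) \<le> B" using norm_fourier_le by blast
    have B0: "0 \<le> B" using order_trans[OF norm_ge_zero B] .
    have di: "integrable lborel (damp e :: 'a \<Rightarrow> complex)"
      using integrable_exp_damp[OF e, of "0::'a"] by simp
    have [measurable]: "cnj \<in> borel_measurable borel"
      by (intro borel_measurable_continuous_onI continuous_intros)
    have gi: "integrable lborel ?g"
      by (rule Bochner_Integration.integrable_bound[OF integrable_mult_right[OF di, of "of_real B"]])
         (use B B0 in \<open>auto simp: norm_mult intro!: AE_I2 mult_right_mono\<close>)
    have fgi: "integrable lborel (\<lambda>\<xi>. fourier v \<xi> * ?g \<xi>)"
      by (rule Bochner_Integration.integrable_bound[OF integrable_mult_right[OF gi, of "of_real B"]])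
         (use B B0 in \<open>auto simp: norm_mult intro!: AE_I2 mult_right_mono\<close>)
    have ghat: "fourier ?g x = cnj (LINT y|lborel. of_real (gauss e (x - y)) * v y)" for x
    proof -
      have "fourier ?g x = cnj (fourier_const TYPE('a) * (LINT \<xi>|lborel. fourier v \<xi> * (exp (\<i> * of_real (\<xi> \<bullet> x)) * damp e \<xi>)))"
      proof -
        have pw: "exp (- \<i> * of_real (\<xi> \<bullet> x)) * ?g \<xi> = cnj (fourier v \<xi> * (exp (\<i> * of_real (\<xi> \<bullet> x)) * damp e \<xi>))" for \<xi>
          by (simp add: exp_cnj damp_def mult_ac)
        show ?thesis unfolding fourier_def[of ?g] pw
          by (subst Bochner_Integration.integral_cnj) simp
      qed
      then show ?thesis by (simp only: regularized_inversion[OF e v])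
    qed
    have eq: "fourier v \<xi> * ?g \<xi> = of_real ((norm (fourier v \<xi>))\<^sup>2 * norm (damp e \<xi>))" for \<xi>
      unfolding of_real_mult complex_norm_square by (simp add: damp_def)
    have "(\<integral>\<^sup>+\<xi>. ennreal ((norm (fourier v \<xi>))\<^sup>2 * norm (damp e \<xi>)) \<partial>lborel)
      = ennreal (LINT \<xi>|lborel. (norm (fourier v \<xi>))\<^sup>2 * norm (damp e \<xi>))"
      using fgi unfolding eq complex_of_real_integrable_eq by (intro nn_integral_eq_integral) auto
    also have "\<dots> \<le> ennreal (norm (LINT \<xi>|lborel. fourier v \<xi> * ?g \<xi>))"
      unfolding eq integral_complex_of_real norm_of_real by (intro ennreal_leI) simp
    also have "(LINT \<xi>|lborel. fourier v \<xi> * ?g \<xi>) = (LINT x|lborel. v x * cnj (LINT y|lborel. of_real (gauss e (x - y)) * v y))"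
      using fourier_duality[OF v gi] by (simp only: ghat)
    also have "ennreal (norm \<dots>) \<le> (\<integral>\<^sup>+x. ennreal (norm (v x * cnj (LINT y|lborel. of_real (gauss e (x - y)) * v y))) \<partial>lborel)"
      by (rule norm_integral_le_nn_integral)
    also have "\<dots> \<le> (\<integral>\<^sup>+x. (\<integral>\<^sup>+y. ennreal (norm (v x)) * ennreal (norm (v y)) * ennreal (gauss e (x - y)) \<partial>lborel) \<partial>lborel)"
    proof (rule nn_integral_mono)
      fix x
      have "ennreal (norm (v x * cnj (LINT y|lborel. of_real (gauss e (x - y)) * v y)))
        = ennreal (norm (v x)) * ennreal (norm (LINT y|lborel. of_real (gauss e (x - y)) * v y))"
        by (simp add: norm_mult ennreal_mult)
      also have "\<dots> \<le> ennreal (norm (v x)) * (\<integral>\<^sup>+y. ennreal (norm (of_real (gauss e (x - y)) * v y)) \<partial>lborel)"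
        by (intro mult_left_mono norm_integral_le_nn_integral) auto
      also have "\<dots> = (\<integral>\<^sup>+y. ennreal (norm (v x)) * ennreal (norm (v y)) * ennreal (gauss e (x - y)) \<partial>lborel)"
        by (subst nn_integral_cmult[symmetric]) (auto simp: norm_mult ennreal_mult mult_ac gauss_nonneg e)
      finally show "ennreal (norm (v x * cnj (LINT y|lborel. of_real (gauss e (x - y)) * v y)))
        \<le> (\<integral>\<^sup>+y. ennreal (norm (v x)) * ennreal (norm (v y)) * ennreal (gauss e (x - y)) \<partial>lborel)" .
    qed
    also have "\<dots> \<le> sqnorm v" by (rule nn_integral_gauss_convolution_le) (use e in auto)
    finally show ?thesis .
  qed
  define ee where "ee n = inverse (real (Suc n))" for n
  have e: "ee n > 0" "ee \<longlonglongrightarrow> 0" for n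
    using LIMSEQ_inverse_real_of_nat by (auto simp: ee_def[abs_def])
  have lim: "(\<lambda>n. ennreal ((norm (fourier v \<xi>))\<^sup>2 * norm (damp (ee n) \<xi>))) \<longlonglongrightarrow> ennreal ((norm (fourier v \<xi>))\<^sup>2)" for \<xi>
  proof -
    have "(\<lambda>n. (norm (fourier v \<xi>))\<^sup>2 * norm (damp (ee n) \<xi>)) \<longlonglongrightarrow> (norm (fourier v \<xi>))\<^sup>2 * norm (1::complex)"
      by (intro tendsto_intros damp_tendsto e)
    then show ?thesis by (intro tendsto_ennrealI) simp
  qed
  \<comment> \<open>Removing the damping by Fatou's lemma gives one inequality only. The reverse one
    follows from inverting the transform, in \<open>fourier_pair_sqnorm\<close>.\<close>
  have "sqnorm (fourier v) = (\<integral>\<^sup>+\<xi>. liminf (\<lambda>n. ennreal ((norm (fourier v \<xi>))\<^sup>2 * norm (damp (ee n) \<xi>))) \<partial>lborel)"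
    unfolding sqnorm_def by (intro nn_integral_cong lim_imp_Liminf[symmetric] lim) simp
  also have "\<dots> \<le> liminf (\<lambda>n. \<integral>\<^sup>+\<xi>. ennreal ((norm (fourier v \<xi>))\<^sup>2 * norm (damp (ee n) \<xi>)) \<partial>lborel)"
    by (rule nn_integral_liminf) measurable
  also have "\<dots> \<le> liminf (\<lambda>n. sqnorm v)"
    by (intro Liminf_mono always_eventually allI damped e)
  finally show ?thesis by (simp add: Liminf_const)
qed

text \<open>Says that the tempered distribution v has the function h as its Fourier transform. A
  relation is used because v may grow polynomially, so that no integral formula for h is
  available.\<close>

definition fourier_pair :: "('a::euclidean_space \<Rightarrow> complex) \<Rightarrow> ('a \<Rightarrow> complex) \<Rightarrow> bool" where
  "fourier_pair v h \<longleftrightarrow> v \<in> borel_measurable borel \<and> h \<in> borel_measurable borel \<and>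
     (\<forall>\<psi>\<in>schwartz. integrable lborel (\<lambda>x. v x * fourier \<psi> x) \<and> integrable lborel (\<lambda>x. h x * \<psi> x) \<and>
        (LINT x|lborel. v x * fourier \<psi> x) = (LINT x|lborel. h x * \<psi> x))"

section \<open>Extension of the transform to square-integrable functions, and Plancherel\<close>

lemma exists_strict_subseq_le:
  fixes a :: "nat \<Rightarrow> ennreal"
  assumes "a \<longlonglongrightarrow> 0"
  shows "\<exists>r. strict_mono r \<and> (\<forall>k. a (r k) \<le> ennreal ((1/8) ^ k))"
proof -
  have "\<exists>n>m. a n \<le> ennreal ((1/8) ^ k)" for m k :: nat
  proof -
    have "\<forall>\<^sub>F n in sequentially. a n < ennreal ((1/8) ^ k)"
      using assms by (rule order_tendstoD) simp
    with eventually_gt_at_top[of m] have "\<forall>\<^sub>F n in sequentially. n > m \<and> a n < ennreal ((1/8) ^ k)"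
      by eventually_elim simp
    then show ?thesis by (auto simp: eventually_sequentially intro: less_imp_le)
  qed
  note ex = this
  have "\<exists>f. \<forall>k. a (f k) \<le> ennreal ((1/8) ^ k) \<and> f k < f (Suc k)"
  proof (rule dependent_nat_choice)
    show "\<exists>n. a n \<le> ennreal ((1/8) ^ 0)" using ex[of _ 0] by blast
    fix m k :: nat
    show "\<exists>n. a n \<le> ennreal ((1/8) ^ Suc k) \<and> m < n" using ex[of m "Suc k"] by blast
  qed
  then show ?thesis by (auto simp: strict_mono_Suc_iff)
qed

text \<open>The rate 1/8 leaves room for the weights 2^k: the weighted sum of squared increments has
  an integral at most the sum of (1/4)^k, so it is finite almost everywhere. At such points the
  increments are bounded by a geometric sequence of ratio sqrt(1/2).\<close>

lemma sqnorm_fast_Cauchy_convergent: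
  fixes f :: "nat \<Rightarrow> 'a::euclidean_space \<Rightarrow> complex"
  assumes [measurable]: "\<And>k. f k \<in> borel_measurable borel"
    and fast: "\<And>k. sqnorm (\<lambda>x. f (Suc k) x - f k x) \<le> ennreal ((1/8) ^ k)"
  shows "AE x in lborel. convergent (\<lambda>k. f k x)"
proof -
  let ?S = "\<lambda>x. \<Sum>k. ennreal (2 ^ k) * ennreal ((norm (f (Suc k) x - f k x))\<^sup>2)"
  have "(\<integral>\<^sup>+x. ?S x \<partial>lborel) = (\<Sum>k. ennreal (2 ^ k) * sqnorm (\<lambda>x. f (Suc k) x - f k x))"
    by (simp add: nn_integral_suminf nn_integral_cmult sqnorm_def)
  also have "\<dots> \<le> (\<Sum>k. ennreal ((1/4) ^ k))"
  proof (rule suminf_le)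
    fix k
    have "ennreal (2 ^ k) * sqnorm (\<lambda>x. f (Suc k) x - f k x) \<le> ennreal (2 ^ k) * ennreal ((1/8) ^ k)"
      by (intro mult_left_mono fast) auto
    also have "\<dots> = ennreal ((1/4) ^ k)"
      by (simp add: ennreal_mult[symmetric] power_mult_distrib[symmetric])
    finally show "ennreal (2 ^ k) * sqnorm (\<lambda>x. f (Suc k) x - f k x) \<le> ennreal ((1/4) ^ k)" .
  qed auto
  also have "\<dots> = ennreal (\<Sum>k. (1/4) ^ k)"
    by (rule suminf_ennreal2) (auto intro: summable_geometric)
  finally have "(\<integral>\<^sup>+x. ?S x \<partial>lborel) \<noteq> \<infinity>"
    by (metis ennreal_less_top infinity_ennreal_def leD)
  then have "AE x in lborel. ?S x \<noteq> \<infinity>"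
    by (intro nn_integral_PInf_AE) measurable
  then show ?thesis
  proof eventually_elim
    case (elim x)
    then obtain C where C: "?S x = ennreal C" "0 \<le> C" by (cases "?S x") auto
    have le: "norm (f (Suc k) x - f k x) \<le> sqrt C * (sqrt (1/2)) ^ k" for k
    proof -
      have "ennreal (2 ^ k * (norm (f (Suc k) x - f k x))\<^sup>2) \<le> ennreal C"
        using sum_le_suminf[of "\<lambda>k. ennreal (2 ^ k) * ennreal ((norm (f (Suc k) x - f k x))\<^sup>2)" "{k}"]
        by (simp add: C ennreal_mult)
      then have "2 ^ k * (norm (f (Suc k) x - f k x))\<^sup>2 \<le> C"
        using C(2) by (simp add: ennreal_le_iff)
      then have "(norm (f (Suc k) x - f k x))\<^sup>2 \<le> C * (1/2) ^ k"
        by (simp add: field_simps power_divide)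
      then have "sqrt ((norm (f (Suc k) x - f k x))\<^sup>2) \<le> sqrt (C * (1/2) ^ k)"
        by (rule real_sqrt_le_mono)
      then show ?thesis by (simp add: real_sqrt_mult real_sqrt_power)
    qed
    have "summable (\<lambda>k. sqrt C * (sqrt (1/2)) ^ k)"
      by (intro summable_mult summable_geometric) simp
    then have "summable (\<lambda>k. f (Suc k) x - f k x)"
      by (rule summable_comparison_test'[of _ 0]) (rule le)
    then have "convergent (\<lambda>n. \<Sum>k<n. f (Suc k) x - f k x)"
      by (simp add: summable_iff_convergent)
    then have "convergent (\<lambda>n. (\<Sum>k<n. f (Suc k) x - f k x) + f 0 x)"
      by (intro convergent_add convergent_const)
    then show "convergent (\<lambda>k. f k x)"
      by (simp add: sum_lessThan_telescope[of "\<lambda>k. f k x"])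
  qed
qed

lemma sqnorm_le_liminf:
  fixes f :: "nat \<Rightarrow> 'a::euclidean_space \<Rightarrow> complex"
  assumes [measurable]: "\<And>k. f k \<in> borel_measurable borel"
    and lim: "AE x in lborel. (\<lambda>k. f k x) \<longlonglongrightarrow> g x"
  shows "sqnorm g \<le> liminf (\<lambda>k. sqnorm (f k))"
proof -
  have "sqnorm g = (\<integral>\<^sup>+x. liminf (\<lambda>k. ennreal ((norm (f k x))\<^sup>2)) \<partial>lborel)"
    unfolding sqnorm_def
  proof (rule nn_integral_cong_AE)
    show "AE x in lborel. ennreal ((norm (g x))\<^sup>2) = liminf (\<lambda>k. ennreal ((norm (f k x))\<^sup>2))"
      using lim by eventually_elim (intro lim_imp_Liminf[symmetric] tendsto_ennrealI tendsto_intros; simp)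
  qed
  also have "\<dots> \<le> liminf (\<lambda>k. sqnorm (f k))"
    unfolding sqnorm_def by (rule nn_integral_liminf) measurable
  finally show ?thesis .
qed

lemma tendsto_integral_of_sqnorm:
  assumes [measurable]: "\<And>k. f k \<in> borel_measurable borel" "h \<in> borel_measurable borel" "\<psi> \<in> borel_measurable borel"
    and lim: "(\<lambda>k. sqnorm (\<lambda>x. h x - f k x)) \<longlonglongrightarrow> 0" and \<psi>: "sqnorm \<psi> < \<infinity>"
    and int: "integrable lborel (\<lambda>x. h x * \<psi> x)" "\<And>k. integrable lborel (\<lambda>x. f k x * \<psi> x)"
  shows "(\<lambda>k. LINT x|lborel. f k x * \<psi> x) \<longlonglongrightarrow> (LINT x|lborel. h x * \<psi> x)"
proof -
  have le: "ennreal ((norm ((LINT x|lborel. h x * \<psi> x) - (LINT x|lborel. f k x * \<psi> x)))\<^sup>2) \<le> sqnorm (\<lambda>x. h x - f k x) * sqnorm \<psi>" for k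
  proof -
    have "(LINT x|lborel. h x * \<psi> x) - (LINT x|lborel. f k x * \<psi> x) = (LINT x|lborel. (h x - f k x) * \<psi> x)"
      using int by (simp add: left_diff_distrib)
    then have "ennreal ((norm ((LINT x|lborel. h x * \<psi> x) - (LINT x|lborel. f k x * \<psi> x)))\<^sup>2)
      \<le> (\<integral>\<^sup>+x. ennreal (norm ((h x - f k x) * \<psi> x)) \<partial>lborel)\<^sup>2"
      using norm_integral_le_nn_integral[of lborel "\<lambda>x. (h x - f k x) * \<psi> x"]
      by (simp add: ennreal_power[symmetric] power_mono)
    also have "\<dots> \<le> sqnorm (\<lambda>x. h x - f k x) * sqnorm \<psi>"
      by (rule norm_mult_integral_le) measurable
    finally show ?thesis .
  qed
  have lim0: "(\<lambda>k. sqnorm (\<lambda>x. h x - f k x) * sqnorm \<psi>) \<longlonglongrightarrow> 0 * sqnorm \<psi>"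
    using \<psi> by (intro tendsto_mult_ennreal lim tendsto_const) auto
  have "(\<lambda>k. ennreal ((norm ((LINT x|lborel. h x * \<psi> x) - (LINT x|lborel. f k x * \<psi> x)))\<^sup>2)) \<longlonglongrightarrow> 0"
  proof (rule tendsto_sandwich[OF _ _ tendsto_const])
    show "(\<lambda>k. sqnorm (\<lambda>x. h x - f k x) * sqnorm \<psi>) \<longlonglongrightarrow> 0" using lim0 by simp
  qed (use le in auto)
  then have "(\<lambda>k. ennreal ((norm ((LINT x|lborel. h x * \<psi> x) - (LINT x|lborel. f k x * \<psi> x)))\<^sup>2)) \<longlonglongrightarrow> ennreal 0"
    by simp
  then have "(\<lambda>k. (norm ((LINT x|lborel. h x * \<psi> x) - (LINT x|lborel. f k x * \<psi> x)))\<^sup>2) \<longlonglongrightarrow> 0"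
    by (subst (asm) tendsto_ennreal_iff) auto
  from tendsto_real_sqrt[OF this]
  have "(\<lambda>k. norm ((LINT x|lborel. f k x * \<psi> x) - (LINT x|lborel. h x * \<psi> x))) \<longlonglongrightarrow> 0"
    by (simp add: norm_minus_commute)
  then show ?thesis unfolding tendsto_norm_zero_iff by (rule Lim_null[THEN iffD2])
qed

text \<open>Truncations of v to balls are integrable, so their transforms are given by the integral
  formula. The transform does not increase the norm, hence the transforms of the truncations are
  Cauchy; a fast subsequence converges almost everywhere to h, and duality survives the
  limit.\<close>

lemma exists_fourier_pair:
  fixes v :: "'a::euclidean_space \<Rightarrow> complex"
  assumes [measurable]: "v \<in> borel_measurable borel" and fin: "sqnorm v < \<infinity>"
  shows "\<exists>h. fourier_pair v h \<and> sqnorm h \<le> sqnorm v"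
proof -
  define c where "c n x = (if norm x \<le> real n then v x else 0)" for n :: nat and x
  have c_meas [measurable]: "c n \<in> borel_measurable borel" for n
    unfolding c_def by measurable
  have c_le: "sqnorm (c n) \<le> sqnorm v" for n
    unfolding sqnorm_def c_def by (intro nn_integral_mono ennreal_leI) auto
  have c_int: "integrable lborel (c n)" for n
  proof -
    have "emeasure lborel (cball (0::'a) (real n)) < \<infinity>"
      by (intro emeasure_bounded_finite bounded_cball)
    then have i: "sqnorm (\<lambda>x. of_real (indicator (cball (0::'a) (real n)) x)) < \<infinity>"
      unfolding sqnorm_def by (subst nn_integral_cong[where v="indicator (cball 0 (real n))"]) (auto simp: indicator_def)
    have [measurable]: "cball (0::'a) (real n) \<in> sets borel" by simp
    have "integrable lborel (\<lambda>x. c n x * of_real (indicator (cball (0::'a) (real n)) x))"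
      by (rule integrable_mult_of_sqnorm[OF c_meas _ order_le_less_trans[OF c_le fin] i]) measurable
    moreover have "c n x * of_real (indicator (cball (0::'a) (real n)) x) = c n x" for x
      by (simp add: c_def indicator_def)
    ultimately show ?thesis by simp
  qed
  have "(\<lambda>n. sqnorm (\<lambda>x. v x - c n x)) \<longlonglongrightarrow> (\<integral>\<^sup>+x. 0 \<partial>(lborel :: 'a measure))"
    unfolding sqnorm_def
  proof (rule nn_integral_dominated_convergence[where w="\<lambda>x. ennreal ((norm (v x))\<^sup>2)"])
    show "AE x in lborel. (\<lambda>n. ennreal ((norm (v x - c n x))\<^sup>2)) \<longlonglongrightarrow> 0"
    proof (rule AE_I2)
      fix x
      have "\<forall>\<^sub>F n in sequentially. ennreal ((norm (v x - c n x))\<^sup>2) = 0"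
        using eventually_ge_at_top[of "nat \<lceil>norm x\<rceil>"] by eventually_elim (auto simp: c_def)
      then show "(\<lambda>n. ennreal ((norm (v x - c n x))\<^sup>2)) \<longlonglongrightarrow> 0" by (rule tendsto_eventually)
    qed
  qed (use fin in \<open>auto simp: sqnorm_def c_def intro!: AE_I2\<close>)
  then have "(\<lambda>n. sqnorm (\<lambda>x. v x - c n x)) \<longlonglongrightarrow> 0" by simp
  then obtain r where r: "strict_mono r" "\<And>k. sqnorm (\<lambda>x. v x - c (r k) x) \<le> ennreal ((1/8) ^ k)"
    using exists_strict_subseq_le by blast
  define H where "H k = fourier (c (r k))" for k
  have H_meas [measurable]: "H k \<in> borel_measurable borel" for k unfolding H_def by measurable
  have H_diff: "sqnorm (\<lambda>x. H m x - H k x) \<le> ennreal ((1/8) ^ k)" if "k \<le> m" for k m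
  proof -
    have "(\<lambda>x. H m x - H k x) = fourier (\<lambda>x. c (r m) x - c (r k) x)"
      by (rule ext) (simp add: H_def fourier_diff c_int)
    then have "sqnorm (\<lambda>x. H m x - H k x) \<le> sqnorm (\<lambda>x. c (r m) x - c (r k) x)"
      by (simp only:) (intro sqnorm_fourier_le Bochner_Integration.integrable_diff c_int)
    also have "\<dots> \<le> sqnorm (\<lambda>x. v x - c (r k) x)"
    proof -
      have "real (r k) \<le> real (r m)" using that r(1) by (simp add: strict_mono_less_eq)
      then show ?thesis
        unfolding sqnorm_def by (intro nn_integral_mono ennreal_leI) (auto simp: c_def)
    qed
    finally show ?thesis using r(2)[of k] by simp
  qed
  have conv: "AE x in lborel. convergent (\<lambda>k. H k x)"
    by (rule sqnorm_fast_Cauchy_convergent) (auto intro: H_diff)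
  define h where "h x = lim (\<lambda>k. H k x)" for x
  have [measurable]: "h \<in> borel_measurable borel" unfolding h_def by measurable
  have lim: "AE x in lborel. (\<lambda>k. H k x) \<longlonglongrightarrow> h x"
    using conv by eventually_elim (simp add: h_def convergent_LIMSEQ_iff)
  have H_le: "sqnorm (H k) \<le> sqnorm v" for k
    unfolding H_def using sqnorm_fourier_le[OF c_int] c_le order_trans by blast
  have h_le: "sqnorm h \<le> sqnorm v"
  proof -
    have "sqnorm h \<le> liminf (\<lambda>k. sqnorm (H k))" by (rule sqnorm_le_liminf[OF _ lim]) measurable
    also have "\<dots> \<le> liminf (\<lambda>k. sqnorm v)" by (intro Liminf_mono always_eventually allI H_le)
    finally show ?thesis by (simp add: Liminf_const)
  qed
  \<comment> \<open>Fatou's lemma in m turns the pointwise limit into a limit in the mean square,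
    with the rate of the Cauchy estimate.\<close>
  have hH: "sqnorm (\<lambda>x. h x - H k x) \<le> ennreal ((1/8) ^ k)" for k
  proof -
    have "sqnorm (\<lambda>x. h x - H k x) \<le> liminf (\<lambda>m. sqnorm (\<lambda>x. H m x - H k x))"
    proof (rule sqnorm_le_liminf)
      show "AE x in lborel. (\<lambda>m. H m x - H k x) \<longlonglongrightarrow> h x - H k x"
        using lim by eventually_elim (intro tendsto_intros)
    qed measurable
    also have "\<dots> \<le> liminf (\<lambda>m. ennreal ((1/8) ^ k))"
      by (intro Liminf_mono) (auto simp: eventually_sequentially intro!: exI[of _ k] H_diff)
    finally show ?thesis by (simp add: Liminf_const)
  qed
  have "(\<lambda>k. ennreal ((1/8) ^ k)) \<longlonglongrightarrow> ennreal 0"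
    by (intro tendsto_ennrealI LIMSEQ_realpow_zero) auto
  then have lim8: "(\<lambda>k. ennreal ((1/8) ^ k)) \<longlonglongrightarrow> 0" by simp
  have hH0: "(\<lambda>k. sqnorm (\<lambda>x. h x - H k x)) \<longlonglongrightarrow> 0"
    by (rule tendsto_sandwich[OF _ _ tendsto_const lim8]) (use hH in \<open>simp_all add: always_eventually\<close>)
  have "fourier_pair v h"
    unfolding fourier_pair_def
  proof (intro conjI ballI)
    fix \<psi> :: "'a \<Rightarrow> complex" assume \<psi>: "\<psi> \<in> schwartz"
    have [measurable]: "\<psi> \<in> borel_measurable borel" using \<psi> by (rule schwartz_measurable)
    show i1: "integrable lborel (\<lambda>x. v x * fourier \<psi> x)"
      by (intro integrable_mult_of_sqnorm fin schwartz_sqnorm schwartz_fourier \<psi>) measurable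
    show i2: "integrable lborel (\<lambda>x. h x * \<psi> x)"
      by (intro integrable_mult_of_sqnorm order_le_less_trans[OF h_le fin] schwartz_sqnorm \<psi>) measurable
    have "(\<lambda>k. LINT x|lborel. H k x * \<psi> x) \<longlonglongrightarrow> (LINT x|lborel. h x * \<psi> x)"
      by (rule tendsto_integral_of_sqnorm[OF _ _ _ hH0 schwartz_sqnorm[OF \<psi>] i2])
         (auto intro!: integrable_mult_of_sqnorm order_le_less_trans[OF H_le fin] schwartz_sqnorm \<psi>)
    moreover have "(LINT x|lborel. H k x * \<psi> x) = (LINT x|lborel. c (r k) x * fourier \<psi> x)" for k
      unfolding H_def by (rule fourier_duality[OF c_int schwartz_integrable[OF \<psi>]])
    moreover have "(\<lambda>k. LINT x|lborel. c (r k) x * fourier \<psi> x) \<longlonglongrightarrow> (LINT x|lborel. v x * fourier \<psi> x)"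
    proof (rule integral_dominated_convergence[where w="\<lambda>x. norm (v x * fourier \<psi> x)"])
      show "AE x in lborel. (\<lambda>k. c (r k) x * fourier \<psi> x) \<longlonglongrightarrow> v x * fourier \<psi> x"
      proof (rule AE_I2)
        fix x
        have "\<forall>\<^sub>F k in sequentially. c (r k) x * fourier \<psi> x = v x * fourier \<psi> x"
          using eventually_ge_at_top[of "nat \<lceil>norm x\<rceil>"]
        proof eventually_elim
          case (elim k)
          then have "norm x \<le> real (r k)" using seq_suble[OF r(1), of k] by linarith
          then show ?case by (simp add: c_def)
        qed
        then show "(\<lambda>k. c (r k) x * fourier \<psi> x) \<longlonglongrightarrow> v x * fourier \<psi> x" by (rule tendsto_eventually)
      qed
      show "AE x in lborel. norm (c (r k) x * fourier \<psi> x) \<le> norm (v x * fourier \<psi> x)" for k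
        by (auto simp: c_def)
    qed (use i1 in auto)
    ultimately show "(LINT x|lborel. v x * fourier \<psi> x) = (LINT x|lborel. h x * \<psi> x)"
      using LIMSEQ_unique by auto
  qed measurable
  with h_le show ?thesis by blast
qed

lemma fourier_pair_unique_right:
  assumes "fourier_pair v h" "fourier_pair v h'"
  shows "AE x in lborel. h x = h' x"
  by (rule AE_eq_of_schwartz_integrals) (use assms in \<open>auto simp: fourier_pair_def\<close>)

lemma fourier_pair_inv_fourier:
  assumes "fourier_pair v h" and \<psi>: "\<psi> \<in> schwartz"
  shows "integrable lborel (\<lambda>x. v x * \<psi> x)" "integrable lborel (\<lambda>x. h x * inv_fourier \<psi> x)"
    "(LINT x|lborel. v x * \<psi> x) = (LINT x|lborel. h x * inv_fourier \<psi> x)"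
  using assms(1) schwartz_inv_fourier[OF \<psi>] fourier_inv_fourier[OF \<psi>]
  unfolding fourier_pair_def by metis+

lemma fourier_pair_unique_left:
  assumes "fourier_pair v h" "fourier_pair v' h"
  shows "AE x in lborel. v x = v' x"
proof (rule AE_eq_of_schwartz_integrals)
  show "v \<in> borel_measurable borel" "v' \<in> borel_measurable borel"
    using assms by (auto simp: fourier_pair_def)
qed (use fourier_pair_inv_fourier[OF assms(1)] fourier_pair_inv_fourier[OF assms(2)] in auto)

lemma fourier_pairI_inv_fourier:
  assumes "v \<in> borel_measurable borel" "h \<in> borel_measurable borel"
    and "\<And>\<psi>. \<psi> \<in> schwartz \<Longrightarrow> integrable lborel (\<lambda>x. v x * \<psi> x)"
    and "\<And>\<psi>. \<psi> \<in> schwartz \<Longrightarrow> integrable lborel (\<lambda>x. h x * \<psi> x)"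
    and "\<And>\<psi>. \<psi> \<in> schwartz \<Longrightarrow> (LINT x|lborel. v x * \<psi> x) = (LINT x|lborel. h x * inv_fourier \<psi> x)"
  shows "fourier_pair v h"
  unfolding fourier_pair_def using assms inv_fourier_fourier schwartz_fourier by metis

text \<open>The inverse transform is the transform followed by a reflection, so the forward
  construction applied to h and reflected yields v.\<close>

lemma exists_fourier_pair_left:
  fixes h :: "'a::euclidean_space \<Rightarrow> complex"
  assumes [measurable]: "h \<in> borel_measurable borel" and fin: "sqnorm h < \<infinity>"
  shows "\<exists>v. fourier_pair v h \<and> sqnorm v \<le> sqnorm h"
proof -
  obtain g where g: "fourier_pair h g" "sqnorm g \<le> sqnorm h"
    using exists_fourier_pair[OF assms] by blast
  have [measurable]: "g \<in> borel_measurable borel" using g by (simp add: fourier_pair_def)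
  have "fourier_pair (\<lambda>x. g (- x)) h"
    unfolding fourier_pair_def
  proof (intro conjI ballI)
    fix \<psi> :: "'a \<Rightarrow> complex" assume \<psi>: "\<psi> \<in> schwartz"
    have [measurable]: "\<psi> \<in> borel_measurable borel" using \<psi> by (rule schwartz_measurable)
    note p = fourier_pair_inv_fourier[OF g(1) \<psi>]
    show "integrable lborel (\<lambda>x. h x * \<psi> x)" by (rule p)
    show "integrable lborel (\<lambda>x. g (- x) * fourier \<psi> x)"
      using integrable_lborel_reflect[OF p(2), of 0] by (simp add: inv_fourier_eq_fourier)
    show "(LINT x|lborel. g (- x) * fourier \<psi> x) = (LINT x|lborel. h x * \<psi> x)"
      using integral_lborel_reflect[of "\<lambda>x. g x * fourier \<psi> (- x)" 0] p(3)
      by (simp add: inv_fourier_eq_fourier)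
  qed measurable
  moreover have "sqnorm (\<lambda>x. g (- x)) = sqnorm g"
    using nn_integral_lborel_reflect[of "\<lambda>x. ennreal ((norm (g x))\<^sup>2)" 0] by (simp add: sqnorm_def)
  ultimately show ?thesis using g(2) by metis
qed

text \<open>If one norm is finite, the partner constructed from that function has no larger norm and
  by uniqueness is the given one; if it is infinite, that inequality is trivial. In particular the
  two norms are finite together, and no finiteness needs to be known in advance.\<close>

theorem fourier_pair_sqnorm:
  assumes p: "fourier_pair v h"
  shows "sqnorm v = sqnorm h"
proof -
  have m: "v \<in> borel_measurable borel" "h \<in> borel_measurable borel"
    using p by (auto simp: fourier_pair_def)
  have "sqnorm h \<le> sqnorm v"
  proof (cases "sqnorm v < \<infinity>")
    case True
    then obtain h' where h': "fourier_pair v h'" "sqnorm h' \<le> sqnorm v"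
      using exists_fourier_pair[OF m(1)] by blast
    then show ?thesis using sqnorm_cong_AE[OF fourier_pair_unique_right[OF p h'(1)]] by simp
  qed (auto simp: not_less top_unique)
  moreover have "sqnorm v \<le> sqnorm h"
  proof (cases "sqnorm h < \<infinity>")
    case True
    then obtain v' where v': "fourier_pair v' h" "sqnorm v' \<le> sqnorm h"
      using exists_fourier_pair_left[OF m(2)] by blast
    then show ?thesis using sqnorm_cong_AE[OF fourier_pair_unique_left[OF p v'(1)]] by simp
  qed (auto simp: not_less top_unique)
  ultimately show ?thesis by simp
qed

section \<open>Functions reproduced by convolution with a Schwartz function\<close>

text \<open>The graph of t^q lies above its tangent at a. With s = b/a this reads q s \<le> s^q + q
  - 1, which is Young's inequality for s and 1 with exponents q and q/(q - 1).\<close>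

lemma powr_tangent_le:
  fixes a b q :: real
  assumes "0 \<le> a" "0 \<le> b" "1 \<le> q"
  shows "a powr q + q * a powr (q - 1) * (b - a) \<le> b powr q"
proof (cases "a = 0 \<or> b = 0 \<or> q = 1")
  case True
  have "a powr (q - 1) * a = a powr q"
    using assms by (cases "a = 0") (auto simp: powr_mult_base[symmetric] powr_diff)
  moreover have "0 \<le> (q - 1) * a powr q" using assms by simp
  ultimately show ?thesis using True assms by (auto simp: algebra_simps)
next
  case False
  then have pos: "0 < a" "0 < b" "1 < q" using assms by auto
  define s where "s = b / a"
  have s: "0 < s" using pos by (simp add: s_def)
  have "q * s \<le> s powr q + (q - 1)"
  proof -
    have "s * 1 \<le> s powr q / q + 1 powr (q / (q - 1)) / (q / (q - 1))"
      by (rule Youngs_inequality) (use pos s in \<open>auto simp: field_simps\<close>)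
    then have "s \<le> s powr q / q + (q - 1) / q" by simp
    then have "q * s \<le> q * (s powr q / q + (q - 1) / q)"
      using pos by (intro mult_left_mono) auto
    then show ?thesis using pos by (simp add: distrib_left)
  qed
  then have "a powr q * (q * s) \<le> a powr q * (s powr q + (q - 1))"
    by (rule mult_left_mono) simp
  moreover have "a powr q * (s powr q + (q - 1)) = b powr q + (q * a powr q - a powr q)"
    using pos by (simp add: s_def powr_divide algebra_simps)
  moreover have "a powr q * (q * s) = q * a powr (q - 1) * b"
    using pos by (simp add: s_def powr_diff)
  moreover have "q * a powr (q - 1) * (b - a) = q * a powr (q - 1) * b - q * a powr q"
  proof -
    have "a powr (q - 1) * a = a powr q" using pos by (simp add: powr_diff)
    then have "q * a powr (q - 1) * a = q * a powr q" by (simp only: mult.assoc)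
    then show ?thesis by (simp only: right_diff_distrib)
  qed
  ultimately show ?thesis by linarith
qed

text \<open>The tangent at the larger of the two values. With q = p/2 it converts increments of U
  into increments of |U|^(p/2) for the upper bound.\<close>

lemma powr_diff_le:
  fixes s t q :: real
  assumes "0 \<le> s" "0 \<le> t" "1 \<le> q"
  shows "\<bar>s powr q - t powr q\<bar> \<le> q * \<bar>s - t\<bar> * max s t powr (q - 1)"
  using powr_tangent_le[of s t q] powr_tangent_le[of t s q] assms
    powr_mono2[of q s t] powr_mono2[of q t s]
  by (cases "s \<le> t") (auto simp: max_def algebra_simps)

lemma powr_superadditive:
  fixes s t q :: real
  assumes "0 \<le> s" "0 \<le> t" "1 \<le> q"
  shows "s powr q + t powr q \<le> (s + t) powr q"
proof -
  have eq: "x powr q = x * x powr (q - 1)" if "0 \<le> x" for x :: real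
    using that by (cases "x = 0") (auto simp: powr_diff)
  have "s * s powr (q - 1) + t * t powr (q - 1) \<le> s * (s + t) powr (q - 1) + t * (s + t) powr (q - 1)"
    using assms by (intro add_mono mult_left_mono powr_mono2) auto
  then show ?thesis using assms by (simp add: eq distrib_right)
qed

text \<open>Superadditivity of t^q applied to the smaller value and the difference. With q = p/2 it
  recovers increments of |U| from those of |U|^(p/2), as the lower bound requires.\<close>

lemma abs_diff_powr_le:
  fixes s t q :: real
  assumes "0 \<le> s" "0 \<le> t" "1 \<le> q"
  shows "\<bar>s - t\<bar> powr q \<le> \<bar>s powr q - t powr q\<bar>"
  using powr_superadditive[of "s - t" t q] powr_superadditive[of "t - s" s q] assms
  by (cases "s \<le> t") auto

lemma powr_half_square: "0 \<le> x \<Longrightarrow> (x powr (p / 2))\<^sup>2 = x powr p" for x p :: real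
  by (simp add: power2_eq_square powr_add[symmetric])

lemma add_powr_le:
  fixes s t p :: real
  assumes "0 \<le> s" "0 \<le> t" "0 \<le> p"
  shows "(s + t) powr p \<le> 2 powr p * (s powr p + t powr p)"
proof -
  have "(s + t) powr p \<le> (2 * max s t) powr p"
    using assms by (intro powr_mono2) auto
  also have "\<dots> = 2 powr p * max s t powr p" using assms by (simp add: powr_mult)
  also have "max s t powr p \<le> s powr p + t powr p" by (auto simp: max_def)
  finally show ?thesis by (simp add: mult_left_mono)
qed

text \<open>Jensen's inequality: the tangent inequality at the mean value is integrated.\<close>

lemma integral_powr_le:
  fixes w g :: "'a \<Rightarrow> real"
  assumes w: "\<And>z. 0 \<le> w z" "integrable M w" and g: "\<And>z. 0 \<le> g z" "integrable M (\<lambda>z. w z * g z)"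
    and meas [measurable]: "g \<in> borel_measurable M" and p: "1 \<le> p"
  shows "ennreal ((LINT z|M. w z * g z) powr p)
    \<le> ennreal ((LINT z|M. w z) powr (p - 1)) * (\<integral>\<^sup>+z. ennreal (w z * g z powr p) \<partial>M)"
proof -
  have [measurable]: "w \<in> borel_measurable M" using w by auto
  define A where "A = (LINT z|M. w z)"
  define G where "G = (LINT z|M. w z * g z)"
  have A0: "0 \<le> A" unfolding A_def using w by simp
  have G0: "0 \<le> G" unfolding G_def using w g by simp
  show ?thesis
  proof (cases "A = 0")
    case True
    then have "AE z in M. w z = 0"
      using integral_nonneg_eq_0_iff_AE[OF w(2)] w(1) unfolding A_def by auto
    then have "G = 0" unfolding G_def by (intro integral_eq_zero_AE) auto
    then show ?thesis by (simp add: G_def)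
  next
    case False
    then have A: "0 < A" using A0 by simp
    define I where "I = (\<integral>\<^sup>+z. ennreal (w z * g z powr p) \<partial>M)"
    show ?thesis
    proof (cases "I = \<infinity>")
      case True
      then show ?thesis using A by (simp add: I_def[symmetric] A_def[symmetric] ennreal_mult_top)
    next
      case fin: False
      have int: "integrable M (\<lambda>z. w z * g z powr p)"
        using fin w(1) by (intro integrableI_nonneg) (auto simp: I_def less_top)
      define t where "t = G / A"
      have t: "0 \<le> t" using A G0 by (simp add: t_def)
      have "(LINT z|M. t powr p * w z + p * t powr (p - 1) * (w z * g z - t * w z)) \<le> (LINT z|M. w z * g z powr p)"
      proof (rule integral_mono)
        show "integrable M (\<lambda>z. t powr p * w z + p * t powr (p - 1) * (w z * g z - t * w z))"
          using w g by simp
        fix z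
        have "w z * (t powr p + p * t powr (p - 1) * (g z - t)) \<le> w z * g z powr p"
          using powr_tangent_le[OF t g(1) p] w(1) by (rule mult_left_mono)
        then show "t powr p * w z + p * t powr (p - 1) * (w z * g z - t * w z) \<le> w z * g z powr p"
          by (simp add: algebra_simps)
      qed (rule int)
      also have "(LINT z|M. t powr p * w z + p * t powr (p - 1) * (w z * g z - t * w z)) = t powr p * A + p * t powr (p - 1) * (G - t * A)"
        using w g by (simp add: A_def G_def)
      also have "G - t * A = 0" using A by (simp add: t_def)
      finally have le: "t powr p * A \<le> (LINT z|M. w z * g z powr p)" by simp
      have "G powr p = A powr (p - 1) * (t powr p * A)"
        using A G0 by (simp add: t_def powr_divide powr_diff)
      also have "\<dots> \<le> A powr (p - 1) * (LINT z|M. w z * g z powr p)"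
        by (intro mult_left_mono le) simp
      finally have "ennreal (G powr p) \<le> ennreal (A powr (p - 1)) * ennreal (LINT z|M. w z * g z powr p)"
        by (simp add: ennreal_mult'[symmetric] ennreal_leI)
      also have "ennreal (LINT z|M. w z * g z powr p) = I"
        unfolding I_def using int w(1) by (intro nn_integral_eq_integral[symmetric]) auto
      finally show ?thesis by (simp add: G_def A_def I_def)
    qed
  qed
qed

definition Lpow :: "real \<Rightarrow> ('a::euclidean_space \<Rightarrow> complex) \<Rightarrow> ennreal" where
  "Lpow p U = (\<integral>\<^sup>+x. ennreal (norm (U x) powr p) \<partial>lborel)"

text \<open>The pointwise bound w u \<le> w + B u^p, seen by distinguishing u \<le> 1 from u > 1,
  takes the place of Hoelder's inequality and needs no conjugate exponent.\<close>

lemma integrable_convolution_Lpow: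
  fixes U :: "'a::euclidean_space \<Rightarrow> complex"
  assumes [measurable]: "U \<in> borel_measurable borel" and fin: "Lpow p U < \<infinity>" and p: "1 \<le> p"
    and w: "\<And>z. 0 \<le> w z" "\<And>z. w z \<le> B" "integrable lborel w"
  shows "integrable lborel (\<lambda>z. w z * norm (U (x - z)))"
proof -
  have [measurable]: "w \<in> borel_measurable borel" using w by auto
  show ?thesis
  proof (rule Bochner_Integration.integrable_bound)
  have "integrable lborel (\<lambda>x. norm (U x) powr p)"
    using fin by (intro integrableI_nonneg) (auto simp: Lpow_def)
  from integrable_lborel_reflect[OF this, of x]
  show "integrable lborel (\<lambda>z. w z + B * norm (U (x - z)) powr p)"
    using w by simp
  show "AE z in lborel. norm (w z * norm (U (x - z))) \<le> norm (w z + B * norm (U (x - z)) powr p)"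
  proof (rule AE_I2)
    fix z
    let ?u = "norm (U (x - z))"
    have "w z * ?u \<le> w z + B * ?u powr p"
    proof (cases "?u \<le> 1")
      case True
      then have "w z * ?u \<le> w z" using w(1) by (simp add: mult_left_le)
      moreover have "0 \<le> B * ?u powr p" using order_trans[OF w(1) w(2)] by simp
      ultimately show ?thesis by linarith
    next
      case False
      then have "?u powr 1 \<le> ?u powr p" using p by (intro powr_mono) auto
      then have "w z * ?u \<le> B * ?u powr p"
        using w(1,2) False by (intro mult_mono) (auto intro: order_trans[OF w(1) w(2)])
      then show ?thesis using w(1)[of z] by linarith
    qed
    then show "norm (w z * ?u) \<le> norm (w z + B * ?u powr p)"
      using w(1)[of z] by (simp add: abs_of_nonneg)
  qed
qed measurable
qed

text \<open>Young's convolution inequality for an integrable kernel: Jensen's inequality in z gives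
  the factor A^(p-1) with A the mass of w, and Fubini with translation invariance the remaining
  factor A.\<close>

lemma young_Lpow:
  fixes U :: "'a::euclidean_space \<Rightarrow> complex"
  assumes [measurable]: "U \<in> borel_measurable borel" and fin: "Lpow p U < \<infinity>" and p: "1 \<le> p"
    and w: "\<And>z. 0 \<le> w z" "\<And>z. w z \<le> B" "integrable lborel w"
  shows "(\<integral>\<^sup>+x. ennreal ((LINT z|lborel. w z * norm (U (x - z))) powr p) \<partial>lborel)
    \<le> ennreal ((LINT z|lborel. w z) powr p) * Lpow p U"
proof -
  have [measurable]: "w \<in> borel_measurable borel" using w by auto
  let ?A = "LINT z|lborel. w z"
  have A0: "0 \<le> ?A" using w by simp
  have "(\<integral>\<^sup>+x. ennreal ((LINT z|lborel. w z * norm (U (x - z))) powr p) \<partial>lborel)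
    \<le> (\<integral>\<^sup>+x. ennreal (?A powr (p - 1)) * (\<integral>\<^sup>+z. ennreal (w z * norm (U (x - z)) powr p) \<partial>lborel) \<partial>lborel)"
  proof (rule nn_integral_mono)
    fix x
    show "ennreal ((LINT z|lborel. w z * norm (U (x - z))) powr p)
      \<le> ennreal (?A powr (p - 1)) * (\<integral>\<^sup>+z. ennreal (w z * norm (U (x - z)) powr p) \<partial>lborel)"
      by (rule integral_powr_le[OF w(1) w(3) _ integrable_convolution_Lpow[OF assms(1) fin p w] _ p]) auto
  qed
  also have "\<dots> = ennreal (?A powr (p - 1)) * (\<integral>\<^sup>+x. (\<integral>\<^sup>+z. ennreal (w z * norm (U (x - z)) powr p) \<partial>lborel) \<partial>lborel)"
    by (rule nn_integral_cmult) measurable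
  also have "(\<integral>\<^sup>+x. (\<integral>\<^sup>+z. ennreal (w z * norm (U (x - z)) powr p) \<partial>lborel) \<partial>lborel)
    = (\<integral>\<^sup>+z. (\<integral>\<^sup>+x. ennreal (w z * norm (U (x - z)) powr p) \<partial>lborel) \<partial>lborel)"
    by (rule lborel_pair.Fubini') measurable
  also have "\<dots> = (\<integral>\<^sup>+z. ennreal (w z) * Lpow p U \<partial>lborel)"
  proof (rule nn_integral_cong)
    fix z
    have "(\<integral>\<^sup>+x. ennreal (w z * norm (U (x - z)) powr p) \<partial>lborel) = ennreal (w z) * (\<integral>\<^sup>+x. ennreal (norm (U (x + - z)) powr p) \<partial>lborel)"
      using w(1) by (subst nn_integral_cmult[symmetric]) (auto simp: ennreal_mult)
    then show "(\<integral>\<^sup>+x. ennreal (w z * norm (U (x - z)) powr p) \<partial>lborel) = ennreal (w z) * Lpow p U"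
      unfolding Lpow_def by (subst (asm) nn_integral_lborel_translate) measurable
  qed
  also have "\<dots> = ennreal ?A * Lpow p U"
    using w by (subst nn_integral_multc) (auto simp: nn_integral_eq_integral)
  also have "ennreal (?A powr (p - 1)) * (ennreal ?A * Lpow p U) = ennreal (?A powr p) * Lpow p U"
  proof -
    have "?A powr (p - 1) * ?A = ?A powr p"
      using A0 p by (cases "?A = 0") (auto simp: powr_diff)
    then show ?thesis
      using A0 by (simp add: mult.assoc[symmetric] ennreal_mult[symmetric])
  qed
  finally show ?thesis .
qed

text \<open>Encodes localization in frequency: if the symbol of K is one on the spectrum of U,
  convolution with K returns U. The identity is required at every point, which makes U its
  continuous representative. The finite norm guarantees that the convolution integral converges and
  later permits absorption.\<close>

definition reproduces :: "('a::euclidean_space \<Rightarrow> complex) \<Rightarrow> real \<Rightarrow> ('a \<Rightarrow> complex) \<Rightarrow> bool" where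
  "reproduces K p U \<longleftrightarrow> U \<in> borel_measurable borel \<and> Lpow p U < \<infinity> \<and>
     (\<forall>x. U x = (LINT z|lborel. K z * U (x - z)))"

lemma reproducesD:
  assumes "reproduces K p U"
  shows "U \<in> borel_measurable borel" "Lpow p U < \<infinity>" "U x = (LINT z|lborel. K z * U (x - z))"
  using assms unfolding reproduces_def by blast+

lemma reproduces_integrable:
  assumes K: "K \<in> schwartz" and U: "reproduces K p U" and p: "1 \<le> p"
  shows "integrable lborel (\<lambda>z. norm (K z) * norm (U (x - z)))" "integrable lborel (\<lambda>z. K z * U (x - z))"
proof -
  have [measurable]: "U \<in> borel_measurable borel" "K \<in> borel_measurable borel"
    using reproducesD(1)[OF U] schwartz_measurable[OF K] by auto
  obtain B where B: "\<And>z. norm (K z) \<le> B" using schwartz_bounded[OF K] by blast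
  show i: "integrable lborel (\<lambda>z. norm (K z) * norm (U (x - z)))"
    by (rule integrable_convolution_Lpow[OF _ reproducesD(2)[OF U] p _ B integrable_norm[OF schwartz_integrable[OF K]]])
       auto
  show "integrable lborel (\<lambda>z. K z * U (x - z))"
    by (rule Bochner_Integration.integrable_bound[OF i]) (auto simp: norm_mult)
qed

text \<open>Increments of U are moved onto the kernel, where they are at most norm (a - b) times an
  integrable weight w. The majorant m is the convolution of w with the modulus of U, and Young's
  inequality bounds it. The constant depends on K, p and R but not on U.\<close>

lemma reproduces_lipschitz:
  fixes K :: "'a::euclidean_space \<Rightarrow> complex"
  assumes K: "K \<in> schwartz" and p: "1 \<le> p" and R: "0 \<le> R"
  obtains B where "0 \<le> B"
    "\<And>U. reproduces K p U \<Longrightarrow> \<exists>m. m \<in> borel_measurable borel \<and> (\<forall>x. 0 \<le> m x) \<and>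
       (\<forall>x a b. norm a \<le> R \<longrightarrow> norm b \<le> R \<longrightarrow> norm (U (x + a) - U (x + b)) \<le> norm (a - b) * m x) \<and>
       (\<integral>\<^sup>+x. ennreal (m x powr p) \<partial>lborel) \<le> ennreal B * Lpow p U"
proof -
  let ?N = "2 * DIM('a)"
  obtain C where C: "0 \<le> C"
    "\<And>x a. norm (K (x + a) - K x) \<le> C * norm a * (1 + norm a) ^ ?N * inverse ((1 + norm x) ^ ?N)"
    using schwartz_mean_value[OF K, of ?N] by blast
  \<comment> \<open>The factor with 2 R comes from norm (a - b) \<le> 2 R in the mean value
    estimate, the one with R from moving the decay from z + b to z.\<close>
  define c where "c = C * (1 + 2 * R) ^ ?N * (1 + R) ^ ?N"
  have c0: "0 \<le> c" using C R by (simp add: c_def)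
  define w where "w z = c * inverse ((1 + norm z) ^ ?N)" for z :: 'a
  have w0: "0 \<le> w z" for z using c0 by (simp add: w_def)
  have wB: "w z \<le> c" for z
    using c0 unfolding w_def by (intro mult_left_le) (auto intro!: inverse_le_1_iff[THEN iffD2] one_le_power)
  have wi: "integrable lborel w"
    unfolding w_def by (intro integrable_mult_right integrable_inverse_one_plus_norm)
  have [measurable]: "w \<in> borel_measurable borel" using wi by auto
  have lip: "norm (K (z + a) - K (z + b)) \<le> norm (a - b) * w z" if "norm a \<le> R" "norm b \<le> R" for z a b
  proof -
    have ab: "norm (a - b) \<le> 2 * R" using norm_triangle_ineq4[of a b] that by linarith
    have "norm (K (z + b + (a - b)) - K (z + b)) \<le> C * norm (a - b) * (1 + norm (a - b)) ^ ?N * inverse ((1 + norm (z + b)) ^ ?N)"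
      by (rule C)
    also have "\<dots> \<le> C * norm (a - b) * (1 + 2 * R) ^ ?N * ((1 + R) ^ ?N * inverse ((1 + norm z) ^ ?N))"
    proof (intro mult_mono power_mono add_mono ab order_refl)
      have "1 + norm z \<le> (1 + norm (z + b)) * (1 + norm (- b))"
        using one_plus_norm_add_le[of "z + b" "- b"] by simp
      also have "\<dots> \<le> (1 + norm (z + b)) * (1 + R)"
        using that by (intro mult_left_mono) auto
      finally have "(1 + norm z) ^ ?N \<le> (1 + norm (z + b)) ^ ?N * (1 + R) ^ ?N"
        unfolding power_mult_distrib[symmetric] by (intro power_mono) auto
      moreover have "0 < (1 + norm z) ^ ?N" "0 < (1 + norm (z + b)) ^ ?N"
        by (intro zero_less_power; simp add: add_pos_nonneg)+
      ultimately show "inverse ((1 + norm (z + b)) ^ ?N) \<le> (1 + R) ^ ?N * inverse ((1 + norm z) ^ ?N)"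
        by (simp add: field_simps)
    qed (use C R in auto)
    finally show ?thesis by (simp add: w_def c_def mult_ac)
  qed
  show ?thesis
  proof (rule that[of "(LINT z|lborel. w z) powr p"])
    fix U assume U: "reproduces K p U"
    have [measurable]: "U \<in> borel_measurable borel" using reproducesD(1)[OF U] .
    have fin: "Lpow p U < \<infinity>" using reproducesD(2)[OF U] .
    have [measurable]: "K \<in> borel_measurable borel" using K by (rule schwartz_measurable)
    define m where "m x = (LINT z|lborel. w z * norm (U (x - z)))" for x
    have mi: "integrable lborel (\<lambda>z. w z * norm (U (x - z)))" for x
      by (rule integrable_convolution_Lpow[OF _ fin p w0 wB wi]) measurable
    have shift: "U (x + a) = (LINT z|lborel. K (z + a) * U (x - z)) \<and> integrable lborel (\<lambda>z. K (z + a) * U (x - z))" for x a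
    proof -
      have "U (x + a) = (LINT z|lborel. K z * U (x + a - z))" using reproducesD(3)[OF U] .
      also have "\<dots> = (LINT z|lborel. K (z + a) * U (x + a - (z + a)))"
        by (rule integral_lborel_translate[symmetric]) measurable
      finally have "U (x + a) = (LINT z|lborel. K (z + a) * U (x - z))" by simp
      moreover have "integrable lborel (\<lambda>z. K (z + a) * U (x + a - (z + a)))"
        using integrable_lborel_translate[OF reproduces_integrable(2)[OF K U p, of "x + a"], of a] by simp
      ultimately show ?thesis by simp
    qed
    have "norm (U (x + a) - U (x + b)) \<le> norm (a - b) * m x" if "norm a \<le> R" "norm b \<le> R" for x a b
    proof -
      have "U (x + a) - U (x + b) = (LINT z|lborel. (K (z + a) - K (z + b)) * U (x - z))"
        using shift[of x a] shift[of x b] by (simp add: left_diff_distrib)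
      also have "norm \<dots> \<le> (LINT z|lborel. norm ((K (z + a) - K (z + b)) * U (x - z)))"
        by (rule integral_norm_bound)
      also have "\<dots> \<le> (LINT z|lborel. norm (a - b) * (w z * norm (U (x - z))))"
      proof (rule integral_mono)
        show "integrable lborel (\<lambda>z. norm ((K (z + a) - K (z + b)) * U (x - z)))"
          using shift[of x a] shift[of x b] by (intro integrable_norm) (simp add: left_diff_distrib)
        show "integrable lborel (\<lambda>z. norm (a - b) * (w z * norm (U (x - z))))"
          by (intro integrable_mult_right mi)
        show "norm ((K (z + a) - K (z + b)) * U (x - z)) \<le> norm (a - b) * (w z * norm (U (x - z)))" for z
          using mult_right_mono[OF lip[OF that, of z] norm_ge_zero[of "U (x - z)"]] by (simp add: norm_mult mult.assoc)
      qed
      finally show ?thesis by (simp add: m_def)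
    qed
    moreover have "m \<in> borel_measurable borel" unfolding m_def by measurable
    moreover have "0 \<le> m x" for x unfolding m_def using w0 by (intro integral_nonneg_AE) auto
    moreover have "(\<integral>\<^sup>+x. ennreal (m x powr p) \<partial>lborel) \<le> ennreal ((LINT z|lborel. w z) powr p) * Lpow p U"
      unfolding m_def by (rule young_Lpow[OF _ fin p w0 wB wi]) measurable
    ultimately show "\<exists>m. m \<in> borel_measurable borel \<and> (\<forall>x. 0 \<le> m x) \<and>
       (\<forall>x a b. norm a \<le> R \<longrightarrow> norm b \<le> R \<longrightarrow> norm (U (x + a) - U (x + b)) \<le> norm (a - b) * m x) \<and>
       (\<integral>\<^sup>+x. ennreal (m x powr p) \<partial>lborel) \<le> ennreal ((LINT z|lborel. w z) powr p) * Lpow p U"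
      by blast
  qed simp
qed

text \<open>The squared difference of the powers is at most (p/2)^2 (norm k)^2 m^2 times the
  (p-2)-nd power of the larger modulus. In the constant, B accounts for m, and 2 for U and its
  translate.\<close>

lemma reproduces_upper:
  fixes K :: "'a::euclidean_space \<Rightarrow> complex"
  assumes K: "K \<in> schwartz" and p: "2 \<le> p"
  obtains C where "0 \<le> C"
    "\<And>U k. reproduces K p U \<Longrightarrow> norm k \<le> 1 \<Longrightarrow>
       (\<integral>\<^sup>+x. ennreal ((norm (U (x + k)) powr (p/2) - norm (U x) powr (p/2))\<^sup>2) \<partial>lborel)
         \<le> ennreal (C * (norm k)\<^sup>2) * Lpow p U"
proof -
  have p1: "1 \<le> p" using p by simp
  obtain B where B: "0 \<le> B"
    "\<And>U. reproduces K p U \<Longrightarrow> \<exists>m. m \<in> borel_measurable borel \<and> (\<forall>x. 0 \<le> m x) \<and>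
       (\<forall>x a b. norm a \<le> 1 \<longrightarrow> norm b \<le> 1 \<longrightarrow> norm (U (x + a) - U (x + b)) \<le> norm (a - b) * m x) \<and>
       (\<integral>\<^sup>+x. ennreal (m x powr p) \<partial>lborel) \<le> ennreal B * Lpow p U"
    using reproduces_lipschitz[OF K p1, of 1] by auto
  show ?thesis
  proof (rule that[of "(p/2)\<^sup>2 * (B + 2)"])
    fix U and k :: 'a assume U: "reproduces K p U" and k: "norm k \<le> 1"
    have [measurable]: "U \<in> borel_measurable borel" using reproducesD(1)[OF U] .
    obtain m where m [measurable]: "m \<in> borel_measurable borel" and m0: "\<And>x. 0 \<le> m x"
      and lip: "\<And>x a b. norm a \<le> 1 \<Longrightarrow> norm b \<le> 1 \<Longrightarrow> norm (U (x + a) - U (x + b)) \<le> norm (a - b) * m x"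
      and mB: "(\<integral>\<^sup>+x. ennreal (m x powr p) \<partial>lborel) \<le> ennreal B * Lpow p U"
      using B(2)[OF U] by blast
    let ?c = "(p/2)\<^sup>2 * (norm k)\<^sup>2"
    have pt: "(norm (U (x + k)) powr (p/2) - norm (U x) powr (p/2))\<^sup>2
      \<le> ?c * (m x powr p + (norm (U (x + k)) powr p + norm (U x) powr p))" for x
    proof -
      let ?s = "norm (U (x + k))" and ?t = "norm (U x)"
      have "\<bar>?s - ?t\<bar> \<le> norm k * m x"
        using lip[of k 0 x] k norm_triangle_ineq3[of "U (x + k)" "U x"] by simp
      then have st: "p/2 * \<bar>?s - ?t\<bar> * max ?s ?t powr (p/2 - 1) \<le> p/2 * (norm k * m x) * max ?s ?t powr (p/2 - 1)"
        using p by (intro mult_right_mono mult_left_mono) auto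
      have "\<bar>?s powr (p/2) - ?t powr (p/2)\<bar> \<le> p/2 * \<bar>?s - ?t\<bar> * max ?s ?t powr (p/2 - 1)"
        by (rule powr_diff_le) (use p in auto)
      from order_trans[OF this st]
      have "\<bar>?s powr (p/2) - ?t powr (p/2)\<bar> \<le> p/2 * (norm k * m x) * max ?s ?t powr (p/2 - 1)" .
      then have "\<bar>?s powr (p/2) - ?t powr (p/2)\<bar>\<^sup>2 \<le> (p/2 * (norm k * m x) * max ?s ?t powr (p/2 - 1))\<^sup>2"
        by (intro power_mono) auto
      also have "\<dots> = ?c * ((m x)\<^sup>2 * max ?s ?t powr (p - 2))"
      proof -
        have "(max ?s ?t powr (p/2 - 1))\<^sup>2 = max ?s ?t powr (p - 2)"
          using powr_half_square[of "max ?s ?t" "p - 2"] by (simp add: diff_divide_distrib le_max_iff_disj)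
        then show ?thesis by (simp only: power_mult_distrib mult_ac)
      qed
      also have "(m x)\<^sup>2 * max ?s ?t powr (p - 2) \<le> m x powr p + (?s powr p + ?t powr p)"
      proof -
        \<comment> \<open>Bounding the product by the p-th power of the largest factor avoids
          Hoelder's inequality with exponents p/2 and p/(p-2), which degenerates at p = 2.\<close>
        define y where "y = max (m x) (max ?s ?t)"
        have y0: "0 \<le> y" by (simp add: y_def le_max_iff_disj)
        have "(m x)\<^sup>2 * max ?s ?t powr (p - 2) \<le> y\<^sup>2 * y powr (p - 2)"
          using m0[of x] p by (intro mult_mono power_mono powr_mono2) (auto simp: y_def le_max_iff_disj)
        also have "\<dots> = y powr p"
          using y0 by (cases "y = 0") (auto simp: powr_diff powr_numeral)
        also have "\<dots> \<le> m x powr p + (?s powr p + ?t powr p)"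
          by (auto simp: y_def max_def)
        finally show ?thesis .
      qed
      finally show ?thesis by (simp add: mult_left_mono)
    qed
    have "(\<integral>\<^sup>+x. ennreal ((norm (U (x + k)) powr (p/2) - norm (U x) powr (p/2))\<^sup>2) \<partial>lborel)
      \<le> (\<integral>\<^sup>+x. ennreal ?c * (ennreal (m x powr p) + (ennreal (norm (U (x + k)) powr p) + ennreal (norm (U x) powr p))) \<partial>lborel)"
      using pt by (intro nn_integral_mono) (simp add: ennreal_mult'[symmetric] ennreal_plus[symmetric] ennreal_leI del: ennreal_plus)
    also have "\<dots> = ennreal ?c * ((\<integral>\<^sup>+x. ennreal (m x powr p) \<partial>lborel) + ((\<integral>\<^sup>+x. ennreal (norm (U (x + k)) powr p) \<partial>lborel) + Lpow p U))"
      by (simp add: nn_integral_cmult nn_integral_add Lpow_def)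
    also have "(\<integral>\<^sup>+x. ennreal (norm (U (x + k)) powr p) \<partial>lborel) = Lpow p U"
      unfolding Lpow_def by (rule nn_integral_lborel_translate) measurable
    also have "ennreal ?c * ((\<integral>\<^sup>+x. ennreal (m x powr p) \<partial>lborel) + (Lpow p U + Lpow p U))
      \<le> ennreal ?c * (ennreal B * Lpow p U + (Lpow p U + Lpow p U))"
      by (intro mult_left_mono add_mono mB) auto
    also have "ennreal B * Lpow p U + (Lpow p U + Lpow p U) = ennreal (B + 2) * Lpow p U"
      using B(1) by (simp add: distrib_right mult_2)
    also have "ennreal ?c * (ennreal (B + 2) * Lpow p U) = ennreal ((p/2)\<^sup>2 * (B + 2) * (norm k)\<^sup>2) * Lpow p U"
    proof -
      have "(p/2)\<^sup>2 * (B + 2) * (norm k)\<^sup>2 = ?c * (B + 2)" by (simp only: mult_ac)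
      then have "ennreal ((p/2)\<^sup>2 * (B + 2) * (norm k)\<^sup>2) = ennreal ?c * ennreal (B + 2)"
        using B(1) by (simp only: ennreal_mult' zero_le_mult_iff zero_le_power2 simp_thms)
      then show ?thesis by (simp only: mult.assoc)
    qed
    finally show "(\<integral>\<^sup>+x. ennreal ((norm (U (x + k)) powr (p/2) - norm (U x) powr (p/2))\<^sup>2) \<partial>lborel)
         \<le> ennreal ((p/2)\<^sup>2 * (B + 2) * (norm k)\<^sup>2) * Lpow p U" .
  qed (use B(1) in auto)
qed

section \<open>The lower bound for real-valued reproduced functions\<close>

lemma reproduces_continuous:
  assumes K: "K \<in> schwartz" and p: "1 \<le> p" and U: "reproduces K p U"
  shows "isCont U x"
proof -
  obtain m where m0: "\<And>x. 0 \<le> m x"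
    and lip: "\<And>x a b. norm a \<le> 1 \<Longrightarrow> norm b \<le> 1 \<Longrightarrow> norm (U (x + a) - U (x + b)) \<le> norm (a - b) * m x"
    using reproduces_lipschitz[OF K p, of 1] U by (metis zero_le_one)
  show ?thesis unfolding isCont_def LIM_def
  proof (intro allI impI)
    fix r :: real assume r: "0 < r"
    define s where "s = min 1 (r / (m x + 1))"
    have s: "0 < s" using r m0[of x] by (simp add: s_def add_nonneg_pos)
    have "dist (U y) (U x) < r" if "dist y x < s" for y
    proof -
      have y: "norm (y - x) \<le> 1" "norm (y - x) < r / (m x + 1)" using that by (auto simp: s_def dist_norm)
      have "norm (U y - U x) \<le> norm (y - x) * m x" using lip[of "y - x" 0 x] y by simp
      also have "\<dots> \<le> norm (y - x) * (m x + 1)" by (intro mult_left_mono) auto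
      also have "\<dots> < r" using y(2) m0[of x] by (simp add: pos_less_divide_eq add_nonneg_pos)
      finally show ?thesis by (simp add: dist_norm)
    qed
    then show "\<exists>s>0. \<forall>y. y \<noteq> x \<and> dist y x < s \<longrightarrow> dist (U y) (U x) < r" using s by blast
  qed
qed

lemma real_valued_zero_on_segment:
  fixes U :: "'a::real_normed_vector \<Rightarrow> complex"
  assumes cont: "\<And>y. isCont U y" and real: "\<And>y. U y \<in> \<real>"
    and sign: "Re (U x) * Re (U (x + h)) < 0"
  shows "\<exists>e. norm e \<le> norm h \<and> U (x + e) = 0"
proof -
  define f where "f t = Re (U (x + t *\<^sub>R h))" for t
  have c: "continuous_on {0..1} f"
    unfolding f_def
    by (intro continuous_at_imp_continuous_on ballI isCont_o2[OF _ isCont_Re[OF cont]] continuous_intros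
        continuous_Re isCont_o2[OF _ cont])
  have "\<exists>t\<ge>0. t \<le> 1 \<and> f t = 0"
  proof (cases "f 0 \<le> 0")
    case True
    then have "0 \<le> f 1" using sign by (auto simp: f_def mult_less_0_iff)
    then show ?thesis using IVT'[of f 0 0 1] True c by auto
  next
    case False
    then have "f 1 \<le> 0" using sign by (auto simp: f_def mult_less_0_iff)
    then show ?thesis using IVT2'[of f 1 0 0] False c by auto
  qed
  then obtain t where t: "0 \<le> t" "t \<le> 1" "f t = 0" by blast
  have "U (x + t *\<^sub>R h) = 0" using real[of "x + t *\<^sub>R h"] t(3)
    by (simp add: f_def complex_is_Real_iff complex_eq_iff)
  then show ?thesis using t by (intro exI[of _ "t *\<^sub>R h"]) (auto simp: mult_left_le_one_le)
qed

lemma integral_tail_tendsto: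
  fixes K :: "'a::euclidean_space \<Rightarrow> complex"
  assumes "integrable lborel K"
  shows "(\<lambda>n. LINT z|lborel. norm (K z) * indicator {z. real n < norm z} z) \<longlonglongrightarrow> 0"
proof -
  have [measurable]: "K \<in> borel_measurable borel" using assms by auto
  have "(\<lambda>n. LINT z|lborel. norm (K z) * indicator {z. real n < norm z} z) \<longlonglongrightarrow> (LINT z|(lborel :: 'a measure). 0)"
  proof (rule integral_dominated_convergence[where w="\<lambda>z. norm (K z)"])
    show "AE z in lborel. (\<lambda>n. norm (K z) * indicator {z. real n < norm z} z) \<longlonglongrightarrow> 0"
    proof (rule AE_I2)
      fix z
      have "\<forall>\<^sub>F n in sequentially. norm (K z) * indicator {z. real n < norm z} z = 0"
        using eventually_ge_at_top[of "nat \<lceil>norm z\<rceil>"] by eventually_elim (auto simp: indicator_def)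
      then show "(\<lambda>n. norm (K z) * indicator {z. real n < norm z} z) \<longlonglongrightarrow> 0" by (rule tendsto_eventually)
    qed
    show "AE z in lborel. norm (norm (K z) * indicator {z. real n < norm z} z) \<le> norm (K z)" for n
      by (auto simp: indicator_def)
  qed (use assms in auto)
  then show ?thesis by simp
qed

text \<open>Close to a zero of \<open>U\<close> the modulus is small on a ball of radius \<open>r\<close>, so that a large value of
  \<open>U\<close> at \<open>x\<close> forces the modulus to vary.\<close>

lemma powr_le_near_zero:
  fixes U :: "'a::euclidean_space \<Rightarrow> complex"
  assumes [measurable]: "U \<in> borel_measurable borel" and p: "0 \<le> p"
    and lip: "\<And>a b. norm a \<le> R + 1 \<Longrightarrow> norm b \<le> R + 1 \<Longrightarrow> norm (U (x + a) - U (x + b)) \<le> norm (a - b) * m"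
    and m: "0 \<le> m" and r: "0 < r" "r \<le> 1" and e: "norm e \<le> R" "U (x + e) = 0"
  shows "ennreal (norm (U x) powr p) \<le>
    ennreal (2 / measure lborel (cball (0::'a) r)) * (\<integral>\<^sup>+k. indicator (cball 0 (R + 1)) k *
        ennreal ((norm (U (x + k)) powr (p/2) - norm (U x) powr (p/2))\<^sup>2) \<partial>lborel)
    + ennreal (2 * r powr p * m powr p)"
proof -
  define V where "V y = norm (U y) powr (p/2)" for y
  have [measurable]: "V \<in> borel_measurable borel" unfolding V_def by measurable
  have [measurable]: "cball (0::'a) s \<in> sets borel" for s by simp
  define vol where "vol = measure lborel (cball (0::'a) r)"
  have vol: "0 < vol" unfolding vol_def using r by (intro content_cball_pos)
  have em: "emeasure lborel (cball (0::'a) r) = ennreal vol"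
    unfolding vol_def using emeasure_bounded_finite[of "cball (0::'a) r"]
    by (intro emeasure_eq_ennreal_measure) auto
  let ?G = "\<lambda>k. ennreal ((V (x + k) - V x)\<^sup>2)"
  have pt: "(V x)\<^sup>2 \<le> 2 * (V (x + (e + f)) - V x)\<^sup>2 + 2 * (r powr p * m powr p)" if f: "norm f \<le> r" for f
  proof -
    have "norm (U (x + (e + f))) \<le> norm f * m"
      using lip[of "e + f" e] e f r norm_triangle_ineq[of e f] by simp
    also have "\<dots> \<le> r * m" using f m by (rule mult_right_mono)
    finally have "norm (U (x + (e + f))) powr p \<le> (r * m) powr p"
      using p by (intro powr_mono2) auto
    then have b: "(V (x + (e + f)))\<^sup>2 \<le> r powr p * m powr p"
      using r m by (simp add: V_def powr_half_square powr_mult)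
    have "(V x)\<^sup>2 \<le> 2 * (V (x + (e + f)) - V x)\<^sup>2 + 2 * (V (x + (e + f)))\<^sup>2"
      using zero_le_power2[of "2 * V (x + (e + f)) - V x"] by (simp add: power2_diff power_mult_distrib algebra_simps)
    then show ?thesis using b by linarith
  qed
  have "ennreal (vol * (V x)\<^sup>2) = (\<integral>\<^sup>+f. ennreal ((V x)\<^sup>2) * indicator (cball (0::'a) r) f \<partial>lborel)"
    using vol by (subst nn_integral_cmult_indicator) (auto simp: em ennreal_mult mult.commute)
  \<comment> \<open>The average runs over the ball of radius r about the zero x + e. Seen from x,
    its displacements e + f have length at most R + 1, so the location of the zero can be forgotten
    and one fixed ball of displacements remains.\<close>
  also have "\<dots> \<le> (\<integral>\<^sup>+f. ennreal 2 * (indicator (cball 0 (R + 1)) (f + e) * ?G (f + e)) + ennreal (2 * (r powr p * m powr p)) * indicator (cball 0 r) f \<partial>lborel)"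
  proof (rule nn_integral_mono)
    fix f :: 'a
    show "ennreal ((V x)\<^sup>2) * indicator (cball 0 r) f
      \<le> ennreal 2 * (indicator (cball 0 (R + 1)) (f + e) * ?G (f + e)) + ennreal (2 * (r powr p * m powr p)) * indicator (cball 0 r) f"
    proof (cases "norm f \<le> r")
      case True
      then have "norm (f + e) \<le> R + 1" using norm_triangle_ineq[of f e] e r by linarith
      moreover have "ennreal ((V x)\<^sup>2) \<le> ennreal 2 * ?G (f + e) + ennreal (2 * (r powr p * m powr p))"
      proof -
        have "ennreal ((V x)\<^sup>2) \<le> ennreal (2 * (V (x + (e + f)) - V x)\<^sup>2 + 2 * (r powr p * m powr p))"
          by (intro ennreal_leI pt True)
        also have "\<dots> = ennreal 2 * ?G (f + e) + ennreal (2 * (r powr p * m powr p))"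
          by (subst ennreal_plus) (auto simp: ennreal_mult add.commute)
        finally show ?thesis .
      qed
      ultimately show ?thesis using True by simp
    qed (simp add: indicator_def)
  qed
  also have "\<dots> = ennreal 2 * (\<integral>\<^sup>+f. indicator (cball 0 (R + 1)) (f + e) * ?G (f + e) \<partial>lborel) + ennreal (2 * (r powr p * m powr p)) * ennreal vol"
    by (simp add: nn_integral_add nn_integral_cmult nn_integral_cmult_indicator em)
  also have "(\<integral>\<^sup>+f. indicator (cball 0 (R + 1)) (f + e) * ?G (f + e) \<partial>lborel) = (\<integral>\<^sup>+k. indicator (cball 0 (R + 1)) k * ?G k \<partial>lborel)"
    by (rule nn_integral_lborel_translate) measurable
  finally have "ennreal (inverse vol) * ennreal (vol * (V x)\<^sup>2) \<le> ennreal (inverse vol) * (ennreal 2 * (\<integral>\<^sup>+k. indicator (cball 0 (R + 1)) k * ?G k \<partial>lborel) + ennreal (2 * (r powr p * m powr p)) * ennreal vol)"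
    by (rule mult_left_mono) simp
  moreover have "ennreal (inverse vol) * ennreal (vol * (V x)\<^sup>2) = ennreal (norm (U x) powr p)"
    using vol by (simp add: ennreal_mult'[symmetric] V_def powr_half_square)
  moreover have "ennreal (inverse vol) * (ennreal 2 * (\<integral>\<^sup>+k. indicator (cball 0 (R + 1)) k * ?G k \<partial>lborel) + ennreal (2 * (r powr p * m powr p)) * ennreal vol)
    = ennreal (2 / vol) * (\<integral>\<^sup>+k. indicator (cball 0 (R + 1)) k * ?G k \<partial>lborel) + ennreal (2 * r powr p * m powr p)"
  proof -
    have "ennreal (inverse vol) * ennreal 2 = ennreal (2 / vol)"
      using vol by (subst ennreal_mult'[symmetric]) (auto simp: field_simps)
    moreover have "ennreal (inverse vol) * (ennreal (2 * (r powr p * m powr p)) * ennreal vol) = ennreal (2 * r powr p * m powr p)"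
      using vol by (subst ennreal_mult'[symmetric]; simp)+
    ultimately show ?thesis by (simp only: distrib_left mult.assoc[symmetric])
  qed
  ultimately show ?thesis by (simp only: V_def vol_def)
qed

text \<open>For values of the same sign the increment of \<open>U\<close> is controlled by that of the modulus; for
  values of opposite sign the zero in between is used.\<close>

lemma increment_powr_le:
  fixes U :: "'a::euclidean_space \<Rightarrow> complex"
  assumes U: "U \<in> borel_measurable borel" and p: "2 \<le> p"
    and lip: "\<And>a b. norm a \<le> R + 1 \<Longrightarrow> norm b \<le> R + 1 \<Longrightarrow> norm (U (x + a) - U (x + b)) \<le> norm (a - b) * m"
    and m: "0 \<le> m" and r: "0 < r" "r \<le> 1"
    and cont: "\<And>y. isCont U y" and real: "\<And>y. U y \<in> \<real>" and h: "norm h \<le> R"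
  shows "ennreal (norm (U (x + h) - U x) powr p) \<le>
    ennreal (2 * 2 powr p) * ennreal ((norm (U (x + h)) powr (p/2) - norm (U x) powr (p/2))\<^sup>2)
    + ennreal (3 * 2 powr p) * (ennreal (2 / measure lborel (cball (0::'a) r)) * (\<integral>\<^sup>+k. indicator (cball 0 (R + 1)) k *
        ennreal ((norm (U (x + k)) powr (p/2) - norm (U x) powr (p/2))\<^sup>2) \<partial>lborel)
    + ennreal (2 * r powr p * m powr p))"
    (is "?L \<le> ennreal ?c * ennreal ?D + ?E")
proof -
  let ?s = "norm (U (x + h))" and ?t = "norm (U x)"
  have Re: "U y = of_real (Re (U y))" for y using real[of y] by (auto elim: Reals_cases)
  have diff: "norm (U (x + h) - U x) = \<bar>Re (U (x + h)) - Re (U x)\<bar>"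
    by (subst (1 2) Re) (simp only: of_real_diff[symmetric] norm_of_real)
  have s: "?s = \<bar>Re (U (x + h))\<bar>" and t: "?t = \<bar>Re (U x)\<bar>"
    by (subst Re, simp only: norm_of_real)+
  show ?thesis
  proof (cases "Re (U x) * Re (U (x + h)) < 0")
    case False
    have "norm (U (x + h) - U x) = \<bar>?s - ?t\<bar>"
      unfolding diff s t using False by (auto simp: not_less zero_le_mult_iff)
    then have "norm (U (x + h) - U x) powr p = (\<bar>?s - ?t\<bar> powr (p/2))\<^sup>2"
      by (simp add: powr_half_square)
    also have "\<dots> \<le> (\<bar>?s powr (p/2) - ?t powr (p/2)\<bar>)\<^sup>2"
      using p by (intro power_mono abs_diff_powr_le) auto
    also have "\<dots> = 1 * ?D" by simp
    also have "\<dots> \<le> ?c * ?D"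
    proof (rule mult_right_mono)
      have "(1::real) \<le> 2 powr p" using p by (intro ge_one_powr_ge_zero) auto
      then show "1 \<le> ?c" by simp
    qed simp
    finally have "?L \<le> ennreal (?c * ?D)" by (rule ennreal_leI)
    also have "\<dots> = ennreal ?c * ennreal ?D" by (rule ennreal_mult') simp
    finally show ?thesis by (rule add_increasing2[rotated]) simp
  next
    case True
    obtain e where e: "norm e \<le> norm h" "U (x + e) = 0"
      using real_valued_zero_on_segment[OF cont real True] by blast
    have "norm (U (x + h) - U x) powr p \<le> (?s + ?t) powr p"
      using p by (intro powr_mono2 norm_triangle_ineq4) auto
    also have "\<dots> \<le> 2 powr p * (?s powr p + ?t powr p)"
      using p by (intro add_powr_le) auto
    \<comment> \<open>The value at x + h is traded for the one at x, by (a - 2 b)^2 \<ge> 0 for the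
      half powers, so that the estimate near a zero is needed at x only. This produces the
      coefficients 2 and 3 in the constants.\<close>
    also have "?s powr p + ?t powr p \<le> 2 * ?D + 3 * ?t powr p"
    proof -
      have "a\<^sup>2 + b\<^sup>2 \<le> 2 * (a - b)\<^sup>2 + 3 * b\<^sup>2" for a b :: real
        using zero_le_power2[of "a - 2 * b"] by (simp add: power2_eq_square algebra_simps)
      from this[of "?s powr (p/2)" "?t powr (p/2)"] show ?thesis
        by (simp only: powr_half_square norm_ge_zero)
    qed
    also have "2 powr p * (2 * ?D + 3 * ?t powr p) = ?c * ?D + 3 * 2 powr p * ?t powr p"
      by (simp only: distrib_left mult_ac)
    finally have "norm (U (x + h) - U x) powr p \<le> ?c * ?D + 3 * 2 powr p * ?t powr p"
      by (simp add: mult_left_mono)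
    then have "?L \<le> ennreal (?c * ?D + 3 * 2 powr p * ?t powr p)" by (rule ennreal_leI)
    also have "\<dots> = ennreal ?c * ennreal ?D + ennreal (3 * 2 powr p) * ennreal (?t powr p)"
      by (subst ennreal_plus) (auto simp: ennreal_mult' simp del: ennreal_numeral)
    also have "\<dots> \<le> ennreal ?c * ennreal ?D + ?E"
      by (intro add_left_mono mult_left_mono powr_le_near_zero[OF U _ lip m r order_trans[OF e(1) h] e(2)])
        (use p in auto)
    finally show ?thesis .
  qed
qed

text \<open>The term b N is at most half of N and can be moved to the left once N is finite. For
  infinite N the assumed inequality would carry no information about D.\<close>

lemma ennreal_absorb:
  fixes N D :: ennreal
  assumes le: "N \<le> a * D + b * N" and b: "b \<le> ennreal (1/2)" and N: "N < \<infinity>"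
  shows "N \<le> 2 * a * D"
proof (cases "a * D < \<infinity>")
  case True
  then obtain d where d: "a * D = ennreal d" "0 \<le> d" by (cases "a * D") auto
  obtain n where n: "N = ennreal n" "0 \<le> n" using N by (cases N) auto
  have "b * N \<le> ennreal (1/2) * ennreal n" unfolding n using b by (intro mult_right_mono) auto
  then have "ennreal n \<le> ennreal d + ennreal (1/2) * ennreal n"
    using le unfolding d n by (meson add_left_mono order_trans)
  also have "\<dots> = ennreal (d + 1/2 * n)"
  proof -
    have "ennreal (d + 1/2 * n) = ennreal d + ennreal (1/2 * n)" using d n by (intro ennreal_plus) auto
    moreover have "ennreal (1/2 * n) = ennreal (1/2) * ennreal n" by (rule ennreal_mult') simp
    ultimately show ?thesis by (simp only:)
  qed
  finally have "n \<le> d + 1/2 * n" using d n by (subst (asm) ennreal_le_iff) auto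
  then have "ennreal n \<le> ennreal (2 * d)" by (intro ennreal_leI) simp
  then show ?thesis using d n by (simp add: mult.assoc ennreal_mult)
next
  case False
  then have "2 * a * D = \<infinity>" by (simp add: mult.assoc not_less top_unique ennreal_mult_top)
  then show ?thesis by simp
qed

lemma absorb_rearrange:
  fixes a k t v r D N q \<kappa> A :: ennreal
  shows "a * (k * D + (t * (v * D + r * N)) * A + (q * (\<kappa> * N) + q * N * \<kappa>))
    = (a * k + a * (t * A) * v) * D + (a * (t * A) * r + a * (2 * q) * \<kappa>) * N"
  unfolding mult_2 by (simp only: distrib_left distrib_right mult_ac add_ac)

text \<open>The order of the choices matters. The radius R is fixed by the tail of K; the Lipschitz
  constant B belongs to R + 1; and the radius r of the ball about a zero is chosen small in terms of
  B. The volume of that ball enters only the factor of the difference integral, so small r does no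
  harm. The tail and the Lipschitz terms each contribute at most 1/4 of the norm.\<close>

lemma reproduces_lower:
  fixes K :: "'a::euclidean_space \<Rightarrow> complex"
  assumes K: "K \<in> schwartz" and K0: "(LINT z|lborel. K z) = 0" and p: "2 \<le> p"
  obtains R C where "0 \<le> R" "0 \<le> C"
    "\<And>U. reproduces K p U \<Longrightarrow> (\<And>x. U x \<in> \<real>) \<Longrightarrow>
       Lpow p U \<le> ennreal C * (\<integral>\<^sup>+x. (\<integral>\<^sup>+k. indicator (cball 0 R) k *
          ennreal ((norm (U (x + k)) powr (p/2) - norm (U x) powr (p/2))\<^sup>2) \<partial>lborel) \<partial>lborel)"
proof -
  have p1: "1 \<le> p" using p by simp
  have [measurable]: "K \<in> borel_measurable borel" using K by (rule schwartz_measurable)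
  have Ki: "integrable lborel K" using K by (rule schwartz_integrable)
  obtain Kb where Kb: "0 \<le> Kb" "\<And>z. norm (K z) \<le> Kb" using schwartz_bounded[OF K] by blast
  define A where "A = (LINT z|lborel. norm (K z))"
  have A0: "0 \<le> A" unfolding A_def by simp
  have Ann: "(\<integral>\<^sup>+z. ennreal (norm (K z)) \<partial>lborel) = ennreal A"
    unfolding A_def using Ki by (intro nn_integral_eq_integral) auto
  \<comment> \<open>The factor from Jensen's inequality for the weight norm (K z), whose total mass
    is A.\<close>
  define a where "a = A powr (p - 1)"
  have a0: "0 \<le> a" by (simp add: a_def)
  define q where "q = 2 powr p"
  have q0: "0 < q" by (simp add: q_def)
  \<comment> \<open>On the tail the increment is bounded crudely by both values of U. Each of the
    two contributes q times the tail mass times the norm, whence 2 q.\<close>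
  obtain n where n: "a * (2 * q) * (LINT z|lborel. norm (K z) * indicator {z. real n < norm z} z) \<le> 1/4"
  proof -
    have "(\<lambda>n. a * (2 * q) * (LINT z|lborel. norm (K z) * indicator {z. real n < norm z} z)) \<longlonglongrightarrow> a * (2 * q) * 0"
      by (intro tendsto_mult_left integral_tail_tendsto Ki)
    then have "\<forall>\<^sub>F n in sequentially. a * (2 * q) * (LINT z|lborel. norm (K z) * indicator {z. real n < norm z} z) < 1/4"
      by (rule order_tendstoD) simp
    then show ?thesis using that by (auto simp: eventually_sequentially intro: less_imp_le)
  qed
  define R where "R = real n"
  have R0: "0 \<le> R" by (simp add: R_def)
  define tail where "tail z = norm (K z) * indicator {z. R < norm z} z" for z
  define \<kappa> where "\<kappa> = (LINT z|lborel. tail z)"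
  have tail_meas [measurable]: "tail \<in> borel_measurable borel" unfolding tail_def by measurable
  have tail0: "0 \<le> tail z" for z by (simp add: tail_def)
  have \<kappa>0: "0 \<le> \<kappa>" unfolding \<kappa>_def using tail0 by simp
  have \<kappa>le: "a * (2 * q) * \<kappa> \<le> 1/4" using n by (simp add: \<kappa>_def tail_def R_def)
  have tail_nn: "(\<integral>\<^sup>+z. ennreal (tail z) \<partial>lborel) = ennreal \<kappa>"
    unfolding \<kappa>_def
  proof (rule nn_integral_eq_integral)
    show "integrable lborel tail"
      by (rule Bochner_Integration.integrable_bound[OF integrable_norm[OF Ki]]) (auto simp: tail_def indicator_def)
  qed (simp add: tail0)
  obtain B where B: "0 \<le> B"
    "\<And>U. reproduces K p U \<Longrightarrow> \<exists>m. m \<in> borel_measurable borel \<and> (\<forall>x. 0 \<le> m x) \<and>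
       (\<forall>x a b. norm a \<le> R + 1 \<longrightarrow> norm b \<le> R + 1 \<longrightarrow> norm (U (x + a) - U (x + b)) \<le> norm (a - b) * m x) \<and>
       (\<integral>\<^sup>+x. ennreal (m x powr p) \<partial>lborel) \<le> ennreal B * Lpow p U"
    using reproduces_lipschitz[OF K p1, of "R + 1"] R0 by auto
  \<comment> \<open>Since r \<le> 1 and 1 \<le> p, r^p is at most r, so a choice of size inverse to
    the coefficient suffices. The added 1 covers the case of a vanishing coefficient.\<close>
  define r where "r = min 1 (inverse (a * A * (3 * q) * 2 * B * 4 + 1))"
  have r: "0 < r" "r \<le> 1" using a0 A0 q0 B(1) by (auto simp: r_def intro!: add_nonneg_pos mult_nonneg_nonneg)
  have rB: "a * (3 * q * A) * (2 * r powr p * B) \<le> 1/4"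
  proof -
    let ?Q = "a * A * (3 * q) * 2 * B"
    have Q: "0 \<le> ?Q" using a0 A0 q0 B(1) by (intro mult_nonneg_nonneg) auto
    have "r powr p \<le> r powr 1" using r p by (intro powr_mono') auto
    then have "r powr p \<le> r" using r by simp
    then have "?Q * r powr p \<le> ?Q * r" using Q by (rule mult_left_mono)
    also have "\<dots> \<le> ?Q * inverse (?Q * 4 + 1)" using Q by (intro mult_left_mono) (auto simp: r_def)
    also have "\<dots> \<le> 1/4" using Q by (simp add: field_simps)
    finally show ?thesis by (simp only: mult_ac)
  qed
  define vol where "vol = measure lborel (cball (0::'a) r)"
  have vol: "0 < vol" unfolding vol_def using r by (intro content_cball_pos)
  define c where "c = a * (Kb * (2 * q)) + a * (3 * q * A) * (2 / vol)"
  have c0: "0 \<le> c" unfolding c_def using a0 A0 q0 Kb vol by (intro add_nonneg_nonneg mult_nonneg_nonneg) auto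
  show ?thesis
  proof (rule that[of "R + 1" "2 * c"])
    fix U assume U: "reproduces K p U" and real: "\<And>x. U x \<in> \<real>"
    have U_meas [measurable]: "U \<in> borel_measurable borel" using reproducesD(1)[OF U] .
    obtain m where m [measurable]: "m \<in> borel_measurable borel" and m0: "\<And>x. 0 \<le> m x"
      and lip: "\<And>x a b. norm a \<le> R + 1 \<Longrightarrow> norm b \<le> R + 1 \<Longrightarrow> norm (U (x + a) - U (x + b)) \<le> norm (a - b) * m x"
      and mB: "(\<integral>\<^sup>+x. ennreal (m x powr p) \<partial>lborel) \<le> ennreal B * Lpow p U"
      using B(2)[OF U] by blast
    define G where "G x k = ennreal ((norm (U (x + k)) powr (p/2) - norm (U x) powr (p/2))\<^sup>2)" for x k
    define D where "D x = (\<integral>\<^sup>+k. indicator (cball 0 (R + 1)) k * G x k \<partial>lborel)" for x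
    define E where "E x = ennreal (2 / vol) * D x + ennreal (2 * r powr p * m x powr p)" for x
    define N where "N = Lpow p U"
    define DD where "DD = (\<integral>\<^sup>+x. D x \<partial>lborel)"
    have [measurable]: "cball (0::'a) s \<in> sets borel" for s by simp
    have Gx_meas [measurable]: "G x \<in> borel_measurable borel" for x unfolding G_def by measurable
    have D_meas [measurable]: "D \<in> borel_measurable borel" unfolding D_def G_def by measurable
    have E_meas [measurable]: "E \<in> borel_measurable borel" unfolding E_def by measurable
    have incr: "ennreal (norm (U (x + h) - U x) powr p) \<le> ennreal (2 * q) * G x h + ennreal (3 * q) * E x"
      if "norm h \<le> R" for x h
      using increment_powr_le[OF U_meas p lip m0 r reproduces_continuous[OF K p1 U] real that, of x]
      unfolding q_def G_def E_def D_def vol_def by blast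
    \<comment> \<open>For norm z \<le> R the increment estimate applies, where a bound of K turns
      the integral against K into one over a ball. For larger z only the triangle inequality is
      used, and the smallness comes from \<open>tail\<close>.\<close>
    have kernel: "ennreal (norm (K z) * norm (U (x - z) - U x) powr p)
        \<le> ennreal (Kb * (2 * q)) * (indicator (cball 0 (R + 1)) (- z) * G x (- z))
          + (ennreal (3 * q) * E x) * ennreal (norm (K z))
          + (ennreal q * (ennreal (tail z) * ennreal (norm (U (x - z)) powr p)) + ennreal q * ennreal (norm (U x) powr p) * ennreal (tail z))" for x z
    proof (cases "norm z \<le> R")
      case True
      have "ennreal (norm (K z) * norm (U (x - z) - U x) powr p) = ennreal (norm (K z)) * ennreal (norm (U (x + - z) - U x) powr p)"
        by (simp add: ennreal_mult)
      also have "\<dots> \<le> ennreal (norm (K z)) * (ennreal (2 * q) * G x (- z) + ennreal (3 * q) * E x)"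
        using True by (intro mult_left_mono incr) auto
      also have "\<dots> = (ennreal (norm (K z)) * ennreal (2 * q)) * G x (- z) + (ennreal (3 * q) * E x) * ennreal (norm (K z))"
        by (simp only: distrib_left mult_ac)
      also have "\<dots> \<le> ennreal (Kb * (2 * q)) * G x (- z) + (ennreal (3 * q) * E x) * ennreal (norm (K z))"
        using Kb q0 by (intro add_mono mult_right_mono order_refl) (auto simp: ennreal_mult'[symmetric] intro!: ennreal_leI mult_right_mono)
      also have "G x (- z) = indicator (cball 0 (R + 1)) (- z) * G x (- z)" using True by simp
      finally show ?thesis by (rule add_increasing2[rotated]) simp
    next
      case False
      then have t: "tail z = norm (K z)" by (simp add: tail_def)
      have "norm (U (x - z) - U x) powr p \<le> (norm (U (x - z)) + norm (U x)) powr p"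
        using p by (intro powr_mono2 norm_triangle_ineq4) auto
      also have "\<dots> \<le> q * (norm (U (x - z)) powr p + norm (U x) powr p)"
        unfolding q_def using p by (intro add_powr_le) auto
      finally have "norm (K z) * norm (U (x - z) - U x) powr p \<le> norm (K z) * (q * (norm (U (x - z)) powr p + norm (U x) powr p))"
        by (rule mult_left_mono) simp
      also have "\<dots> = q * (tail z * norm (U (x - z)) powr p) + q * norm (U x) powr p * tail z"
        by (simp add: t algebra_simps)
      finally have "ennreal (norm (K z) * norm (U (x - z) - U x) powr p)
        \<le> ennreal (q * (tail z * norm (U (x - z)) powr p) + q * norm (U x) powr p * tail z)"
        by (rule ennreal_leI)
      also have "\<dots> = ennreal q * (ennreal (tail z) * ennreal (norm (U (x - z)) powr p)) + ennreal q * ennreal (norm (U x) powr p) * ennreal (tail z)"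
        using q0 tail0[of z] by (subst ennreal_plus) (auto simp: ennreal_mult' mult_nonneg_nonneg)
      finally show ?thesis by (rule add_increasing[rotated]) simp
    qed
    have pointwise: "ennreal (norm (U x) powr p) \<le> ennreal a * (ennreal (Kb * (2 * q)) * D x + (ennreal (3 * q) * E x) * ennreal A
        + (ennreal q * (\<integral>\<^sup>+z. ennreal (tail z) * ennreal (norm (U (x - z)) powr p) \<partial>lborel) + ennreal q * ennreal (norm (U x) powr p) * ennreal \<kappa>))" for x
    proof -
      have i2: "integrable lborel (\<lambda>z. K z * U x)" using Ki by simp
      have i: "integrable lborel (\<lambda>z. K z * (U (x - z) - U x))"
        using reproduces_integrable(2)[OF K U p1, of x] i2 by (simp add: right_diff_distrib)
      have "(LINT z|lborel. K z * (U (x - z) - U x)) = (LINT z|lborel. K z * U (x - z)) - (LINT z|lborel. K z * U x)"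
        using reproduces_integrable(2)[OF K U p1, of x] i2 by (simp add: right_diff_distrib)
      also have "\<dots> = U x" using reproducesD(3)[OF U, of x] K0 by simp
      finally have "norm (U x) \<le> (LINT z|lborel. norm (K z) * norm (U (x - z) - U x))"
        using integral_norm_bound[of lborel "\<lambda>z. K z * (U (x - z) - U x)"] by (simp add: norm_mult)
      then have "ennreal (norm (U x) powr p) \<le> ennreal ((LINT z|lborel. norm (K z) * norm (U (x - z) - U x)) powr p)"
        using p by (intro ennreal_leI powr_mono2) auto
      also have "\<dots> \<le> ennreal a * (\<integral>\<^sup>+z. ennreal (norm (K z) * norm (U (x - z) - U x) powr p) \<partial>lborel)"
        unfolding a_def A_def
        by (rule integral_powr_le) (use Ki integrable_norm[OF i] p in \<open>auto simp: norm_mult\<close>)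
      also have "(\<integral>\<^sup>+z. ennreal (norm (K z) * norm (U (x - z) - U x) powr p) \<partial>lborel)
        \<le> (\<integral>\<^sup>+z. ennreal (Kb * (2 * q)) * (indicator (cball 0 (R + 1)) (- z) * G x (- z))
          + (ennreal (3 * q) * E x) * ennreal (norm (K z))
          + (ennreal q * (ennreal (tail z) * ennreal (norm (U (x - z)) powr p)) + ennreal q * ennreal (norm (U x) powr p) * ennreal (tail z)) \<partial>lborel)"
        by (intro nn_integral_mono kernel)
      also have "\<dots> = ennreal (Kb * (2 * q)) * (\<integral>\<^sup>+z. indicator (cball 0 (R + 1)) (- z) * G x (- z) \<partial>lborel)
          + (ennreal (3 * q) * E x) * (\<integral>\<^sup>+z. ennreal (norm (K z)) \<partial>lborel)
          + (ennreal q * (\<integral>\<^sup>+z. ennreal (tail z) * ennreal (norm (U (x - z)) powr p) \<partial>lborel) + ennreal q * ennreal (norm (U x) powr p) * (\<integral>\<^sup>+z. ennreal (tail z) \<partial>lborel))"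
        by (simp add: nn_integral_add nn_integral_cmult)
      also have "(\<integral>\<^sup>+z. indicator (cball 0 (R + 1)) (- z) * G x (- z) \<partial>lborel) = D x"
        unfolding D_def using nn_integral_lborel_reflect[of "\<lambda>z. indicator (cball 0 (R + 1)) z * G x z" 0] by simp
      finally show ?thesis unfolding Ann tail_nn by (simp add: mult_left_mono)
    qed
    have tailN: "(\<integral>\<^sup>+x. (\<integral>\<^sup>+z. ennreal (tail z) * ennreal (norm (U (x - z)) powr p) \<partial>lborel) \<partial>lborel) = ennreal \<kappa> * N"
    proof -
      have "(\<integral>\<^sup>+x. (\<integral>\<^sup>+z. ennreal (tail z) * ennreal (norm (U (x - z)) powr p) \<partial>lborel) \<partial>lborel)
        = (\<integral>\<^sup>+z. (\<integral>\<^sup>+x. ennreal (tail z) * ennreal (norm (U (x - z)) powr p) \<partial>lborel) \<partial>lborel)"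
        by (rule lborel_pair.Fubini') measurable
      also have "\<dots> = (\<integral>\<^sup>+z. ennreal (tail z) * N \<partial>lborel)"
      proof (rule nn_integral_cong)
        fix z
        have "(\<integral>\<^sup>+x. ennreal (norm (U (x + - z)) powr p) \<partial>lborel) = N"
          unfolding N_def Lpow_def by (rule nn_integral_lborel_translate) measurable
        then show "(\<integral>\<^sup>+x. ennreal (tail z) * ennreal (norm (U (x - z)) powr p) \<partial>lborel) = ennreal (tail z) * N"
          by (simp add: nn_integral_cmult)
      qed
      also have "\<dots> = ennreal \<kappa> * N" by (simp add: nn_integral_multc tail_nn)
      finally show ?thesis .
    qed
    have EN: "(\<integral>\<^sup>+x. E x \<partial>lborel) \<le> ennreal (2 / vol) * DD + ennreal (2 * r powr p * B) * N"
    proof -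
      have "(\<integral>\<^sup>+x. E x \<partial>lborel) = ennreal (2 / vol) * DD + ennreal (2 * r powr p) * (\<integral>\<^sup>+x. ennreal (m x powr p) \<partial>lborel)"
        unfolding E_def DD_def by (simp add: nn_integral_add nn_integral_cmult ennreal_mult')
      also have "\<dots> \<le> ennreal (2 / vol) * DD + ennreal (2 * r powr p) * (ennreal B * N)"
        unfolding N_def by (intro add_left_mono mult_left_mono mB) auto
      also have "ennreal (2 * r powr p) * (ennreal B * N) = ennreal (2 * r powr p * B) * N"
        using B(1) by (subst ennreal_mult'[of "2 * r powr p"]) (auto simp: mult.assoc)
      finally show ?thesis .
    qed
    have "N \<le> (\<integral>\<^sup>+x. ennreal a * (ennreal (Kb * (2 * q)) * D x + (ennreal (3 * q) * E x) * ennreal A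
        + (ennreal q * (\<integral>\<^sup>+z. ennreal (tail z) * ennreal (norm (U (x - z)) powr p) \<partial>lborel) + ennreal q * ennreal (norm (U x) powr p) * ennreal \<kappa>)) \<partial>lborel)"
      unfolding N_def Lpow_def by (intro nn_integral_mono pointwise)
    also have "\<dots> = ennreal a * (ennreal (Kb * (2 * q)) * DD + (ennreal (3 * q) * (\<integral>\<^sup>+x. E x \<partial>lborel)) * ennreal A
        + (ennreal q * (ennreal \<kappa> * N) + ennreal q * N * ennreal \<kappa>))"
      unfolding DD_def N_def Lpow_def
      by (simp add: nn_integral_add nn_integral_cmult nn_integral_multc tailN[unfolded N_def Lpow_def])
    also have "\<dots> \<le> ennreal a * (ennreal (Kb * (2 * q)) * DD + (ennreal (3 * q) * (ennreal (2 / vol) * DD + ennreal (2 * r powr p * B) * N)) * ennreal A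
        + (ennreal q * (ennreal \<kappa> * N) + ennreal q * N * ennreal \<kappa>))"
      by (intro mult_left_mono mult_right_mono add_mono EN order_refl) auto
    also have "\<dots> = (ennreal a * ennreal (Kb * (2 * q)) + ennreal a * (ennreal (3 * q) * ennreal A) * ennreal (2 / vol)) * DD
        + (ennreal a * (ennreal (3 * q) * ennreal A) * ennreal (2 * r powr p * B) + ennreal a * (2 * ennreal q) * ennreal \<kappa>) * N"
      by (rule absorb_rearrange)
    also have "ennreal a * ennreal (Kb * (2 * q)) + ennreal a * (ennreal (3 * q) * ennreal A) * ennreal (2 / vol) = ennreal c"
    proof -
      have "ennreal a * ennreal (Kb * (2 * q)) = ennreal (a * (Kb * (2 * q)))"
        using a0 by (rule ennreal_mult'[symmetric])
      moreover have "ennreal a * (ennreal (3 * q) * ennreal A) * ennreal (2 / vol) = ennreal (a * (3 * q * A) * (2 / vol))"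
        using a0 A0 q0 by (simp only: ennreal_mult' mult_nonneg_nonneg zero_le_numeral less_imp_le)
      moreover have "ennreal (a * (Kb * (2 * q)) + a * (3 * q * A) * (2 / vol)) = ennreal (a * (Kb * (2 * q))) + ennreal (a * (3 * q * A) * (2 / vol))"
        using a0 A0 q0 Kb(1) vol by (intro ennreal_plus mult_nonneg_nonneg) auto
      ultimately show ?thesis by (simp only: c_def)
    qed
    also have "ennreal a * (ennreal (3 * q) * ennreal A) * ennreal (2 * r powr p * B) + ennreal a * (2 * ennreal q) * ennreal \<kappa>
      = ennreal (a * (3 * q * A) * (2 * r powr p * B) + a * (2 * q) * \<kappa>)"
    proof -
      have "2 * ennreal q = ennreal (2 * q)" by (simp add: ennreal_mult')
      then have "ennreal a * (2 * ennreal q) * ennreal \<kappa> = ennreal (a * (2 * q) * \<kappa>)"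
        using a0 q0 by (simp only: ennreal_mult' mult_nonneg_nonneg zero_le_numeral less_imp_le)
      moreover have "ennreal a * (ennreal (3 * q) * ennreal A) * ennreal (2 * r powr p * B) = ennreal (a * (3 * q * A) * (2 * r powr p * B))"
        using a0 A0 q0 by (simp only: ennreal_mult' mult_nonneg_nonneg zero_le_numeral less_imp_le)
      moreover have "ennreal (a * (3 * q * A) * (2 * r powr p * B) + a * (2 * q) * \<kappa>) = ennreal (a * (3 * q * A) * (2 * r powr p * B)) + ennreal (a * (2 * q) * \<kappa>)"
        using a0 A0 q0 \<kappa>0 B(1) by (intro ennreal_plus mult_nonneg_nonneg) auto
      ultimately show ?thesis by (simp only:)
    qed
    finally have "N \<le> 2 * ennreal c * DD"
    proof (rule ennreal_absorb)
      show "ennreal (a * (3 * q * A) * (2 * r powr p * B) + a * (2 * q) * \<kappa>) \<le> ennreal (1/2)"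
        using rB \<kappa>le by (intro ennreal_leI) linarith
      show "N < \<infinity>" unfolding N_def by (rule reproducesD(2)[OF U])
    qed
    then show "Lpow p U \<le> ennreal (2 * c) * (\<integral>\<^sup>+x. (\<integral>\<^sup>+k. indicator (cball 0 (R + 1)) k *
          ennreal ((norm (U (x + k)) powr (p/2) - norm (U x) powr (p/2))\<^sup>2) \<partial>lborel) \<partial>lborel)"
      using c0 by (simp add: N_def DD_def D_def G_def ennreal_mult)
  qed (use R0 c0 in auto)
qed

section \<open>Convolution of tempered and Schwartz functions\<close>

lemma iter_deriv_translate: "iter_deriv bs (\<lambda>x. f (x - y)) = (\<lambda>x. iter_deriv bs f (x - y))"
proof (induction bs)
  case (Cons b bs)
  have "dir_deriv b (\<lambda>x. g (x - y)) x = dir_deriv b g (x - y)" for g x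
    by (simp add: dir_deriv_def algebra_simps)
  then show ?case using Cons by auto
qed simp

lemma iter_deriv_add:
  assumes "f \<in> schwartz" "g \<in> schwartz" "set bs \<subseteq> Basis"
  shows "iter_deriv bs (\<lambda>x. f x + g x) = (\<lambda>x. iter_deriv bs f x + iter_deriv bs g x)"
  using assms(3)
proof (induction bs)
  case (Cons b bs)
  show ?case
  proof
    fix x
    obtain f' where f': "(iter_deriv bs f has_derivative f') (at x)"
      using schwartz_differentiable[OF schwartz_iter_deriv[OF assms(1)], of bs x] Cons(2)
      unfolding differentiable_def by auto
    obtain g' where g': "(iter_deriv bs g has_derivative g') (at x)"
      using schwartz_differentiable[OF schwartz_iter_deriv[OF assms(2)], of bs x] Cons(2)
      unfolding differentiable_def by auto
    have IH: "iter_deriv bs (\<lambda>x. f x + g x) = (\<lambda>x. iter_deriv bs f x + iter_deriv bs g x)"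
      using Cons by simp
    show "iter_deriv (b # bs) (\<lambda>x. f x + g x) x = iter_deriv (b # bs) f x + iter_deriv (b # bs) g x"
      unfolding iter_deriv_Cons IH dir_deriv_eq[OF f'] dir_deriv_eq[OF g']
      by (rule dir_deriv_eq[OF has_derivative_add[OF f' g']])
  qed
qed simp

lemma iter_deriv_cmult:
  assumes "f \<in> schwartz" "set bs \<subseteq> Basis"
  shows "iter_deriv bs (\<lambda>x. c * f x) = (\<lambda>x. c * iter_deriv bs f x)"
  using assms(2)
proof (induction bs)
  case (Cons b bs)
  show ?case
  proof
    fix x
    obtain f' where f': "(iter_deriv bs f has_derivative f') (at x)"
      using schwartz_differentiable[OF schwartz_iter_deriv[OF assms(1)], of bs x] Cons(2)
      unfolding differentiable_def by auto
    have IH: "iter_deriv bs (\<lambda>x. c * f x) = (\<lambda>x. c * iter_deriv bs f x)"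
      using Cons by simp
    show "iter_deriv (b # bs) (\<lambda>x. c * f x) x = c * iter_deriv (b # bs) f x"
      unfolding iter_deriv_Cons IH dir_deriv_eq[OF f']
      by (rule dir_deriv_eq[OF has_derivative_mult_right[OF f']])
  qed
qed simp

lemma iter_deriv_diff:
  assumes "f \<in> schwartz" "g \<in> schwartz" "set bs \<subseteq> Basis"
  shows "iter_deriv bs (\<lambda>x. f x - g x) = (\<lambda>x. iter_deriv bs f x - iter_deriv bs g x)"
  using iter_deriv_add[OF assms(1) schwartz_cmult[OF assms(2), of "-1"] assms(3)]
    iter_deriv_cmult[OF assms(2,3), of "-1"] by simp

lemma schwartz_zero: "(\<lambda>x. 0) \<in> schwartz"
  using schwartz_cmult[OF schwartz_gauss_1, of 0] by simp

lemma
  assumes "finite Q" "\<And>q. q \<in> Q \<Longrightarrow> f q \<in> schwartz"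
  shows schwartz_sum: "(\<lambda>x. \<Sum>q\<in>Q. c q * f q x) \<in> schwartz"
    and iter_deriv_sum: "set bs \<subseteq> Basis \<Longrightarrow>
      iter_deriv bs (\<lambda>x. \<Sum>q\<in>Q. c q * f q x) = (\<lambda>x. \<Sum>q\<in>Q. c q * iter_deriv bs (f q) x)"
proof -
  have "(\<lambda>x. \<Sum>q\<in>Q. c q * f q x) \<in> schwartz \<and> (set bs \<subseteq> Basis \<longrightarrow>
      iter_deriv bs (\<lambda>x. \<Sum>q\<in>Q. c q * f q x) = (\<lambda>x. \<Sum>q\<in>Q. c q * iter_deriv bs (f q) x))"
    using assms
  proof (induction Q rule: finite_induct)
    case empty
    show ?case using iter_deriv_cmult[OF schwartz_zero, of bs 0] schwartz_zero by simp
  next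
    case (insert q Q)
    then have q: "(\<lambda>x. c q * f q x) \<in> schwartz" and Q: "(\<lambda>x. \<Sum>q\<in>Q. c q * f q x) \<in> schwartz"
      by (auto intro: schwartz_cmult)
    show ?case
      using insert schwartz_add[OF q Q] iter_deriv_add[OF q Q, of bs] iter_deriv_cmult[of "f q" bs "c q"] by simp
  qed
  then show "(\<lambda>x. \<Sum>q\<in>Q. c q * f q x) \<in> schwartz"
    "set bs \<subseteq> Basis \<Longrightarrow> iter_deriv bs (\<lambda>x. \<Sum>q\<in>Q. c q * f q x) = (\<lambda>x. \<Sum>q\<in>Q. c q * iter_deriv bs (f q) x)"
    by auto
qed

lemma tempered_distribution_linear:
  assumes "tempered_distribution T" "f \<in> schwartz" "g \<in> schwartz"
  shows "T (\<lambda>x. a * f x + b * g x) = a * T f + b * T g"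
  using assms unfolding tempered_distribution_def by blast

lemma tempered_distribution_zero:
  assumes "tempered_distribution T"
  shows "T (\<lambda>x. 0) = 0"
  using tempered_distribution_linear[OF assms schwartz_zero schwartz_zero, of 0 0] by simp

lemma tempered_distribution_sum:
  assumes T: "tempered_distribution T" and "finite Q" "\<And>q. q \<in> Q \<Longrightarrow> f q \<in> schwartz"
  shows "T (\<lambda>x. \<Sum>q\<in>Q. c q * f q x) = (\<Sum>q\<in>Q. c q * T (f q))"
  using assms(2,3)
proof (induction Q rule: finite_induct)
  case empty
  then show ?case using tempered_distribution_zero[OF T] by simp
next
  case (insert q Q)
  have "T (\<lambda>x. c q * f q x + 1 * (\<Sum>q\<in>Q. c q * f q x)) = c q * T (f q) + 1 * T (\<lambda>x. \<Sum>q\<in>Q. c q * f q x)"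
    by (rule tempered_distribution_linear[OF T]) (use schwartz_sum[of Q f c] insert in auto)
  then show ?case using insert by simp
qed

text \<open>The seminorm is a supremum of reals, so the bound plays two roles: it makes the set
  bounded above, which gives the supremum its meaning, and it majorizes it by a null
  sequence.\<close>

lemma schwartz_tendstoI:
  assumes "\<And>k bs. set bs \<subseteq> Basis \<Longrightarrow> \<exists>c. c \<longlonglongrightarrow> 0 \<and>
      (\<forall>n x. (1 + norm x) ^ k * norm (iter_deriv bs (\<lambda>x. F n x - f x) x) \<le> c n)"
  shows "schwartz_tendsto F f"
  unfolding schwartz_tendsto_def
proof (intro allI impI)
  fix k and bs :: "'a list" assume "set bs \<subseteq> Basis"
  then obtain c where c: "c \<longlonglongrightarrow> 0"
    "\<And>n x. (1 + norm x) ^ k * norm (iter_deriv bs (\<lambda>x. F n x - f x) x) \<le> c n"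
    using assms by blast
  have le: "schwartz_seminorm k bs (\<lambda>x. F n x - f x) \<le> c n" for n
    unfolding schwartz_seminorm_def by (rule cSUP_least) (auto intro: c)
  have ge: "0 \<le> schwartz_seminorm k bs (\<lambda>x. F n x - f x)" for n
    unfolding schwartz_seminorm_def
    by (rule cSUP_upper2[where x=0]) (auto intro!: bdd_aboveI2[where M="c n"] c)
  show "(\<lambda>n. schwartz_seminorm k bs (\<lambda>x. F n x - f x)) \<longlonglongrightarrow> 0"
    by (rule tendsto_sandwich[OF _ _ tendsto_const c(1)]) (simp_all add: le ge)
qed

lemma tempered_distribution_tendsto:
  assumes "tempered_distribution T" "\<And>n. F n \<in> schwartz" "f \<in> schwartz" "schwartz_tendsto F f"
  shows "(\<lambda>n. T (F n)) \<longlonglongrightarrow> T f"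
  using assms unfolding tempered_distribution_def by blast

text \<open>The weight is submultiplicative: 1 + norm x \<le> (1 + norm (x - y)) (1 + norm y). Thus
  seminorms of translates grow only polynomially in the shift, which is what bounds the growth of
  the regularization of a distribution.\<close>

lemma schwartz_translate_bound:
  assumes g: "g \<in> schwartz"
  obtains C where "0 \<le> C" "\<And>x y. (1 + norm x) ^ N * norm (g (x - y)) \<le> C * (1 + norm y) ^ N"
proof -
  obtain C where C: "0 \<le> C" "\<And>x. (1 + norm x) ^ N * norm (g x) \<le> C"
    using rapid_bound[OF schwartz_rapid[OF g], of N] by blast
  have "(1 + norm x) ^ N * norm (g (x - y)) \<le> C * (1 + norm y) ^ N" for x y
  proof -
    have "(1 + norm x) ^ N \<le> ((1 + norm (x - y)) * (1 + norm y)) ^ N"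
      using one_plus_norm_add_le[of "x - y" y] by (intro power_mono) auto
    then have "(1 + norm x) ^ N * norm (g (x - y)) \<le> ((1 + norm (x - y)) * (1 + norm y)) ^ N * norm (g (x - y))"
      by (rule mult_right_mono) simp
    also have "\<dots> = (1 + norm y) ^ N * ((1 + norm (x - y)) ^ N * norm (g (x - y)))"
      by (simp add: power_mult_distrib mult_ac)
    also have "\<dots> \<le> (1 + norm y) ^ N * C" by (intro mult_left_mono C) auto
    finally show ?thesis by (simp add: mult.commute)
  qed
  then show ?thesis using that C(1) by blast
qed

text \<open>The mean value estimate at x - y combined with the submultiplicative weight. The right
  side vanishes as s tends to y, so translation is continuous in the Schwartz space, with explicit
  dependence on the shifts.\<close>

lemma schwartz_translate_diff_bound:
  assumes g: "g \<in> schwartz"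
  obtains C where "0 \<le> C" "\<And>x y s. (1 + norm x) ^ N * norm (g (x - s) - g (x - y))
    \<le> C * ((1 + norm y) ^ N * (norm (y - s) * (1 + norm (y - s)) ^ N))"
proof -
  obtain C where C: "0 \<le> C"
    "\<And>x a. norm (g (x + a) - g x) \<le> C * norm a * (1 + norm a) ^ N * inverse ((1 + norm x) ^ N)"
    using schwartz_mean_value[OF g, of N] by blast
  have "(1 + norm x) ^ N * norm (g (x - s) - g (x - y))
    \<le> C * ((1 + norm y) ^ N * (norm (y - s) * (1 + norm (y - s)) ^ N))" for x y s
  proof -
    have pos: "0 < (1 + norm (x - y)) ^ N" by (intro zero_less_power) (simp add: add_pos_nonneg)
    have "(1 + norm x) ^ N \<le> (1 + norm (x - y)) ^ N * (1 + norm y) ^ N"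
      unfolding power_mult_distrib[symmetric] using one_plus_norm_add_le[of "x - y" y] by (intro power_mono) auto
    moreover have "norm (g (x - s) - g (x - y)) \<le> C * norm (y - s) * (1 + norm (y - s)) ^ N * inverse ((1 + norm (x - y)) ^ N)"
      using C(2)[of "x - y" "y - s"] by simp
    ultimately have "(1 + norm x) ^ N * norm (g (x - s) - g (x - y))
      \<le> ((1 + norm (x - y)) ^ N * (1 + norm y) ^ N) * (C * norm (y - s) * (1 + norm (y - s)) ^ N * inverse ((1 + norm (x - y)) ^ N))"
      by (intro mult_mono) auto
    also have "\<dots> = C * ((1 + norm y) ^ N * (norm (y - s) * (1 + norm (y - s)) ^ N))"
    proof -
      have "(1 + norm (x - y)) ^ N * inverse ((1 + norm (x - y)) ^ N) = 1" by (rule right_inverse[OF less_imp_neq[OF pos, symmetric]])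
      moreover have "P * Y * (c * d * e * i) = c * (Y * (d * e)) * (P * i)" for P Y c d e i :: real
        by (simp only: mult_ac)
      ultimately show ?thesis by (simp only: mult_1_right)
    qed
    finally show ?thesis .
  qed
  then show ?thesis using that C(1) by blast
qed

lemma schwartz_weighted_integrable:
  assumes "\<psi> \<in> schwartz"
  shows "integrable lborel (\<lambda>y. (1 + norm y) ^ N * norm (\<psi> y))"
proof -
  have "rapid (\<lambda>y. of_real ((1 + norm y) ^ N) * \<psi> y)"
    by (intro moderate_mult_rapid schwartz_rapid assms moderateI[of _ 1 N])
       (simp only: norm_of_real, simp add: abs_of_nonneg)
  then have "integrable lborel (\<lambda>y. of_real ((1 + norm y) ^ N) * \<psi> y)"
    using schwartz_measurable[OF assms] by (intro rapid_integrable) auto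
  from integrable_norm[OF this] show ?thesis
    by (simp only: norm_mult norm_of_real) (simp add: abs_of_nonneg)
qed

section \<open>Convolutions of Schwartz functions and regularization of distributions\<close>

lemma convolution_dir_deriv:
  assumes \<psi>: "\<psi> \<in> schwartz" and k: "k \<in> schwartz"
  shows "\<exists>f'. ((\<lambda>x. LINT y|lborel. \<psi> y * k (x - y)) has_derivative f') (at x) \<and>
    (\<forall>b. f' b = (LINT y|lborel. \<psi> y * dir_deriv b k (x - y)))"
proof -
  have "\<exists>k'. (k has_derivative k') (at z)" for z
    using schwartz_differentiable[OF k] differentiable_def by blast
  then obtain k' where k': "\<And>z. (k has_derivative k' z) (at z)" by metis
  obtain C where C: "0 \<le> C" "\<And>x a. norm (k (x + a) - k x) \<le> C * norm a"
    using schwartz_mean_value[OF k, of 0] by auto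
  obtain B where B: "\<And>z. norm (k z) \<le> B" using schwartz_bounded[OF k] by blast
  have [measurable]: "k \<in> borel_measurable borel" "\<psi> \<in> borel_measurable borel"
    using k \<psi> by (auto intro: schwartz_measurable)
  have "((\<lambda>x. LINT y|lborel. \<psi> y * k (x - y)) has_derivative (\<lambda>h. LINT y|lborel. \<psi> y * k' (x - y) h)) (at x)"
  proof (rule has_derivative_integral(1)[where B="\<lambda>y. C * norm (\<psi> y)"])
    fix y
    have "((\<lambda>x. x - y) has_derivative (\<lambda>h. h)) (at x)" by (auto intro!: derivative_eq_intros)
    from has_derivative_compose[OF this k']
    show "((\<lambda>x. \<psi> y * k (x - y)) has_derivative (\<lambda>h. \<psi> y * k' (x - y) h)) (at x)"
      by (rule has_derivative_mult_right)
    fix h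
    have "norm (\<psi> y * k (x + h - y) - \<psi> y * k (x - y)) = norm (\<psi> y) * norm (k ((x - y) + h) - k (x - y))"
    proof -
      have "x + h - y = (x - y) + h" by simp
      then show ?thesis by (simp only: right_diff_distrib[symmetric] norm_mult)
    qed
    also have "\<dots> \<le> norm (\<psi> y) * (C * norm h)" by (intro mult_left_mono C) auto
    finally show "norm (\<psi> y * k (x + h - y) - \<psi> y * k (x - y)) \<le> norm h * (C * norm (\<psi> y))"
      by (simp add: mult_ac)
  next
    show "integrable lborel (\<lambda>y. C * norm (\<psi> y))"
      using schwartz_integrable[OF \<psi>] by simp
    show "integrable lborel (\<lambda>y. \<psi> y * k (x - y))" for x
      by (rule Bochner_Integration.integrable_bound[OF integrable_mult_right[OF schwartz_integrable[OF \<psi>], of "of_real B"]])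
         (use B order_trans[OF norm_ge_zero B] in \<open>auto simp: norm_mult mult.commute[of B] intro!: AE_I2 mult_left_mono\<close>)
  qed
  then show ?thesis by (intro exI conjI) (auto simp: dir_deriv_eq[OF k'])
qed

lemma schwartz_convolution:
  assumes \<psi>: "\<psi> \<in> schwartz" and k: "k \<in> schwartz"
  shows "(\<lambda>x. LINT y|lborel. \<psi> y * k (x - y)) \<in> schwartz"
  unfolding schwartz_eq_smooth_with
proof (rule smooth_with_coinduct[where X="(\<lambda>k x. LINT y|lborel. \<psi> y * k (x - y)) ` schwartz"])
  fix g assume "g \<in> (\<lambda>k x. LINT y|lborel. \<psi> y * k (x - y)) ` schwartz"
  then obtain k where k: "k \<in> schwartz" and g: "g = (\<lambda>x. LINT y|lborel. \<psi> y * k (x - y))" by auto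
  show "g differentiable (at x)" for x
    unfolding g differentiable_def using convolution_dir_deriv[OF \<psi> k, of x] by blast
  show "dir_deriv b g \<in> (\<lambda>k x. LINT y|lborel. \<psi> y * k (x - y)) ` schwartz" if b: "b \<in> Basis" for b
  proof -
    have "dir_deriv b g = (\<lambda>x. LINT y|lborel. \<psi> y * dir_deriv b k (x - y))"
    proof
      fix x
      obtain f' where "(g has_derivative f') (at x)" "\<forall>b. f' b = (LINT y|lborel. \<psi> y * dir_deriv b k (x - y))"
        using convolution_dir_deriv[OF \<psi> k, of x] unfolding g by blast
      then show "dir_deriv b g x = (LINT y|lborel. \<psi> y * dir_deriv b k (x - y))"
        by (simp add: dir_deriv_eq)
    qed
    then show ?thesis using schwartz_dir_deriv[OF k b] by blast
  qed
  show "rapid g" unfolding rapid_iff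
  proof
    fix N
    obtain C where C: "0 \<le> C" "\<And>x y. (1 + norm x) ^ N * norm (k (x - y)) \<le> C * (1 + norm y) ^ N"
      using schwartz_translate_bound[OF k, of N] by blast
    have [measurable]: "k \<in> borel_measurable borel" "\<psi> \<in> borel_measurable borel"
      using k \<psi> by (auto intro: schwartz_measurable)
    have "(1 + norm x) ^ N * norm (g x) \<le> (LINT y|lborel. C * ((1 + norm y) ^ N * norm (\<psi> y)))" for x
    proof -
      have ip: "integrable lborel (\<lambda>y. C * ((1 + norm y) ^ N * norm (\<psi> y)))"
        by (intro integrable_mult_right schwartz_weighted_integrable \<psi>)
      have le: "(1 + norm x) ^ N * norm (\<psi> y * k (x - y)) \<le> C * ((1 + norm y) ^ N * norm (\<psi> y))" for y
        using mult_right_mono[OF C(2)[of x y] norm_ge_zero[of "\<psi> y"]] by (simp add: norm_mult mult_ac)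
      have "norm (g x) \<le> (LINT y|lborel. norm (\<psi> y * k (x - y)))"
        unfolding g by (rule integral_norm_bound)
      then have "(1 + norm x) ^ N * norm (g x) \<le> (1 + norm x) ^ N * (LINT y|lborel. norm (\<psi> y * k (x - y)))"
        by (intro mult_left_mono) auto
      also have "\<dots> = (LINT y|lborel. (1 + norm x) ^ N * norm (\<psi> y * k (x - y)))" by simp
      also have "\<dots> \<le> (LINT y|lborel. C * ((1 + norm y) ^ N * norm (\<psi> y)))"
      proof (rule integral_mono[OF _ ip le])
        show "integrable lborel (\<lambda>y. (1 + norm x) ^ N * norm (\<psi> y * k (x - y)))"
          by (rule Bochner_Integration.integrable_bound[OF ip]) (auto intro!: AE_I2 order_trans[OF le] order_trans[OF _ abs_ge_self])
      qed
      finally show ?thesis .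
    qed
    then show "\<exists>C. \<forall>x. (1 + norm x) ^ N * norm (g x) \<le> C" by blast
  qed
qed (use k in auto)

lemma iter_deriv_convolution:
  assumes \<psi>: "\<psi> \<in> schwartz" and k: "k \<in> schwartz" and bs: "set bs \<subseteq> Basis"
  shows "iter_deriv bs (\<lambda>x. LINT y|lborel. \<psi> y * k (x - y)) = (\<lambda>x. LINT y|lborel. \<psi> y * iter_deriv bs k (x - y))"
  using bs
proof (induction bs)
  case (Cons b bs)
  then have IH: "iter_deriv bs (\<lambda>x. LINT y|lborel. \<psi> y * k (x - y)) = (\<lambda>x. LINT y|lborel. \<psi> y * iter_deriv bs k (x - y))"
    and kb: "iter_deriv bs k \<in> schwartz"
    using schwartz_iter_deriv[OF k] by auto
  show ?case
  proof
    fix x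
    show "iter_deriv (b # bs) (\<lambda>x. LINT y|lborel. \<psi> y * k (x - y)) x = (LINT y|lborel. \<psi> y * iter_deriv (b # bs) k (x - y))"
      using convolution_dir_deriv[OF \<psi> kb, of x] unfolding iter_deriv_Cons IH by (auto simp: dir_deriv_eq)
  qed
qed simp

text \<open>Translates of k depend continuously on the shift in every Schwartz seminorm, and T is
  sequentially continuous.\<close>

lemma regularization_continuous:
  assumes T: "tempered_distribution T" and k: "k \<in> schwartz"
  shows "isCont (\<lambda>y. T (\<lambda>x. k (x - y))) y"
  unfolding continuous_at_sequentially comp_def
proof (intro allI impI)
  fix s assume s: "s \<longlonglongrightarrow> y"
  show "(\<lambda>n. T (\<lambda>x. k (x - s n))) \<longlonglongrightarrow> T (\<lambda>x. k (x - y))"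
  proof (rule tempered_distribution_tendsto[OF T])
    show "schwartz_tendsto (\<lambda>n x. k (x - s n)) (\<lambda>x. k (x - y))"
    proof (rule schwartz_tendstoI)
      fix N and bs :: "'a list" assume bs: "set bs \<subseteq> Basis"
      have D: "iter_deriv bs (\<lambda>x. k (x - s n) - k (x - y)) = (\<lambda>x. iter_deriv bs k (x - s n) - iter_deriv bs k (x - y))" for n
        using iter_deriv_diff[OF schwartz_translate[OF k] schwartz_translate[OF k] bs]
        by (simp add: iter_deriv_translate)
      obtain C where C: "0 \<le> C" "\<And>x y s. (1 + norm x) ^ N * norm (iter_deriv bs k (x - s) - iter_deriv bs k (x - y))
        \<le> C * ((1 + norm y) ^ N * (norm (y - s) * (1 + norm (y - s)) ^ N))"
        using schwartz_translate_diff_bound[OF schwartz_iter_deriv[OF k bs], of N] by blast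
      have "(\<lambda>n. C * ((1 + norm y) ^ N * (norm (y - s n) * (1 + norm (y - s n)) ^ N))) \<longlonglongrightarrow>
          C * ((1 + norm y) ^ N * (norm (y - y) * (1 + norm (y - y)) ^ N))"
        by (intro tendsto_intros s)
      then show "\<exists>c. c \<longlonglongrightarrow> 0 \<and> (\<forall>n x. (1 + norm x) ^ N * norm (iter_deriv bs (\<lambda>x. k (x - s n) - k (x - y)) x) \<le> c n)"
        unfolding D using C(2) by (intro exI[of _ "\<lambda>n. C * ((1 + norm y) ^ N * (norm (y - s n) * (1 + norm (y - s n)) ^ N))"]) auto
    qed
  qed (intro schwartz_translate k)+
qed

text \<open>A tempered distribution has finite order: otherwise normalized translates of \<open>k\<close> would tend
  to zero in the Schwartz space while the distribution takes the value one on them.\<close>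

lemma regularization_moderate:
  assumes T: "tempered_distribution T" and k: "k \<in> schwartz"
  shows "moderate (\<lambda>y. T (\<lambda>x. k (x - y)))"
proof (rule ccontr)
  assume "\<not> moderate (\<lambda>y. T (\<lambda>x. k (x - y)))"
  then have "\<exists>y. real (Suc n) * (1 + norm y) ^ n < norm (T (\<lambda>x. k (x - y)))" for n
    unfolding moderate_def by (auto simp: not_le)
  then obtain y where y: "\<And>n. real (Suc n) * (1 + norm (y n)) ^ n < norm (T (\<lambda>x. k (x - y n)))" by metis
  define t where "t n = T (\<lambda>x. k (x - y n))" for n
  have tn: "real (Suc n) * (1 + norm (y n)) ^ n < norm (t n)" for n using y by (simp add: t_def)
  have tpos: "0 < norm (t n)" for n
    by (rule order_le_less_trans[OF _ tn]) (auto intro!: mult_nonneg_nonneg)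
  let ?F = "\<lambda>n x. inverse (t n) * k (x - y n)"
  have F: "?F n \<in> schwartz" for n by (intro schwartz_cmult schwartz_translate k)
  have "schwartz_tendsto ?F (\<lambda>x. 0)"
  proof (rule schwartz_tendstoI)
    fix N and bs :: "'a list" assume bs: "set bs \<subseteq> Basis"
    have D: "iter_deriv bs (\<lambda>x. ?F n x - 0) = (\<lambda>x. inverse (t n) * iter_deriv bs k (x - y n))" for n
      using iter_deriv_cmult[OF schwartz_translate[OF k] bs, of "inverse (t n)"] by (simp add: iter_deriv_translate)
    obtain C where C: "0 \<le> C" "\<And>x y. (1 + norm x) ^ N * norm (iter_deriv bs k (x - y)) \<le> C * (1 + norm y) ^ N"
      using schwartz_translate_bound[OF schwartz_iter_deriv[OF k bs], of N] by blast
    define c where "c n = inverse (norm (t n)) * (C * (1 + norm (y n)) ^ N)" for n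
    have "(1 + norm x) ^ N * norm (iter_deriv bs (\<lambda>x. ?F n x - 0) x) \<le> c n" for n x
      using mult_left_mono[OF C(2)[of x "y n"], of "inverse (norm (t n))"]
      unfolding D c_def by (simp add: norm_mult norm_inverse mult_ac)
    moreover have "c \<longlonglongrightarrow> 0"
    proof (rule tendsto_sandwich[OF _ _ tendsto_const])
      show "\<forall>\<^sub>F n in sequentially. 0 \<le> c n" using C(1) by (auto simp: c_def intro!: always_eventually)
      show "\<forall>\<^sub>F n in sequentially. c n \<le> C * inverse (real (Suc n))"
        using eventually_ge_at_top[of N]
      proof eventually_elim
        case (elim n)
        \<comment> \<open>Here the failure of moderate growth is exploited with n as exponent and n
          + 1 as constant: once n \<ge> N the polynomial growth of the seminorm is absorbed, and a
          factor 1/(n + 1) is left over.\<close>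
        have "real (Suc n) * (1 + norm (y n)) ^ N \<le> real (Suc n) * (1 + norm (y n)) ^ n"
          using elim by (intro mult_left_mono power_increasing) auto
        also have "\<dots> \<le> norm (t n)" using tn[of n] by simp
        finally have "inverse (norm (t n)) * (1 + norm (y n)) ^ N \<le> inverse (real (Suc n))"
          using tpos[of n] by (simp add: field_simps del: of_nat_Suc)
        from mult_left_mono[OF this C(1)] show ?case by (simp add: c_def mult_ac del: of_nat_Suc)
      qed
      show "(\<lambda>n. C * inverse (real (Suc n))) \<longlonglongrightarrow> 0"
        using tendsto_mult_left[OF LIMSEQ_inverse_real_of_nat, of C] by simp
    qed
    ultimately show "\<exists>c. c \<longlonglongrightarrow> 0 \<and> (\<forall>n x. (1 + norm x) ^ N * norm (iter_deriv bs (\<lambda>x. ?F n x - 0) x) \<le> c n)"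
      by blast
  qed
  from tempered_distribution_tendsto[OF T F schwartz_zero this]
  have "(\<lambda>n. T (?F n)) \<longlonglongrightarrow> 0" by (simp add: tempered_distribution_zero[OF T])
  moreover have "T (?F n) = 1" for n
    using tempered_distribution_sum[OF T, of "{n}" "\<lambda>n x. k (x - y n)" "\<lambda>n. inverse (t n)"] tpos[of n] schwartz_translate[OF k]
    by (simp add: t_def)
  ultimately show False by (simp add: LIMSEQ_const_iff)
qed

lemma integral_simple_comp:
  fixes s :: "'a::euclidean_space \<Rightarrow> 'a" and \<psi> g :: "'a \<Rightarrow> complex"
  assumes s: "simple_function borel s" and \<psi>: "integrable lborel \<psi>"
  shows "(LINT y|lborel. \<psi> y * g (s y)) = (\<Sum>q\<in>range s. (LINT y|lborel. \<psi> y * indicator {y. s y = q} y) * g q)"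
proof -
  have fin: "finite (range s)" using simple_functionD(1)[OF s] by simp
  have meas [measurable]: "{y. s y = q} \<in> sets borel" for q
    using simple_functionD(2)[OF s, of "{q}"] by (simp add: vimage_def)
  have [measurable]: "\<psi> \<in> borel_measurable borel" using \<psi> by auto
  have i: "integrable lborel (\<lambda>y. \<psi> y * indicator {y. s y = q} y)" for q
  proof (rule Bochner_Integration.integrable_bound[OF \<psi>])
    show "(\<lambda>y. \<psi> y * indicator {y. s y = q} y) \<in> borel_measurable lborel" by measurable
  qed (auto simp: indicator_def)
  have "\<psi> y * g (s y) = (\<Sum>q\<in>range s. (\<psi> y * indicator {y. s y = q} y) * g q)" for y
    using fin by (subst sum.remove[of _ "s y"]) (auto simp: indicator_def intro!: sum.neutral)
  then have "(LINT y|lborel. \<psi> y * g (s y)) = (LINT y|lborel. (\<Sum>q\<in>range s. (\<psi> y * indicator {y. s y = q} y) * g q))"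
    by simp
  also have "\<dots> = (\<Sum>q\<in>range s. (LINT y|lborel. \<psi> y * indicator {y. s y = q} y) * g q)"
    using i by (subst Bochner_Integration.integral_sum) auto
  finally show ?thesis .
qed

text \<open>Approximating the integration variable by simple functions turns the convolution into finite
  sums of translates that converge in the Schwartz space.\<close>

lemma tempered_distribution_convolution:
  assumes T: "tempered_distribution T" and k: "k \<in> schwartz" and \<psi>: "\<psi> \<in> schwartz"
  defines "u \<equiv> \<lambda>y. T (\<lambda>x. k (x - y))"
  shows "integrable lborel (\<lambda>y. u y * \<psi> y)"
    and "T (\<lambda>x. LINT y|lborel. \<psi> y * k (x - y)) = (LINT y|lborel. u y * \<psi> y)"
proof -
  have u_cont: "isCont u y" for y unfolding u_def by (rule regularization_continuous[OF T k])
  have u_meas [measurable]: "u \<in> borel_measurable borel"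
    by (intro borel_measurable_continuous_onI continuous_at_imp_continuous_on ballI u_cont)
  have \<psi>_meas [measurable]: "\<psi> \<in> borel_measurable borel" using \<psi> by (rule schwartz_measurable)
  have \<psi>i: "integrable lborel \<psi>" using \<psi> by (rule schwartz_integrable)
  have "moderate u" unfolding u_def by (rule regularization_moderate[OF T k])
  then obtain N0 C0 where u_le: "\<And>y. norm (u y) \<le> C0 * (1 + norm y) ^ N0" unfolding moderate_def by blast
  have C0: "0 \<le> C0" using order_trans[OF norm_ge_zero u_le[of 0]] by simp
  have w0: "integrable lborel (\<lambda>y. C0 * 2 ^ N0 * ((1 + norm y) ^ N0 * norm (\<psi> y)))"
    by (intro integrable_mult_right schwartz_weighted_integrable \<psi>)
  \<comment> \<open>The simple functions approximating the identity satisfy norm (s n y) \<le> 2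
    norm y. This bound therefore dominates the integrands for all n as well as the limit.\<close>
  have u2: "norm (u z * \<psi> y) \<le> C0 * 2 ^ N0 * ((1 + norm y) ^ N0 * norm (\<psi> y))" if "norm z \<le> 2 * norm y" for z y
  proof -
    have "(1 + norm z) ^ N0 \<le> (2 * (1 + norm y)) ^ N0" using that by (intro power_mono) auto
    then have "C0 * (1 + norm z) ^ N0 \<le> C0 * (2 * (1 + norm y)) ^ N0" using C0 by (rule mult_left_mono)
    with u_le[of z] have "norm (u z) \<le> C0 * (2 * (1 + norm y)) ^ N0" by linarith
    from mult_right_mono[OF this norm_ge_zero[of "\<psi> y"]] show ?thesis
      by (simp only: norm_mult power_mult_distrib mult_ac)
  qed
  show ui: "integrable lborel (\<lambda>y. u y * \<psi> y)"
    by (rule Bochner_Integration.integrable_bound[OF w0])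
       (use u2 in \<open>auto intro!: AE_I2 order_trans[OF u2] order_trans[OF _ abs_ge_self]\<close>)
  obtain s :: "nat \<Rightarrow> 'a \<Rightarrow> 'a" where s: "\<And>n. simple_function borel (s n)"
    "\<And>y. (\<lambda>n. s n y) \<longlonglongrightarrow> y" "\<And>n y. norm (s n y) \<le> 2 * norm y"
    using borel_measurable_implies_sequence_metric[of "\<lambda>x::'a. x" borel 0] by auto
  have s_meas [measurable]: "s n \<in> borel_measurable borel" for n
    using s(1) by (rule borel_measurable_simple_function)
  define c where "c n q = (LINT y|lborel. \<psi> y * indicator {y. s n y = q} y)" for n q
  have fin: "finite (range (s n))" for n using simple_functionD(1)[OF s(1)] by simp
  have comp: "(LINT y|lborel. \<psi> y * g (s n y)) = (\<Sum>q\<in>range (s n). c n q * g q)" for g :: "'a \<Rightarrow> complex" and n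
    unfolding c_def by (rule integral_simple_comp[OF s(1) \<psi>i])
  let ?F = "\<lambda>n x. \<Sum>q\<in>range (s n). c n q * k (x - q)"
  let ?f = "\<lambda>x. LINT y|lborel. \<psi> y * k (x - y)"
  have F: "?F n \<in> schwartz" for n
    using schwartz_sum[of "range (s n)" "\<lambda>q x. k (x - q)" "c n"] fin schwartz_translate[OF k] by auto
  have f: "?f \<in> schwartz" by (rule schwartz_convolution[OF \<psi> k])
  have "schwartz_tendsto ?F ?f"
  proof (rule schwartz_tendstoI)
    fix N and bs :: "'a list" assume bs: "set bs \<subseteq> Basis"
    define g where "g = iter_deriv bs k"
    have g: "g \<in> schwartz" unfolding g_def by (rule schwartz_iter_deriv[OF k bs])
    have [measurable]: "g \<in> borel_measurable borel" using g by (rule schwartz_measurable)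
    obtain Bg where Bg: "\<And>z. norm (g z) \<le> Bg" using schwartz_bounded[OF g] by blast
    have gi: "integrable lborel (\<lambda>y. \<psi> y * g (z y))" if [measurable]: "z \<in> borel_measurable borel" for z :: "'a \<Rightarrow> 'a"
      by (rule Bochner_Integration.integrable_bound[OF integrable_mult_right[OF \<psi>i, of "of_real Bg"]])
         (use Bg order_trans[OF norm_ge_zero Bg] in \<open>auto simp: norm_mult mult.commute[of Bg] intro!: AE_I2 mult_left_mono\<close>)
    obtain C where C: "0 \<le> C" "\<And>x y s. (1 + norm x) ^ N * norm (g (x - s) - g (x - y))
      \<le> C * ((1 + norm y) ^ N * (norm (y - s) * (1 + norm (y - s)) ^ N))"
      using schwartz_translate_diff_bound[OF g, of N] by blast
    have D: "iter_deriv bs (\<lambda>x. ?F n x - ?f x) x = (LINT y|lborel. \<psi> y * (g (x - s n y) - g (x - y)))" for n x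
    proof -
      have "iter_deriv bs (\<lambda>x. ?F n x - ?f x) = (\<lambda>x. iter_deriv bs (?F n) x - iter_deriv bs ?f x)"
        by (rule iter_deriv_diff[OF F f bs])
      moreover have "iter_deriv bs (?F n) = (\<lambda>x. \<Sum>q\<in>range (s n). c n q * g (x - q))"
        using iter_deriv_sum[of "range (s n)" "\<lambda>q x. k (x - q)" bs "c n"] fin schwartz_translate[OF k] bs
        by (simp add: iter_deriv_translate g_def)
      moreover have "iter_deriv bs ?f = (\<lambda>x. LINT y|lborel. \<psi> y * g (x - y))"
        unfolding g_def by (rule iter_deriv_convolution[OF \<psi> k bs])
      ultimately have "iter_deriv bs (\<lambda>x. ?F n x - ?f x) x = (LINT y|lborel. \<psi> y * g (x - s n y)) - (LINT y|lborel. \<psi> y * g (x - y))"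
        by (simp add: comp[of "\<lambda>q. g (x - q)"])
      then show ?thesis using gi[of "\<lambda>y. x - s n y"] gi[of "\<lambda>y. x - y"] by (simp add: right_diff_distrib)
    qed
    define w where "w n y = norm (\<psi> y) * (C * ((1 + norm y) ^ N * (norm (y - s n y) * (1 + norm (y - s n y)) ^ N)))" for n y
    \<comment> \<open>A majorant independent of n; the powers of 3 come from norm (y - s n y) \<le>
      3 norm y.\<close>
    define W where "W y = C * 3 ^ Suc N * ((1 + norm y) ^ (N + Suc N) * norm (\<psi> y))" for y
    have W: "integrable lborel W" unfolding W_def by (intro integrable_mult_right schwartz_weighted_integrable \<psi>)
    have w_meas [measurable]: "w n \<in> borel_measurable borel" for n unfolding w_def by measurable
    have w0: "0 \<le> w n y" for n y using C(1) by (auto simp: w_def)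
    have wW: "w n y \<le> W y" for n y
    proof -
      let ?d = "norm (y - s n y)"
      have d3: "?d \<le> 3 * norm y"
        using norm_triangle_ineq4[of y "s n y"] s(3)[of n y] by linarith
      then have d: "?d \<le> 3 * (1 + norm y)" "1 + ?d \<le> 3 * (1 + norm y)" by simp_all
      have "?d * (1 + ?d) ^ N \<le> (3 * (1 + norm y)) * (3 * (1 + norm y)) ^ N"
        using d by (intro mult_mono power_mono) auto
      also have "\<dots> = 3 ^ Suc N * (1 + norm y) ^ Suc N" by (simp only: power_mult_distrib power_Suc mult_ac)
      finally have "w n y \<le> norm (\<psi> y) * (C * ((1 + norm y) ^ N * (3 ^ Suc N * (1 + norm y) ^ Suc N)))"
        unfolding w_def using C(1) by (intro mult_left_mono) auto
      also have "\<dots> = W y" by (simp only: W_def power_add mult_ac)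
      finally show ?thesis .
    qed
    have wi: "integrable lborel (w n)" for n
      by (rule Bochner_Integration.integrable_bound[OF W]) (use w0 wW in \<open>auto intro!: AE_I2 simp: order_trans[OF wW abs_ge_self]\<close>)
    have "(1 + norm x) ^ N * norm (iter_deriv bs (\<lambda>x. ?F n x - ?f x) x) \<le> (LINT y|lborel. w n y)" for n x
    proof -
      have "norm (LINT y|lborel. \<psi> y * (g (x - s n y) - g (x - y))) \<le> (LINT y|lborel. norm (\<psi> y * (g (x - s n y) - g (x - y))))"
        by (rule integral_norm_bound)
      then have "(1 + norm x) ^ N * norm (iter_deriv bs (\<lambda>x. ?F n x - ?f x) x)
        \<le> (1 + norm x) ^ N * (LINT y|lborel. norm (\<psi> y * (g (x - s n y) - g (x - y))))"
        unfolding D by (intro mult_left_mono) auto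
      also have "\<dots> = (LINT y|lborel. (1 + norm x) ^ N * norm (\<psi> y * (g (x - s n y) - g (x - y))))" by simp
      also have "\<dots> \<le> (LINT y|lborel. w n y)"
      proof (rule integral_mono)
        show "integrable lborel (\<lambda>y. (1 + norm x) ^ N * norm (\<psi> y * (g (x - s n y) - g (x - y))))"
          using gi[of "\<lambda>y. x - s n y"] gi[of "\<lambda>y. x - y"]
          by (intro integrable_mult_right integrable_norm) (simp add: right_diff_distrib)
        show "(1 + norm x) ^ N * norm (\<psi> y * (g (x - s n y) - g (x - y))) \<le> w n y" for y
          using mult_left_mono[OF C(2)[of x "s n y" y] norm_ge_zero[of "\<psi> y"]]
          by (simp add: w_def norm_mult mult_ac)
      qed (rule wi)
      finally show ?thesis .
    qed
    moreover have "(\<lambda>n. LINT y|lborel. w n y) \<longlonglongrightarrow> (LINT y|(lborel :: 'a measure). 0)"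
    proof (rule integral_dominated_convergence[where w=W])
      show "AE y in lborel. (\<lambda>n. w n y) \<longlonglongrightarrow> 0"
      proof (rule AE_I2)
        fix y
        have "(\<lambda>n. w n y) \<longlonglongrightarrow> norm (\<psi> y) * (C * ((1 + norm y) ^ N * (norm (y - y) * (1 + norm (y - y)) ^ N)))"
          unfolding w_def by (intro tendsto_intros s)
        then show "(\<lambda>n. w n y) \<longlonglongrightarrow> 0" by simp
      qed
      show "AE y in lborel. norm (w n y) \<le> W y" for n using w0 wW by auto
    qed (use W in auto)
    ultimately show "\<exists>c. c \<longlonglongrightarrow> 0 \<and> (\<forall>n x. (1 + norm x) ^ N * norm (iter_deriv bs (\<lambda>x. ?F n x - ?f x) x) \<le> c n)"
      by (intro exI[of _ "\<lambda>n. LINT y|lborel. w n y"]) auto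
  qed
  from tempered_distribution_tendsto[OF T F f this]
  have lim1: "(\<lambda>n. T (?F n)) \<longlonglongrightarrow> T ?f" .
  have TF: "T (?F n) = (LINT y|lborel. u (s n y) * \<psi> y)" for n
    using tempered_distribution_sum[OF T fin[of n], of "\<lambda>q x. k (x - q)" "c n"] schwartz_translate[OF k] comp[of u n]
    by (simp add: u_def mult.commute)
  have "(\<lambda>n. LINT y|lborel. u (s n y) * \<psi> y) \<longlonglongrightarrow> (LINT y|lborel. u y * \<psi> y)"
  proof (rule integral_dominated_convergence[where w="\<lambda>y. C0 * 2 ^ N0 * ((1 + norm y) ^ N0 * norm (\<psi> y))"])
    show "AE y in lborel. (\<lambda>n. u (s n y) * \<psi> y) \<longlonglongrightarrow> u y * \<psi> y"
      by (intro AE_I2 tendsto_intros isCont_tendsto_compose[OF u_cont] s)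
    show "AE y in lborel. norm (u (s n y) * \<psi> y) \<le> C0 * 2 ^ N0 * ((1 + norm y) ^ N0 * norm (\<psi> y))" for n
      by (intro AE_I2 u2 s)
  qed (use w0 in auto)
  then show "T ?f = (LINT y|lborel. u y * \<psi> y)"
    using lim1 unfolding TF by (rule LIMSEQ_unique[rotated])
qed

section \<open>Littlewood--Paley blocks\<close>

lemma fourier_modulate: "fourier (\<lambda>\<xi>. exp (\<i> * of_real (\<xi> \<bullet> y)) * m \<xi>) x = fourier m (x - y)"
proof -
  have "exp (- \<i> * of_real (\<xi> \<bullet> x)) * (exp (\<i> * of_real (\<xi> \<bullet> y)) * m \<xi>) = exp (- \<i> * of_real (\<xi> \<bullet> (x - y))) * m \<xi>" for \<xi>
  proof -
    have "- \<i> * of_real (\<xi> \<bullet> (x - y)) = - \<i> * of_real (\<xi> \<bullet> x) + \<i> * complex_of_real (\<xi> \<bullet> y)"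
      by (simp add: inner_diff_right algebra_simps)
    then show ?thesis by (simp only: exp_add mult.assoc)
  qed
  then show ?thesis unfolding fourier_def by (simp only:)
qed

lemma fourier_scale:
  fixes m :: "'a::euclidean_space \<Rightarrow> complex"
  assumes [measurable]: "m \<in> borel_measurable borel" and c: "0 < c"
  shows "fourier m x = of_real (c ^ DIM('a)) * fourier (\<lambda>\<xi>. m (c *\<^sub>R \<xi>)) (c *\<^sub>R x)"
proof -
  have "(LINT \<xi>|lborel. exp (- \<i> * of_real (\<xi> \<bullet> x)) * m \<xi>)
    = (\<bar>c\<bar> ^ DIM('a)) *\<^sub>R (LINT \<xi>|lborel. exp (- \<i> * of_real ((c *\<^sub>R \<xi>) \<bullet> x)) * m (c *\<^sub>R \<xi>))"
    using c by (subst integral_lborel_scale[where c=c]) auto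
  then show ?thesis
    using c unfolding fourier_def by (simp add: scaleR_conv_of_real)
qed

text \<open>The transpose of the multiplier, as it acts on test functions. Duality with the
  modulated reflection of m turns it into a convolution, with kernel the transform of m times the
  normalizing constant of the second transform.\<close>

lemma fourier_mult_inv_fourier:
  fixes m \<psi> :: "'a::euclidean_space \<Rightarrow> complex"
  assumes m: "m \<in> schwartz" and \<psi>: "\<psi> \<in> schwartz"
  shows "fourier (\<lambda>\<xi>. m \<xi> * inv_fourier \<psi> \<xi>) x = (LINT y|lborel. \<psi> y * (fourier_const TYPE('a) * fourier m (x - y)))"
proof -
  have m': "(\<lambda>\<xi>. m (- \<xi>)) \<in> schwartz" using schwartz_reflect[OF m, of 0] by simp
  have [measurable]: "m \<in> borel_measurable borel" "\<psi> \<in> borel_measurable borel" "fourier \<psi> \<in> borel_measurable borel"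
    using m \<psi> schwartz_fourier by (auto intro: schwartz_measurable)
  let ?G = "\<lambda>\<xi>. exp (\<i> * of_real (\<xi> \<bullet> x)) * m (- \<xi>)"
  have "fourier (\<lambda>\<xi>. m \<xi> * inv_fourier \<psi> \<xi>) x
    = fourier_const TYPE('a) * (LINT \<xi>|lborel. exp (- \<i> * of_real (\<xi> \<bullet> x)) * (m \<xi> * fourier \<psi> (- \<xi>)))"
    unfolding inv_fourier_eq_fourier by (rule fourier_def)
  also have "(LINT \<xi>|lborel. exp (- \<i> * of_real (\<xi> \<bullet> x)) * (m \<xi> * fourier \<psi> (- \<xi>)))
    = (LINT \<xi>|lborel. exp (- \<i> * of_real ((0 - \<xi>) \<bullet> x)) * (m (0 - \<xi>) * fourier \<psi> (- (0 - \<xi>))))"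
    by (rule integral_lborel_reflect[symmetric]) measurable
  also have "\<dots> = (LINT \<xi>|lborel. ?G \<xi> * fourier \<psi> \<xi>)"
    by (simp add: mult.assoc)
  also have "(LINT \<xi>|lborel. ?G \<xi> * fourier \<psi> \<xi>) = (LINT y|lborel. fourier ?G y * \<psi> y)"
    by (intro fourier_duality[symmetric] integrable_exp_mult schwartz_integrable m' \<psi>)
  also have "\<dots> = (LINT y|lborel. fourier m (x - y) * \<psi> y)"
    unfolding fourier_modulate by (simp add: fourier_reflect)
  also have "fourier_const TYPE('a) * \<dots> = (LINT y|lborel. \<psi> y * (fourier_const TYPE('a) * fourier m (x - y)))"
    by (subst integral_mult_right_zero[symmetric]) (simp only: mult_ac)
  finally show ?thesis .
qed

definition LP_multiplier :: "('a::euclidean_space \<Rightarrow> real) \<Rightarrow> int \<Rightarrow> 'a \<Rightarrow> complex" where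
  "LP_multiplier \<phi> j \<xi> = of_real (\<phi> (2 powi (- j) *\<^sub>R \<xi>))"

text \<open>The convolution kernel of the transposed multiplier, including both normalizing
  constants. The symbols used below are even, so the transform may stand in place of its
  inverse.\<close>

definition LP_kernel :: "('a::euclidean_space \<Rightarrow> complex) \<Rightarrow> 'a \<Rightarrow> complex" where
  "LP_kernel m x = fourier_const TYPE('a) * fourier m x"

lemma schwartz_LP_kernel: "m \<in> schwartz \<Longrightarrow> LP_kernel m \<in> schwartz"
  unfolding LP_kernel_def[abs_def] by (intro schwartz_cmult schwartz_fourier)

lemma LP_block_eq: "LP_block \<phi> j f \<psi> = f (fourier (\<lambda>\<xi>. LP_multiplier \<phi> j \<xi> * inv_fourier \<psi> \<xi>))"
  by (simp add: LP_block_def inv_fourier_dist_def mult_dist_def fourier_dist_def LP_multiplier_def)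

text \<open>On a test function the block evaluates f at a convolution with the kernel, and a
  tempered distribution may be taken under this integral. Hence the block is the regularization of f
  by the kernel, a continuous function of polynomial growth whatever f is.\<close>

lemma LP_block_represents:
  assumes f: "tempered_distribution f" and m: "LP_multiplier \<phi> j \<in> schwartz"
  defines "u \<equiv> \<lambda>y. f (\<lambda>x. LP_kernel (LP_multiplier \<phi> j) (x - y))"
  shows "represents (LP_block \<phi> j f) u" "moderate u" "isCont u y"
proof -
  let ?k = "LP_kernel (LP_multiplier \<phi> j)"
  have k: "?k \<in> schwartz" by (rule schwartz_LP_kernel[OF m])
  show cont: "isCont u y" for y unfolding u_def by (rule regularization_continuous[OF f k])
  show "moderate u" unfolding u_def by (rule regularization_moderate[OF f k])
  have "u \<in> borel_measurable borel"
    by (intro borel_measurable_continuous_onI continuous_at_imp_continuous_on ballI cont)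
  moreover have "fourier (\<lambda>\<xi>. LP_multiplier \<phi> j \<xi> * inv_fourier \<psi> \<xi>) = (\<lambda>x. LINT y|lborel. \<psi> y * ?k (x - y))"
    if "\<psi> \<in> schwartz" for \<psi>
    by (rule ext) (simp only: fourier_mult_inv_fourier[OF m that] LP_kernel_def)
  ultimately show "represents (LP_block \<phi> j f) u"
    unfolding represents_def fun_dist_def LP_block_eq u_def
    using tempered_distribution_convolution[OF f k] by simp
qed

text \<open>Since M is one where the symbol is nonzero, inserting M leaves the block unchanged.
  Testing the block on the reflected translate of the kernel of M, which is itself the transform of
  a modulation of M because M is even, expresses this as a convolution identity at every
  point.\<close>

lemma LP_block_reproduces:
  assumes f: "tempered_distribution f" and m: "LP_multiplier \<phi> j \<in> schwartz"
    and M: "M \<in> schwartz" "\<And>\<xi>. M (- \<xi>) = M \<xi>" "\<And>\<xi>. LP_multiplier \<phi> j \<xi> * M \<xi> = LP_multiplier \<phi> j \<xi>"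
  defines "u \<equiv> \<lambda>y. f (\<lambda>x. LP_kernel (LP_multiplier \<phi> j) (x - y))"
  shows "u y = (LINT z|lborel. u z * LP_kernel M (y - z))"
proof -
  let ?g = "\<lambda>\<xi>. fourier_const TYPE('a) * (exp (\<i> * of_real (\<xi> \<bullet> y)) * M \<xi>)"
  have cf: "fourier (\<lambda>\<xi>. c * h \<xi>) x = c * fourier h x" for c x and h :: "'a \<Rightarrow> complex"
  proof -
    have "(LINT \<xi>|lborel. exp (- \<i> * of_real (\<xi> \<bullet> x)) * (c * h \<xi>)) = c * (LINT \<xi>|lborel. exp (- \<i> * of_real (\<xi> \<bullet> x)) * h \<xi>)"
      by (subst integral_mult_right_zero[symmetric]) (simp only: mult.left_commute)
    then show ?thesis unfolding fourier_def by (simp only: mult.left_commute)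
  qed
  have g: "?g \<in> schwartz" by (intro schwartz_cmult schwartz_modulate M)
  have K: "(\<lambda>z. LP_kernel M (y - z)) = fourier ?g"
  proof
    fix z
    have "fourier M (- (z - y)) = fourier (\<lambda>\<xi>. M (- \<xi>)) (z - y)"
      by (rule fourier_reflect[symmetric]) (rule schwartz_measurable[OF M(1)])
    then show "LP_kernel M (y - z) = fourier ?g z"
      unfolding cf fourier_modulate LP_kernel_def by (simp add: M(2))
  qed
  have "(\<lambda>z. LP_kernel M (y - z)) \<in> schwartz" by (rule schwartz_reflect[OF schwartz_LP_kernel[OF M(1)]])
  then have "(LINT z|lborel. u z * LP_kernel M (y - z)) = LP_block \<phi> j f (\<lambda>z. LP_kernel M (y - z))"
    using LP_block_represents(1)[OF f m] unfolding represents_def fun_dist_def u_def by simp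
  also have "\<dots> = f (fourier (\<lambda>\<xi>. LP_multiplier \<phi> j \<xi> * ?g \<xi>))"
    unfolding LP_block_eq K inv_fourier_fourier[OF g] ..
  also have "(\<lambda>\<xi>. LP_multiplier \<phi> j \<xi> * ?g \<xi>) = (\<lambda>\<xi>. fourier_const TYPE('a) * (exp (\<i> * of_real (\<xi> \<bullet> y)) * LP_multiplier \<phi> j \<xi>))"
    (is "?L = ?R")
  proof
    fix \<xi>
    have "a * (c * (e * b)) = c * (e * (a * b))" for a b c e :: complex by (simp only: mult.left_commute)
    from this[of "LP_multiplier \<phi> j \<xi>" "fourier_const TYPE('a)" "exp (\<i> * of_real (\<xi> \<bullet> y))" "M \<xi>"]
    show "?L \<xi> = ?R \<xi>" unfolding M(3) .
  qed
  also have "fourier \<dots> = (\<lambda>x. LP_kernel (LP_multiplier \<phi> j) (x - y))"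
    by (rule ext) (simp only: cf fourier_modulate LP_kernel_def)
  finally show ?thesis by (simp only: u_def)
qed

text \<open>A real even symbol has a real kernel, and a real distribution takes real values on real
  test functions.\<close>

lemma LP_block_real:
  assumes f: "real_distribution f" and m: "LP_multiplier \<phi> j \<in> schwartz" and even: "\<And>\<xi>. \<phi> (- \<xi>) = \<phi> \<xi>"
  shows "f (\<lambda>x. LP_kernel (LP_multiplier \<phi> j) (x - y)) \<in> \<real>"
proof -
  let ?m = "LP_multiplier \<phi> j"
  have cnj: "cnj (LP_kernel ?m x) = LP_kernel ?m x" for x
  proof -
    have pw: "cnj (exp (- \<i> * of_real (\<xi> \<bullet> x)) * ?m \<xi>) = exp (- \<i> * of_real (\<xi> \<bullet> - x)) * ?m \<xi>" for \<xi>
      by (simp add: exp_cnj LP_multiplier_def)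
    have "cnj (fourier ?m x) = fourier_const TYPE('a) * (LINT \<xi>|lborel. cnj (exp (- \<i> * of_real (\<xi> \<bullet> x)) * ?m \<xi>))"
      unfolding fourier_def by (subst Bochner_Integration.integral_cnj) simp
    also have "\<dots> = fourier ?m (- x)"
      unfolding pw fourier_def ..
    also have "\<dots> = fourier (\<lambda>\<xi>. ?m (- \<xi>)) x"
      by (rule fourier_reflect[symmetric]) (rule schwartz_measurable[OF m])
    also have "(\<lambda>\<xi>. ?m (- \<xi>)) = ?m" by (simp add: LP_multiplier_def even fun_eq_iff)
    finally show ?thesis by (simp add: LP_kernel_def)
  qed
  have "(\<lambda>x. LP_kernel ?m (x - y)) \<in> schwartz" by (intro schwartz_translate schwartz_LP_kernel m)
  from bspec[OF f[unfolded Defs.real_distribution_def] this]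
  have "f (\<lambda>x. cnj (LP_kernel ?m (x - y))) = cnj (f (\<lambda>x. LP_kernel ?m (x - y)))" .
  then show ?thesis unfolding cnj by (simp add: Reals_cnj_iff)
qed

text \<open>The dilation of the symbol changes the kernel by a dilation and the factor c^d, which is
  the Jacobian of the substitution. So the rescaled function is reproduced by a kernel in which c no
  longer occurs.\<close>

lemma LP_block_rescaled:
  fixes u :: "'a::euclidean_space \<Rightarrow> complex"
  assumes [measurable]: "u \<in> borel_measurable borel" and M: "M \<in> schwartz" and c: "0 < c"
    and u: "\<And>y. u y = (LINT z|lborel. u z * LP_kernel (\<lambda>\<xi>. M (c *\<^sub>R \<xi>)) (y - z))"
  shows "u (c *\<^sub>R x) = (LINT z|lborel. LP_kernel M z * u (c *\<^sub>R (x - z)))"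
proof -
  have M': "(\<lambda>\<xi>. M (c *\<^sub>R \<xi>)) \<in> schwartz" using schwartz_affine[OF M, of c 0] c by simp
  have [measurable]: "LP_kernel (\<lambda>\<xi>. M (c *\<^sub>R \<xi>)) \<in> borel_measurable borel"
    "LP_kernel M \<in> borel_measurable borel"
    by (intro schwartz_measurable schwartz_LP_kernel M M')+
  have scale: "LP_kernel M x = of_real (c ^ DIM('a)) * LP_kernel (\<lambda>\<xi>. M (c *\<^sub>R \<xi>)) (c *\<^sub>R x)" for x
    using fourier_scale[OF schwartz_measurable[OF M] c, of x] by (simp add: LP_kernel_def mult.left_commute)
  have "u (c *\<^sub>R x) = (LINT z|lborel. u z * LP_kernel (\<lambda>\<xi>. M (c *\<^sub>R \<xi>)) (c *\<^sub>R x - z))" by (rule u)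
  also have "\<dots> = (\<bar>c\<bar> ^ DIM('a)) *\<^sub>R (LINT z|lborel. u (c *\<^sub>R z) * LP_kernel (\<lambda>\<xi>. M (c *\<^sub>R \<xi>)) (c *\<^sub>R x - c *\<^sub>R z))"
    by (rule integral_lborel_scale) (use c in auto)
  also have "\<dots> = (LINT z|lborel. u (c *\<^sub>R z) * LP_kernel M (x - z))"
  proof -
    have "u (c *\<^sub>R z) * LP_kernel M (x - z) = of_real (c ^ DIM('a)) * (u (c *\<^sub>R z) * LP_kernel (\<lambda>\<xi>. M (c *\<^sub>R \<xi>)) (c *\<^sub>R x - c *\<^sub>R z))" for z
      unfolding scale by (simp only: scaleR_diff_right mult.left_commute)
    then show ?thesis using c by (simp only: integral_mult_right_zero) (simp add: scaleR_conv_of_real)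
  qed
  also have "\<dots> = (LINT z|lborel. u (c *\<^sub>R (x - z)) * LP_kernel M (x - (x - z)))"
    by (rule integral_lborel_reflect[symmetric]) measurable
  finally show ?thesis by (simp add: mult.commute)
qed

lemma LP_support:
  assumes lp: "littlewood_paley chi \<phi>" and nz: "\<phi> \<eta> \<noteq> 0"
  shows "3 / 4 \<le> norm \<eta>" "norm \<eta> \<le> 8 / 3"
proof -
  have "\<eta> \<in> closure {\<xi>. \<phi> \<xi> \<noteq> 0}" using nz closure_subset[of "{\<xi>. \<phi> \<xi> \<noteq> 0}"] by auto
  moreover have "closure {\<xi>. \<phi> \<xi> \<noteq> 0} \<subseteq> {\<xi>. 3 / 4 \<le> norm \<xi> \<and> norm \<xi> \<le> 8 / 3}"
    using lp unfolding littlewood_paley_def by (elim conjE)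
  ultimately show "3 / 4 \<le> norm \<eta>" "norm \<eta> \<le> 8 / 3" by auto
qed

text \<open>On the support of \<phi>, where 3/4 \<le> norm \<xi> \<le> 8/3, only three terms of the
  partition of unity survive: a dilation by 4 or more leads to norms at least 3 > 8/3, and by 1/4 or
  less to norms at most 2/3 < 3/4.\<close>

lemma LP_fattened_cutoff:
  assumes lp: "littlewood_paley chi \<phi>" and nz: "\<phi> \<xi> \<noteq> 0"
  shows "\<phi> (2 *\<^sub>R \<xi>) + \<phi> \<xi> + \<phi> ((1/2) *\<^sub>R \<xi>) = 1"
proof -
  have supp: "3 / 4 \<le> norm \<eta> \<and> norm \<eta> \<le> 8 / 3" if "\<phi> \<eta> \<noteq> 0" for \<eta>
    using LP_support[OF lp that] by simp
  have \<xi>: "3 / 4 \<le> norm \<xi>" "norm \<xi> \<le> 8 / 3" using supp[OF nz] by auto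
  then have "\<xi> \<noteq> 0" by auto
  then have hs: "((\<lambda>j::int. \<phi> (2 powi (- j) *\<^sub>R \<xi>)) has_sum 1) UNIV"
    using lp unfolding littlewood_paley_def by blast
  have zero: "\<phi> (2 powi (- j) *\<^sub>R \<xi>) = 0" if "j \<notin> {-1, 0, 1}" for j :: int
  proof (rule ccontr)
    assume "\<phi> (2 powi (- j) *\<^sub>R \<xi>) \<noteq> 0"
    from supp[OF this] have b: "3 / 4 \<le> 2 powi (- j) * norm \<xi>" "2 powi (- j) * norm \<xi> \<le> 8 / 3"
      by auto
    have "2 \<le> j \<or> j \<le> -2" using that by auto
    then show False
    proof
      assume "2 \<le> j"
      then have "(2::real) powi (- j) \<le> 2 powi (-2)" by (intro power_int_increasing) auto
      then have "(2::real) powi (- j) * norm \<xi> \<le> 1 / 4 * norm \<xi>" by (intro mult_right_mono) (auto simp: power_int_minus)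
      then show False using b \<xi> by linarith
    next
      assume "j \<le> -2"
      then have "(2::real) powi 2 \<le> 2 powi (- j)" by (intro power_int_increasing) auto
      then have "4 * norm \<xi> \<le> (2::real) powi (- j) * norm \<xi>" by (intro mult_right_mono) auto
      then show False using b \<xi> by linarith
    qed
  qed
  have "((\<lambda>j::int. \<phi> (2 powi (- j) *\<^sub>R \<xi>)) has_sum 1) {-1, 0, 1}"
    using hs by (rule has_sum_cong_neutral[THEN iffD1, rotated -1]) (use zero in auto)
  then have "(\<Sum>j\<in>{-1, 0, 1::int}. \<phi> (2 powi (- j) *\<^sub>R \<xi>)) = 1"
    using has_sum_finite[of "{-1, 0, 1::int}" "\<lambda>j. \<phi> (2 powi (- j) *\<^sub>R \<xi>)"] has_sum_unique by blast
  then show ?thesis by (simp add: power_int_minus)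
qed

text \<open>The cutoff M is the sum of the three neighbouring dilates of \<phi>. It is one on the
  support of \<phi>, which gives the reproducing identity, and zero at the origin, which by Fourier
  inversion is the value of the integral of its kernel. Nothing about f or j enters K.\<close>

lemma LP_block_structure:
  fixes chi \<phi> :: "'a::euclidean_space \<Rightarrow> real"
  assumes lp: "littlewood_paley chi \<phi>"
  obtains K :: "'a \<Rightarrow> complex" where "K \<in> schwartz" "(LINT z|lborel. K z) = 0"
    "\<And>f j. tempered_distribution f \<Longrightarrow> \<exists>u. represents (LP_block \<phi> j f) u \<and> moderate u \<and>
       (\<forall>x. u (2 powi (- j) *\<^sub>R x) = (LINT z|lborel. K z * u (2 powi (- j) *\<^sub>R (x - z)))) \<and>
       (real_distribution f \<longrightarrow> (\<forall>x. u x \<in> \<real>))"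
proof -
  have \<phi>: "(\<lambda>\<xi>. complex_of_real (\<phi> \<xi>)) \<in> schwartz" and radial: "\<And>\<xi> \<eta>. norm \<xi> = norm \<eta> \<Longrightarrow> \<phi> \<xi> = \<phi> \<eta>"
    using lp unfolding littlewood_paley_def by blast+
  have even: "\<phi> (- \<xi>) = \<phi> \<xi>" for \<xi> by (rule radial) simp
  have scaled: "(\<lambda>\<xi>. complex_of_real (\<phi> (c *\<^sub>R \<xi>))) \<in> schwartz" if "c \<noteq> 0" for c
    using schwartz_affine[OF \<phi> that, of 0] by simp
  define M where "M \<xi> = complex_of_real (\<phi> (2 *\<^sub>R \<xi>)) + complex_of_real (\<phi> (1 *\<^sub>R \<xi>)) + complex_of_real (\<phi> ((1/2) *\<^sub>R \<xi>))" for \<xi>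
  have M: "M \<in> schwartz" unfolding M_def by (intro schwartz_add scaled) auto
  have Meven: "M (- \<xi>) = M \<xi>" for \<xi> unfolding M_def by (simp add: even)
  have M\<phi>: "of_real (\<phi> \<xi>) * M \<xi> = of_real (\<phi> \<xi>)" for \<xi>
  proof (cases "\<phi> \<xi> = 0")
    case False
    have "M \<xi> = of_real (\<phi> (2 *\<^sub>R \<xi>) + \<phi> \<xi> + \<phi> ((1/2) *\<^sub>R \<xi>))" by (simp add: M_def)
    then show ?thesis using LP_fattened_cutoff[OF lp False] by simp
  qed simp
  have M0: "M 0 = 0"
  proof -
    have "\<phi> 0 = 0"
      using LP_support(1)[OF lp, of 0] by auto
    then show ?thesis by (simp add: M_def)
  qed
  show ?thesis
  proof (rule that[of "LP_kernel M"])
    show "LP_kernel M \<in> schwartz" by (rule schwartz_LP_kernel[OF M])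
    have "(LINT z|lborel. LP_kernel M z) = inv_fourier (fourier M) 0"
      by (simp add: LP_kernel_def inv_fourier_def)
    then show "(LINT z|lborel. LP_kernel M z) = 0" by (simp add: inv_fourier_fourier[OF M] M0)
    fix f :: "'a functional" and j :: int assume f: "tempered_distribution f"
    have c: "(0::real) < 2 powi (- j)" by simp
    have m: "LP_multiplier \<phi> j \<in> schwartz"
      unfolding LP_multiplier_def[abs_def] using c by (intro scaled) simp
    define u where "u y = f (\<lambda>x. LP_kernel (LP_multiplier \<phi> j) (x - y))" for y
    have r: "represents (LP_block \<phi> j f) u" "moderate u"
      using LP_block_represents(1,2)[OF f m] by (simp_all add: u_def[abs_def])
    have um: "u \<in> borel_measurable borel" using r(1) by (simp add: represents_def)
    have Mj: "(\<lambda>\<xi>. M (2 powi (- j) *\<^sub>R \<xi>)) \<in> schwartz" using schwartz_affine[OF M, of "2 powi (- j)" 0] c by simp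
    have "u (2 powi (- j) *\<^sub>R x) = (LINT z|lborel. LP_kernel M z * u (2 powi (- j) *\<^sub>R (x - z)))" for x
    proof (rule LP_block_rescaled[OF um M c])
      show "u y = (LINT z|lborel. u z * LP_kernel (\<lambda>\<xi>. M (2 powi (- j) *\<^sub>R \<xi>)) (y - z))" for y
        unfolding u_def
        by (rule LP_block_reproduces[OF f m Mj]) (simp_all add: Meven LP_multiplier_def M\<phi>)
    qed
    moreover have "real_distribution f \<longrightarrow> (\<forall>x. u x \<in> \<real>)"
      unfolding u_def using LP_block_real[OF _ m even] by blast
    ultimately show "\<exists>u. represents (LP_block \<phi> j f) u \<and> moderate u \<and>
       (\<forall>x. u (2 powi (- j) *\<^sub>R x) = (LINT z|lborel. LP_kernel M z * u (2 powi (- j) *\<^sub>R (x - z)))) \<and>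
       (real_distribution f \<longrightarrow> (\<forall>x. u x \<in> \<real>))"
      using r by blast
  qed
qed

section \<open>The operator \<open>\<Lambda>\<^sup>\<alpha>\<close> on the Fourier side\<close>

lemma ennreal_powr_ennreal: "0 \<le> x \<Longrightarrow> ennreal_powr (ennreal x) r = ennreal (x powr r)"
  by (simp add: ennreal_powr_def)

lemma ennreal_powr_top: "ennreal_powr \<infinity> r = \<infinity>"
  by (simp add: ennreal_powr_def)

lemma ennreal_powr_mono:
  assumes "x \<le> y" "0 \<le> r"
  shows "ennreal_powr x r \<le> ennreal_powr y r"
proof (cases "y = \<infinity>")
  case False
  then obtain b where b: "y = ennreal b" "0 \<le> b" by (cases y) auto
  moreover obtain a where a: "x = ennreal a" "0 \<le> a" using assms(1) b by (cases x) (auto simp: top_unique)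
  ultimately show ?thesis using assms
    by (simp add: ennreal_powr_ennreal ennreal_leI powr_mono2)
qed (simp add: ennreal_powr_def)

lemma ennreal_powr_powr: "ennreal_powr (ennreal_powr x r) s = ennreal_powr x (r * s)"
  by (cases x) (auto simp: ennreal_powr_ennreal ennreal_powr_top powr_powr simp flip: infinity_ennreal_def)

lemma ennreal_powr_mult:
  assumes "0 < a"
  shows "ennreal_powr (ennreal a * x) r = ennreal (a powr r) * ennreal_powr x r"
proof (cases x)
  case (real b)
  then show ?thesis
    using assms by (simp add: ennreal_mult[symmetric] ennreal_powr_ennreal powr_mult)
next
  case top
  have "ennreal c * top = top" if "0 < c" for c
    using that by (simp add: ennreal_mult_top)
  then show ?thesis using assms by (simp add: top ennreal_powr_def)
qed

lemma Lp_norm_eq_Lpow: "Lp_norm p u = ennreal_powr (Lpow p u) (1 / p)"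
  by (simp add: Lp_norm_def Lpow_def)

lemma norm_powr_two: "norm x powr 2 = (norm x)\<^sup>2"
  by (cases "norm x = 0") (auto simp: powr_numeral)

lemma Lpow_two: "Lpow 2 u = sqnorm u"
  by (simp add: Lpow_def sqnorm_def norm_powr_two)

lemma Lpow_cong_AE: "AE x in lborel. u x = v x \<Longrightarrow> Lpow p u = Lpow p v"
  unfolding Lpow_def by (rule nn_integral_cong_AE) auto

lemma represents_unique:
  assumes "represents T u" "represents T v"
  shows "AE x in lborel. u x = v x"
  by (rule AE_eq_of_schwartz_integrals) (use assms in \<open>auto simp: represents_def fun_dist_def\<close>)

lemma represents_dist_fun: "represents T u \<Longrightarrow> represents T (dist_fun T)"
  unfolding dist_fun_def by (rule someI[of "represents T" u])

lemma dist_Lp_norm_eq: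
  assumes "represents T u"
  shows "dist_Lp_norm p T = ennreal_powr (Lpow p u) (1 / p)"
  using Lpow_cong_AE[OF represents_unique[OF represents_dist_fun[OF assms] assms], of p] assms
  by (auto simp: dist_Lp_norm_def Lp_norm_eq_Lpow)

text \<open>The function selected by \<open>dist_fun\<close> agrees with u only almost everywhere,
  but integrals against test functions do not see the difference.\<close>

lemma abs_powr_dist_eq:
  assumes "represents T u" and \<psi>: "\<psi> \<in> schwartz"
  shows "abs_powr_dist T r \<psi> = fun_dist (\<lambda>x. of_real (norm (u x) powr r)) \<psi>"
proof -
  have ae: "AE x in lborel. dist_fun T x = u x"
    by (rule represents_unique[OF represents_dist_fun[OF assms(1)] assms(1)])
  have [measurable]: "u \<in> borel_measurable borel" "dist_fun T \<in> borel_measurable borel" "\<psi> \<in> borel_measurable borel"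
    using assms(1) represents_dist_fun[OF assms(1)] schwartz_measurable[OF \<psi>] by (auto simp: represents_def)
  show ?thesis
    unfolding abs_powr_dist_def fun_dist_def by (rule integral_cong_AE) (use ae in auto)
qed

lemma moderate_integrable:
  assumes [measurable]: "v \<in> borel_measurable borel" and v: "moderate v" and \<psi>: "\<psi> \<in> schwartz"
  shows "integrable lborel (\<lambda>x. v x * \<psi> x)"
  using schwartz_measurable[OF \<psi>] by (intro rapid_integrable moderate_mult_rapid v schwartz_rapid \<psi>) auto

text \<open>Ensures that |u|^(p/2) pairs with test functions and has a distributional transform even
  when no Lebesgue norm of u is known to be finite. The exponent k r is rounded up to a natural
  number.\<close>

lemma moderate_abs_powr:
  assumes "moderate u" and r: "0 \<le> r"
  shows "moderate (\<lambda>x. of_real (norm (u x) powr r))"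
proof -
  obtain k C where C: "\<And>x. norm (u x) \<le> C * (1 + norm x) ^ k"
    using assms(1) unfolding moderate_def by blast
  have C0: "0 \<le> C" using order_trans[OF norm_ge_zero C[of 0]] by simp
  define n where "n = nat \<lceil>real k * r\<rceil>"
  have n: "real k * r \<le> real n" unfolding n_def by linarith
  have "norm (complex_of_real (norm (u x) powr r)) \<le> C powr r * (1 + norm x) ^ n" for x
  proof -
    have pos: "0 < 1 + norm x" by (simp add: add_pos_nonneg)
    have "norm (u x) powr r \<le> (C * (1 + norm x) ^ k) powr r"
      using C r by (intro powr_mono2) auto
    also have "\<dots> = C powr r * (1 + norm x) powr (real k * r)"
      using C0 pos by (simp add: powr_mult powr_powr powr_realpow[symmetric])
    also have "(1 + norm x) powr (real k * r) \<le> (1 + norm x) powr real n"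
      using n by (intro powr_mono) auto
    also have "\<dots> = (1 + norm x) ^ n" using pos by (simp add: powr_realpow)
    finally show ?thesis by (simp add: mult_left_mono)
  qed
  then show ?thesis by (rule moderateI)
qed

lemma represents_fourier_dist_iff:
  assumes v: "v \<in> borel_measurable borel" "moderate v"
    and g: "\<And>\<psi>. \<psi> \<in> schwartz \<Longrightarrow> g \<psi> = fun_dist v \<psi>"
  shows "represents (fourier_dist g) h \<longleftrightarrow> fourier_pair v h"
  using v moderate_integrable[OF v schwartz_fourier] g[OF schwartz_fourier]
  unfolding represents_def fourier_pair_def fourier_dist_def fun_dist_def by auto

lemma powr_norm_le: "0 \<le> \<alpha> \<Longrightarrow> \<alpha> \<le> 1 \<Longrightarrow> norm \<xi> powr \<alpha> \<le> 1 + norm \<xi>"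
proof -
  assume \<alpha>: "0 \<le> \<alpha>" "\<alpha> \<le> 1"
  have "norm \<xi> powr \<alpha> \<le> (1 + norm \<xi>) powr \<alpha>" using \<alpha> by (intro powr_mono2) auto
  also have "\<dots> \<le> (1 + norm \<xi>) powr 1" using \<alpha> by (intro powr_mono) auto
  also have "\<dots> = 1 + norm \<xi>" by (simp add: add_nonneg_pos abs_of_nonneg)
  finally show ?thesis .
qed

text \<open>The symbol is moved onto the test function. It is not smooth at the origin, so the
  product need not be a Schwartz function, but since norm \<xi> powr \<alpha> \<le> 1 + norm \<xi>
  it is rapidly decreasing and therefore square-integrable.\<close>

lemma riesz_symbol_integrable:
  fixes h :: "'a::euclidean_space \<Rightarrow> complex"
  assumes [measurable]: "h \<in> borel_measurable borel" and h: "sqnorm h < \<infinity>" and \<alpha>: "0 \<le> \<alpha>" "\<alpha> \<le> 1"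
    and \<psi>: "\<psi> \<in> schwartz"
  shows "integrable lborel (\<lambda>\<xi>. (of_real (norm \<xi> powr \<alpha>) * h \<xi>) * \<psi> \<xi>)"
proof -
  have [measurable]: "\<psi> \<in> borel_measurable borel" using schwartz_measurable[OF \<psi>] .
  let ?g = "\<lambda>\<xi>. of_real (norm \<xi> powr \<alpha>) * \<psi> \<xi>"
  have mod: "moderate (\<lambda>\<xi>::'a. complex_of_real (norm \<xi> powr \<alpha>))"
    by (rule moderateI[of _ 1 1]) (simp add: powr_norm_le[OF \<alpha>])
  have "rapid (\<lambda>\<xi>. ?g \<xi> * ?g \<xi>)"
    by (intro moderate_mult_rapid rapid_imp_moderate mod schwartz_rapid \<psi>)
  then have "integrable lborel (\<lambda>\<xi>. ?g \<xi> * ?g \<xi>)" by (intro rapid_integrable) auto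
  then have "sqnorm ?g < \<infinity>"
    by (simp add: sqnorm_def integrable_iff_bounded norm_mult power2_eq_square mult_ac)
  then have "integrable lborel (\<lambda>\<xi>. h \<xi> * ?g \<xi>)"
    by (intro integrable_mult_of_sqnorm h) auto
  then show ?thesis by (simp add: mult_ac)
qed

lemma Lambda_domain_iff:
  assumes "v \<in> borel_measurable borel" "moderate v" "\<And>\<psi>. \<psi> \<in> schwartz \<Longrightarrow> g \<psi> = fun_dist v \<psi>"
  shows "Lambda_domain g \<longleftrightarrow> (\<exists>h. fourier_pair v h \<and> sqnorm h < \<infinity>)"
proof -
  have "Lp_norm 2 h < \<infinity> \<longleftrightarrow> sqnorm h < \<infinity>" for h :: "'a \<Rightarrow> complex"
    by (simp add: Lp_norm_eq_Lpow Lpow_two ennreal_powr_def less_top)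
  moreover have "represents (fourier_dist g) h \<longleftrightarrow> fourier_pair v h" for h
    by (rule represents_fourier_dist_iff) (use assms in auto)
  ultimately show ?thesis unfolding Lambda_domain_def by simp
qed

text \<open>By Plancherel, the norm of \<open>\<Lambda>\<^sup>\<alpha> g\<close> is the weighted norm of the transform, both being
  infinite together.\<close>

lemma Lambda_L2_norm_eq:
  fixes v h :: "'a::euclidean_space \<Rightarrow> complex"
  assumes v: "v \<in> borel_measurable borel" "moderate v"
    and g: "\<And>\<psi>. \<psi> \<in> schwartz \<Longrightarrow> g \<psi> = fun_dist v \<psi>"
    and p: "fourier_pair v h" and h: "sqnorm h < \<infinity>" and \<alpha>: "0 \<le> \<alpha>" "\<alpha> \<le> 1"
  shows "Lambda_L2_norm \<alpha> g = ennreal_powr (sqnorm (\<lambda>\<xi>. of_real (norm \<xi> powr \<alpha>) * h \<xi>)) (1 / 2)"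
proof -
  define h' where "h' = dist_fun (fourier_dist g)"
  have iffv: "represents (fourier_dist g) k \<longleftrightarrow> fourier_pair v k" for k
    by (rule represents_fourier_dist_iff) (use v g in auto)
  have r: "represents (fourier_dist g) h" using iffv p by simp
  have p': "fourier_pair v h'"
    unfolding h'_def iffv[symmetric] by (rule represents_dist_fun[OF r])
  have ae: "AE \<xi> in lborel. h' \<xi> = h \<xi>" by (rule fourier_pair_unique_right[OF p' p])
  have hm [measurable]: "h' \<in> borel_measurable borel" using p' by (simp add: fourier_pair_def)
  have h'fin: "sqnorm h' < \<infinity>" using sqnorm_cong_AE[OF ae] h by simp
  define H where "H \<xi> = of_real (norm \<xi> powr \<alpha>) * h' \<xi>" for \<xi>
  have [measurable]: "H \<in> borel_measurable borel" unfolding H_def by measurable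
  have HH: "sqnorm H = sqnorm (\<lambda>\<xi>. of_real (norm \<xi> powr \<alpha>) * h \<xi>)"
    by (rule sqnorm_cong_AE) (use ae in \<open>eventually_elim, simp add: H_def\<close>)
  have Hi: "integrable lborel (\<lambda>\<xi>. H \<xi> * \<psi> \<xi>)" if "\<psi> \<in> schwartz" for \<psi>
    unfolding H_def by (rule riesz_symbol_integrable[OF hm h'fin \<alpha> that])
  have L: "Lambda \<alpha> g \<psi> = (LINT \<xi>|lborel. H \<xi> * inv_fourier \<psi> \<xi>)" for \<psi>
    by (simp add: Lambda_def inv_fourier_dist_def fun_dist_def H_def h'_def)
  have iff: "represents (Lambda \<alpha> g) w \<longleftrightarrow> fourier_pair w H" for w
  proof
    assume "represents (Lambda \<alpha> g) w"
    then show "fourier_pair w H"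
      unfolding represents_def fun_dist_def L by (intro fourier_pairI_inv_fourier Hi) auto
  next
    assume w: "fourier_pair w H"
    show "represents (Lambda \<alpha> g) w"
      unfolding represents_def fun_dist_def L
    proof (intro conjI ballI)
      show "w \<in> borel_measurable borel" using w by (simp add: fourier_pair_def)
      fix \<psi> :: "'a \<Rightarrow> complex" assume \<psi>: "\<psi> \<in> schwartz"
      show "integrable lborel (\<lambda>x. w x * \<psi> x)" by (rule fourier_pair_inv_fourier(1)[OF w \<psi>])
      show "(LINT \<xi>|lborel. H \<xi> * inv_fourier \<psi> \<xi>) = (LINT x|lborel. w x * \<psi> x)"
        by (rule fourier_pair_inv_fourier(3)[OF w \<psi>, symmetric])
    qed
  qed
  have dom: "Lambda_domain g" using Lambda_domain_iff[OF v g] p h by blast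
  show ?thesis
  proof (cases "\<exists>w. represents (Lambda \<alpha> g) w")
    case True
    then obtain w where w: "represents (Lambda \<alpha> g) w" by blast
    then have "sqnorm w = sqnorm H" unfolding iff by (rule fourier_pair_sqnorm)
    then show ?thesis
      using dom dist_Lp_norm_eq[OF w, of 2] by (simp add: Lambda_L2_norm_def Lpow_two HH)
  next
    case False
    \<comment> \<open>Were this finite, the inverse transform of H would be a square-integrable
      function representing the distribution. So the conventional value \<infinity> is the correct
      one.\<close>
    have "sqnorm H = \<infinity>"
    proof (rule ccontr)
      assume "sqnorm H \<noteq> \<infinity>"
      then obtain w where "fourier_pair w H"
        using exists_fourier_pair_left[of H] by (auto simp: less_top)
      then show False using False iff by blast
    qed
    then show ?thesis
      using dom False by (simp add: Lambda_L2_norm_def dist_Lp_norm_def HH[symmetric] ennreal_powr_def)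
  qed
qed

section \<open>Differences and the symbol\<close>

text \<open>A shift of v is a shift of the transformed test function the other way, which is the
  transform of a modulated test function. The argument stays on the side of the test functions, so
  no integrability of v is involved.\<close>

lemma fourier_pair_difference:
  fixes v h :: "'a::euclidean_space \<Rightarrow> complex"
  assumes p: "fourier_pair v h"
  shows "fourier_pair (\<lambda>x. v (x + k) - v x) (\<lambda>\<xi>. (exp (\<i> * of_real (\<xi> \<bullet> k)) - 1) * h \<xi>)"
  unfolding fourier_pair_def
proof (intro conjI ballI)
  have [measurable]: "v \<in> borel_measurable borel" "h \<in> borel_measurable borel" using p by (auto simp: fourier_pair_def)
  show "(\<lambda>x. v (x + k) - v x) \<in> borel_measurable borel" "(\<lambda>\<xi>. (exp (\<i> * of_real (\<xi> \<bullet> k)) - 1) * h \<xi>) \<in> borel_measurable borel"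
    by measurable
  fix \<psi> :: "'a \<Rightarrow> complex" assume \<psi>: "\<psi> \<in> schwartz"
  have [measurable]: "fourier \<psi> \<in> borel_measurable borel" using \<psi> by (intro schwartz_measurable schwartz_fourier)
  let ?e = "\<lambda>\<xi>. exp (\<i> * of_real (\<xi> \<bullet> k)) * \<psi> \<xi>"
  have e: "?e \<in> schwartz" by (rule schwartz_modulate[OF \<psi>])
  have P: "integrable lborel (\<lambda>x. v x * fourier \<psi> x)" "integrable lborel (\<lambda>x. h x * \<psi> x)"
    "(LINT x|lborel. v x * fourier \<psi> x) = (LINT x|lborel. h x * \<psi> x)" if "\<psi> \<in> schwartz" for \<psi>
    using p that by (auto simp: fourier_pair_def)
  have tr: "integrable lborel (\<lambda>x. v (x + k) * fourier \<psi> x)"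
    using integrable_lborel_translate[OF P(1)[OF e], of k] by (simp add: fourier_modulate)
  show "integrable lborel (\<lambda>x. (v (x + k) - v x) * fourier \<psi> x)"
    using tr P(1)[OF \<psi>] by (simp add: left_diff_distrib)
  have h2: "(exp (\<i> * of_real (\<xi> \<bullet> k)) - 1) * h \<xi> * \<psi> \<xi> = h \<xi> * ?e \<xi> - h \<xi> * \<psi> \<xi>" for \<xi>
    by (simp add: algebra_simps)
  show "integrable lborel (\<lambda>\<xi>. (exp (\<i> * of_real (\<xi> \<bullet> k)) - 1) * h \<xi> * \<psi> \<xi>)"
    unfolding h2 using P(2)[OF e] P(2)[OF \<psi>] by simp
  have "(LINT x|lborel. v (x + k) * fourier \<psi> x) = (LINT x|lborel. v (x + k) * fourier ?e (x + k))"
    by (simp add: fourier_modulate)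
  also have "\<dots> = (LINT x|lborel. v x * fourier ?e x)"
  proof (rule integral_lborel_translate)
    have [measurable]: "fourier ?e \<in> borel_measurable borel" by (intro schwartz_measurable schwartz_fourier e)
    show "(\<lambda>x. v x * fourier ?e x) \<in> borel_measurable borel" by measurable
  qed
  finally have "(LINT x|lborel. v (x + k) * fourier \<psi> x) = (LINT \<xi>|lborel. h \<xi> * ?e \<xi>)"
    using P(3)[OF e] by simp
  then show "(LINT x|lborel. (v (x + k) - v x) * fourier \<psi> x) = (LINT \<xi>|lborel. (exp (\<i> * of_real (\<xi> \<bullet> k)) - 1) * h \<xi> * \<psi> \<xi>)"
    unfolding h2 using tr P[OF \<psi>] P(2)[OF e] by (simp add: left_diff_distrib)
qed

text \<open>The left side is at most s = norm k * norm \<xi> and at most 2. For s \<le> 1 one has s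
  \<le> s powr \<alpha>, for larger s one has 1 \<le> s powr \<alpha>.\<close>

lemma norm_exp_minus_one_powr_le:
  fixes \<xi> k :: "'a::euclidean_space"
  assumes \<alpha>: "0 \<le> \<alpha>" "\<alpha> \<le> 1"
  shows "norm (exp (\<i> * of_real (\<xi> \<bullet> k)) - 1) \<le> 2 * (norm k powr \<alpha> * norm \<xi> powr \<alpha>)"
proof (cases "norm \<xi> * norm k = 0")
  \<comment> \<open>The right side is zero here even for \<alpha> = 0, by the convention
    \<open>0 powr 0 = 0\<close>; this is consistent because the exponential is one.\<close>
  case True
  then show ?thesis by auto
next
  case False
  define s where "s = norm k * norm \<xi>"
  have s: "0 < s" using False by (auto simp: s_def)
  have "norm (exp (\<i> * of_real (\<xi> \<bullet> k)) - 1) \<le> 2 * s powr \<alpha>"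
  proof (cases "s \<le> 1")
    case True
    have "norm (exp (\<i> * of_real (\<xi> \<bullet> k)) - 1) \<le> \<bar>\<xi> \<bullet> k\<bar>" by (rule norm_exp_i_minus_one_le)
    also have "\<dots> \<le> s" using Cauchy_Schwarz_ineq2[of \<xi> k] by (simp add: s_def mult.commute)
    also have "s \<le> s powr \<alpha>" using powr_mono'[of \<alpha> 1 s] \<alpha> s True by simp
    finally show ?thesis using powr_ge_zero[of s \<alpha>] by linarith
  next
    case False
    have "norm (exp (\<i> * of_real (\<xi> \<bullet> k)) - 1) \<le> norm (exp (\<i> * of_real (\<xi> \<bullet> k))) + norm (1::complex)"
      by (rule norm_triangle_ineq4)
    also have "\<dots> = 2" by simp
    also have "\<dots> \<le> 2 * s powr \<alpha>" using ge_one_powr_ge_zero[of s \<alpha>] \<alpha> False by simp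
    finally show ?thesis .
  qed
  then show ?thesis by (simp add: s_def powr_mult)
qed

lemma sqnorm_difference_le:
  fixes v h :: "'a::euclidean_space \<Rightarrow> complex"
  assumes p: "fourier_pair v h" and \<alpha>: "0 \<le> \<alpha>" "\<alpha> \<le> 1"
  shows "sqnorm (\<lambda>x. v (x + k) - v x) \<le> ennreal (4 * (norm k powr \<alpha>)\<^sup>2) * sqnorm (\<lambda>\<xi>. of_real (norm \<xi> powr \<alpha>) * h \<xi>)"
proof -
  have [measurable]: "h \<in> borel_measurable borel" using p by (simp add: fourier_pair_def)
  have "sqnorm (\<lambda>x. v (x + k) - v x) = sqnorm (\<lambda>\<xi>. (exp (\<i> * of_real (\<xi> \<bullet> k)) - 1) * h \<xi>)"
    by (rule fourier_pair_sqnorm[OF fourier_pair_difference[OF p]])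
  also have "\<dots> \<le> (\<integral>\<^sup>+\<xi>. ennreal (4 * (norm k powr \<alpha>)\<^sup>2) * ennreal ((norm (of_real (norm \<xi> powr \<alpha>) * h \<xi>))\<^sup>2) \<partial>lborel)"
    unfolding sqnorm_def
  proof (rule nn_integral_mono)
    fix \<xi> :: 'a
    have "(norm ((exp (\<i> * of_real (\<xi> \<bullet> k)) - 1) * h \<xi>))\<^sup>2 \<le> (2 * (norm k powr \<alpha> * norm \<xi> powr \<alpha>) * norm (h \<xi>))\<^sup>2"
      unfolding norm_mult by (intro power_mono mult_right_mono norm_exp_minus_one_powr_le \<alpha>) auto
    also have "\<dots> = 4 * (norm k powr \<alpha>)\<^sup>2 * (norm (of_real (norm \<xi> powr \<alpha>) * h \<xi>))\<^sup>2"
      by (simp add: norm_mult power_mult_distrib)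
    finally show "ennreal ((norm ((exp (\<i> * of_real (\<xi> \<bullet> k)) - 1) * h \<xi>))\<^sup>2)
      \<le> ennreal (4 * (norm k powr \<alpha>)\<^sup>2) * ennreal ((norm (of_real (norm \<xi> powr \<alpha>) * h \<xi>))\<^sup>2)"
      by (subst ennreal_mult'[symmetric]) (auto intro: ennreal_leI)
  qed
  also have "\<dots> = ennreal (4 * (norm k powr \<alpha>)\<^sup>2) * sqnorm (\<lambda>\<xi>. of_real (norm \<xi> powr \<alpha>) * h \<xi>)"
    unfolding sqnorm_def by (rule nn_integral_cmult) measurable
  finally show ?thesis .
qed

text \<open>The symbol of the difference quotient with step t in direction b tends to \<i> (\<xi>
  \<bullet> b). Plancherel bounds the quotients uniformly, and Fatou's lemma carries the bound to
  the limit; no weak derivative of v has to be constructed.\<close>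

lemma sqnorm_coordinate_le:
  fixes v h :: "'a::euclidean_space \<Rightarrow> complex"
  assumes p: "fourier_pair v h" and \<delta>: "0 < \<delta>"
    and le: "\<And>k. norm k \<le> \<delta> \<Longrightarrow> sqnorm (\<lambda>x. v (x + k) - v x) \<le> ennreal ((norm k)\<^sup>2) * B"
    and b: "b \<in> Basis"
  shows "(\<integral>\<^sup>+\<xi>. ennreal ((\<xi> \<bullet> b)\<^sup>2 * (norm (h \<xi>))\<^sup>2) \<partial>lborel) \<le> B"
proof -
  have [measurable]: "h \<in> borel_measurable borel" using p by (simp add: fourier_pair_def)
  define t where "t n = \<delta> * inverse (real (Suc n))" for n
  have t: "0 < t n" "t n \<le> \<delta>" for n
    using \<delta> by (auto simp: t_def divide_inverse[symmetric] field_simps simp del: of_nat_Suc)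
  have tlim: "t \<longlonglongrightarrow> 0"
    unfolding t_def using tendsto_mult_left[OF LIMSEQ_inverse_real_of_nat, of \<delta>] by simp
  let ?f = "\<lambda>n \<xi>. ennreal ((norm (((exp (\<i> * of_real (\<xi> \<bullet> (t n *\<^sub>R b))) - 1) /\<^sub>R t n) * h \<xi>))\<^sup>2)"
  have lim: "(\<lambda>n. ?f n \<xi>) \<longlonglongrightarrow> ennreal ((\<xi> \<bullet> b)\<^sup>2 * (norm (h \<xi>))\<^sup>2)" for \<xi>
  proof -
    have e: "(exp has_derivative (\<lambda>h. exp z * h)) (at z)" for z :: complex
      using DERIV_exp[of z] by (simp add: has_field_derivative_def)
    have "((\<lambda>s::real. exp (\<i> * of_real (s * (\<xi> \<bullet> b)))) has_derivative (\<lambda>s. exp (\<i> * of_real (0 * (\<xi> \<bullet> b))) * (\<i> * of_real (s * (\<xi> \<bullet> b))))) (at 0)"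
      by (intro has_derivative_compose[OF _ e]) (auto intro!: derivative_eq_intros)
    from has_derivative_imp_difference_quotient[OF this, of 1]
    have q: "((\<lambda>s::real. (exp (\<i> * of_real (\<xi> \<bullet> (s *\<^sub>R b))) - 1) /\<^sub>R s) \<longlongrightarrow> \<i> * of_real (\<xi> \<bullet> b)) (at 0)"
      by simp
    have "(\<lambda>n. (exp (\<i> * of_real (\<xi> \<bullet> (t n *\<^sub>R b))) - 1) /\<^sub>R t n) \<longlonglongrightarrow> \<i> * of_real (\<xi> \<bullet> b)"
      by (rule filterlim_compose[OF q]) (use t(1) tlim in \<open>auto simp: filterlim_at intro!: always_eventually less_imp_neq[THEN not_sym]\<close>)
    then have "(\<lambda>n. (norm (((exp (\<i> * of_real (\<xi> \<bullet> (t n *\<^sub>R b))) - 1) /\<^sub>R t n) * h \<xi>))\<^sup>2) \<longlonglongrightarrow> (norm (\<i> * of_real (\<xi> \<bullet> b) * h \<xi>))\<^sup>2"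
      by (intro tendsto_intros)
    then show ?thesis
      by (intro tendsto_ennrealI) (simp only: norm_mult norm_ii norm_of_real power_mult_distrib power2_abs mult_1_left power_one)
  qed
  have "(\<integral>\<^sup>+\<xi>. ?f n \<xi> \<partial>lborel) \<le> B" for n
  proof -
    have "(\<integral>\<^sup>+\<xi>. ?f n \<xi> \<partial>lborel) = (\<integral>\<^sup>+\<xi>. ennreal (inverse ((t n)\<^sup>2)) * ennreal ((norm ((exp (\<i> * of_real (\<xi> \<bullet> (t n *\<^sub>R b))) - 1) * h \<xi>))\<^sup>2) \<partial>lborel)"
    proof (rule nn_integral_cong)
      fix \<xi>
      have "(norm (((exp (\<i> * of_real (\<xi> \<bullet> (t n *\<^sub>R b))) - 1) /\<^sub>R t n) * h \<xi>))\<^sup>2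
        = inverse ((t n)\<^sup>2) * (norm ((exp (\<i> * of_real (\<xi> \<bullet> (t n *\<^sub>R b))) - 1) * h \<xi>))\<^sup>2"
        by (simp only: norm_mult norm_scaleR power_mult_distrib power_inverse real_norm_def power2_abs mult.assoc)
      then show "?f n \<xi> = ennreal (inverse ((t n)\<^sup>2)) * ennreal ((norm ((exp (\<i> * of_real (\<xi> \<bullet> (t n *\<^sub>R b))) - 1) * h \<xi>))\<^sup>2)"
        by (simp only:) (rule ennreal_mult', simp)
    qed
    also have "\<dots> = ennreal (inverse ((t n)\<^sup>2)) * sqnorm (\<lambda>\<xi>. (exp (\<i> * of_real (\<xi> \<bullet> (t n *\<^sub>R b))) - 1) * h \<xi>)"
      unfolding sqnorm_def by (rule nn_integral_cmult) measurable
    also have "\<dots> = ennreal (inverse ((t n)\<^sup>2)) * sqnorm (\<lambda>x. v (x + t n *\<^sub>R b) - v x)"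
      using fourier_pair_sqnorm[OF fourier_pair_difference[OF p, of "t n *\<^sub>R b"]] by (simp only:)
    also have "\<dots> \<le> ennreal (inverse ((t n)\<^sup>2)) * (ennreal ((norm (t n *\<^sub>R b))\<^sup>2) * B)"
      using t[of n] b by (intro mult_left_mono le) auto
    also have "\<dots> = B"
      using t[of n] b by (simp add: mult.assoc[symmetric] ennreal_mult'[symmetric])
    finally show ?thesis .
  qed
  note fB = this
  have "(\<integral>\<^sup>+\<xi>. ennreal ((\<xi> \<bullet> b)\<^sup>2 * (norm (h \<xi>))\<^sup>2) \<partial>lborel) = (\<integral>\<^sup>+\<xi>. liminf (\<lambda>n. ?f n \<xi>) \<partial>lborel)"
    by (intro nn_integral_cong lim_imp_Liminf[symmetric] lim) simp
  also have "\<dots> \<le> liminf (\<lambda>n. \<integral>\<^sup>+\<xi>. ?f n \<xi> \<partial>lborel)"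
    by (rule nn_integral_liminf) measurable
  also have "\<dots> \<le> liminf (\<lambda>n. B)"
    by (intro Liminf_mono always_eventually allI fB)
  finally show ?thesis by (simp add: Liminf_const)
qed

text \<open>With s = \<delta> norm \<xi> the elementary bound s^(2 \<alpha>) \<le> 1 + s^2
  interpolates between the norm of v and that of its gradient. In the constant, 1 stems from the
  former and d C from the d coordinate directions.\<close>

lemma sqnorm_symbol_le:
  fixes v h :: "'a::euclidean_space \<Rightarrow> complex"
  assumes p: "fourier_pair v h" and \<delta>: "0 < \<delta>" and \<alpha>: "0 \<le> \<alpha>" "\<alpha> \<le> 1" and C: "0 \<le> C"
    and le: "\<And>k. norm k \<le> \<delta> \<Longrightarrow> sqnorm (\<lambda>x. v (x + k) - v x) \<le> ennreal (C * (norm k)\<^sup>2 / \<delta>\<^sup>2) * sqnorm v"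
  shows "sqnorm (\<lambda>\<xi>. of_real (norm \<xi> powr \<alpha>) * h \<xi>) \<le> ennreal ((1 + real DIM('a) * C) * \<delta> powr (- 2 * \<alpha>)) * sqnorm v"
proof -
  have [measurable]: "h \<in> borel_measurable borel" using p by (simp add: fourier_pair_def)
  have hv: "sqnorm h = sqnorm v" using fourier_pair_sqnorm[OF p] by simp
  let ?B = "ennreal (C / \<delta>\<^sup>2) * sqnorm v"
  have coord: "(\<integral>\<^sup>+\<xi>. ennreal ((\<xi> \<bullet> b)\<^sup>2 * (norm (h \<xi>))\<^sup>2) \<partial>lborel) \<le> ?B" if "b \<in> Basis" for b
  proof (rule sqnorm_coordinate_le[OF p \<delta> _ that])
    fix k :: 'a assume "norm k \<le> \<delta>"
    then have "sqnorm (\<lambda>x. v (x + k) - v x) \<le> ennreal ((norm k)\<^sup>2 * (C / \<delta>\<^sup>2)) * sqnorm v"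
      using le[of k] by (simp add: mult.commute)
    then show "sqnorm (\<lambda>x. v (x + k) - v x) \<le> ennreal ((norm k)\<^sup>2) * ?B"
      by (simp only: ennreal_mult' zero_le_power2 mult.assoc)
  qed
  let ?c = "\<delta> powr (- 2 * \<alpha>)"
  have pt: "(norm (of_real (norm \<xi> powr \<alpha>) * h \<xi>))\<^sup>2 \<le> ?c * ((norm (h \<xi>))\<^sup>2 + \<delta>\<^sup>2 * (\<Sum>b\<in>Basis. (\<xi> \<bullet> b)\<^sup>2 * (norm (h \<xi>))\<^sup>2))" for \<xi>
  proof -
    define s where "s = \<delta> * norm \<xi>"
    have s0: "0 \<le> s" using \<delta> by (simp add: s_def)
    have "s powr (2 * \<alpha>) \<le> 1 + s\<^sup>2"
    proof (cases "s \<le> 1")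
      case True
      then have "s powr (2 * \<alpha>) \<le> 1" using s0 \<alpha> by (intro powr_le1) auto
      then show ?thesis using zero_le_power2[of s] by linarith
    next
      case False
      then have "s powr (2 * \<alpha>) \<le> s powr 2" using \<alpha> by (intro powr_mono) auto
      also have "\<dots> = s\<^sup>2" using False by (simp add: powr_numeral)
      finally show ?thesis by simp
    qed
    moreover have "s powr (2 * \<alpha>) = \<delta> powr (2 * \<alpha>) * (norm \<xi> powr \<alpha>)\<^sup>2"
      using \<delta> by (simp add: s_def powr_mult power2_eq_square powr_add[symmetric])
    moreover have "?c * \<delta> powr (2 * \<alpha>) = 1" using \<delta> by (simp add: powr_add[symmetric])
    moreover have "?c * (\<delta> powr (2 * \<alpha>) * (norm \<xi> powr \<alpha>)\<^sup>2) \<le> ?c * (1 + s\<^sup>2)"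
      using calculation by (intro mult_left_mono) auto
    ultimately have "(norm \<xi> powr \<alpha>)\<^sup>2 \<le> ?c * (1 + s\<^sup>2)" by (simp only: mult.assoc[symmetric] mult_1_left)
    then have "(norm \<xi> powr \<alpha>)\<^sup>2 * (norm (h \<xi>))\<^sup>2 \<le> ?c * (1 + s\<^sup>2) * (norm (h \<xi>))\<^sup>2"
      by (rule mult_right_mono) simp
    also have "s\<^sup>2 = \<delta>\<^sup>2 * (\<Sum>b\<in>Basis. (\<xi> \<bullet> b)\<^sup>2)"
      by (simp only: s_def power_mult_distrib norm_power2_eq_sum_Basis)
    also have "?c * (1 + \<delta>\<^sup>2 * (\<Sum>b\<in>Basis. (\<xi> \<bullet> b)\<^sup>2)) * (norm (h \<xi>))\<^sup>2
      = ?c * ((norm (h \<xi>))\<^sup>2 + \<delta>\<^sup>2 * (\<Sum>b\<in>Basis. (\<xi> \<bullet> b)\<^sup>2 * (norm (h \<xi>))\<^sup>2))"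
      by (simp only: sum_distrib_right[symmetric] distrib_right mult_1_left mult.assoc)
    finally show ?thesis by (simp only: norm_mult norm_of_real power_mult_distrib power2_abs)
  qed
  have "sqnorm (\<lambda>\<xi>. of_real (norm \<xi> powr \<alpha>) * h \<xi>)
    \<le> (\<integral>\<^sup>+\<xi>. ennreal ?c * (ennreal ((norm (h \<xi>))\<^sup>2) + ennreal (\<delta>\<^sup>2) * (\<Sum>b\<in>Basis. ennreal ((\<xi> \<bullet> b)\<^sup>2 * (norm (h \<xi>))\<^sup>2))) \<partial>lborel)"
    unfolding sqnorm_def
  proof (rule nn_integral_mono)
    fix \<xi> :: 'a
    have S: "0 \<le> (\<Sum>b\<in>Basis. (\<xi> \<bullet> b)\<^sup>2 * (norm (h \<xi>))\<^sup>2)" by (intro sum_nonneg) auto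
    have "ennreal ((norm (of_real (norm \<xi> powr \<alpha>) * h \<xi>))\<^sup>2) \<le> ennreal (?c * ((norm (h \<xi>))\<^sup>2 + \<delta>\<^sup>2 * (\<Sum>b\<in>Basis. (\<xi> \<bullet> b)\<^sup>2 * (norm (h \<xi>))\<^sup>2)))"
      by (intro ennreal_leI pt)
    also have "\<dots> = ennreal ?c * (ennreal ((norm (h \<xi>))\<^sup>2) + ennreal (\<delta>\<^sup>2) * ennreal (\<Sum>b\<in>Basis. (\<xi> \<bullet> b)\<^sup>2 * (norm (h \<xi>))\<^sup>2))"
      using S by (simp only: ennreal_mult' ennreal_plus powr_ge_zero zero_le_power2 mult_nonneg_nonneg)
    also have "ennreal (\<Sum>b\<in>Basis. (\<xi> \<bullet> b)\<^sup>2 * (norm (h \<xi>))\<^sup>2) = (\<Sum>b\<in>Basis. ennreal ((\<xi> \<bullet> b)\<^sup>2 * (norm (h \<xi>))\<^sup>2))"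
      by (rule sum_ennreal[symmetric]) simp
    finally show "ennreal ((norm (of_real (norm \<xi> powr \<alpha>) * h \<xi>))\<^sup>2)
      \<le> ennreal ?c * (ennreal ((norm (h \<xi>))\<^sup>2) + ennreal (\<delta>\<^sup>2) * (\<Sum>b\<in>Basis. ennreal ((\<xi> \<bullet> b)\<^sup>2 * (norm (h \<xi>))\<^sup>2)))" .
  qed
  also have "\<dots> = ennreal ?c * (sqnorm h + ennreal (\<delta>\<^sup>2) * (\<Sum>b\<in>Basis. \<integral>\<^sup>+\<xi>. ennreal ((\<xi> \<bullet> b)\<^sup>2 * (norm (h \<xi>))\<^sup>2) \<partial>lborel))"
    unfolding sqnorm_def by (simp add: nn_integral_cmult nn_integral_add nn_integral_sum del: sum_ennreal)
  also have "\<dots> \<le> ennreal ?c * (sqnorm v + ennreal (\<delta>\<^sup>2) * (\<Sum>b\<in>(Basis::'a set). ?B))"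
    unfolding hv by (intro mult_left_mono add_left_mono sum_mono coord) auto
  also have "(\<Sum>b\<in>(Basis::'a set). ?B) = ennreal (real DIM('a)) * ?B"
    by (simp add: ennreal_of_nat_eq_real_of_nat)
  also have "ennreal (\<delta>\<^sup>2) * (ennreal (real DIM('a)) * ?B) = ennreal (real DIM('a) * C) * sqnorm v"
  proof -
    have "ennreal (\<delta>\<^sup>2) * (ennreal (real DIM('a)) * ennreal (C / \<delta>\<^sup>2)) = ennreal (\<delta>\<^sup>2 * (real DIM('a) * (C / \<delta>\<^sup>2)))"
      by (simp only: ennreal_mult' zero_le_power2 of_nat_0_le_iff)
    also have "\<delta>\<^sup>2 * (real DIM('a) * (C / \<delta>\<^sup>2)) = real DIM('a) * C" using \<delta> by simp
    finally show ?thesis by (simp only: mult.assoc[symmetric])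
  qed
  also have "ennreal ?c * (sqnorm v + ennreal (real DIM('a) * C) * sqnorm v) = ennreal ((1 + real DIM('a) * C) * ?c) * sqnorm v"
  proof -
    have "ennreal ((1 + real DIM('a) * C) * ?c) = ennreal ?c * (1 + ennreal (real DIM('a) * C))"
      using C by (simp add: ennreal_mult mult.commute flip: ennreal_1)
    then show ?thesis by (simp only: distrib_left distrib_right mult_1_left mult_1_right mult.assoc)
  qed
  finally show ?thesis .
qed

section \<open>The Bernstein inequality\<close>

lemma two_powi_powr: "((2::real) powi (- j)) powr a = 2 powr (- (a * real_of_int j))"
proof -
  have "(2::real) powi (- j) = 2 powr (real_of_int (- j))"
    by (rule powr_real_of_int'[symmetric]) auto
  then show ?thesis by (simp add: powr_powr mult.commute)
qed

lemma Lpow_rescale: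
  fixes u :: "'a::euclidean_space \<Rightarrow> complex"
  assumes [measurable]: "u \<in> borel_measurable borel" and s: "0 < s"
  shows "Lpow p u = ennreal (s ^ DIM('a)) * Lpow p (\<lambda>x. u (s *\<^sub>R x))"
  unfolding Lpow_def using s by (subst nn_integral_lborel_scale[where c=s]) auto

lemma sqnorm_difference_rescale:
  fixes u :: "'a::euclidean_space \<Rightarrow> complex"
  assumes [measurable]: "u \<in> borel_measurable borel" and s: "0 < s"
  shows "sqnorm (\<lambda>x. of_real (norm (u (x + k)) powr r) - of_real (norm (u x) powr r))
    = ennreal (s ^ DIM('a)) * (\<integral>\<^sup>+x. ennreal ((norm (u (s *\<^sub>R (x + k /\<^sub>R s))) powr r - norm (u (s *\<^sub>R x)) powr r)\<^sup>2) \<partial>lborel)"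
proof -
  have eq: "s *\<^sub>R x + k = s *\<^sub>R (x + k /\<^sub>R s)" for x :: 'a
    using s by (simp add: scaleR_add_right)
  have "norm (complex_of_real a - of_real b) = \<bar>a - b\<bar>" for a b
    by (simp only: of_real_diff[symmetric] norm_of_real)
  then have "sqnorm (\<lambda>x. of_real (norm (u (x + k)) powr r) - of_real (norm (u x) powr r))
    = (\<integral>\<^sup>+x. ennreal ((norm (u (x + k)) powr r - norm (u x) powr r)\<^sup>2) \<partial>lborel)"
    by (simp add: sqnorm_def)
  also have "\<dots> = ennreal (s ^ DIM('a)) * (\<integral>\<^sup>+x. ennreal ((norm (u (s *\<^sub>R x + k)) powr r - norm (u (s *\<^sub>R x)) powr r)\<^sup>2) \<partial>lborel)"
    using s by (subst nn_integral_lborel_scale[where c=s]) auto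
  finally show ?thesis by (simp only: eq)
qed

lemma sqnorm_abs_powr_half: "sqnorm (\<lambda>x. of_real (norm (u x) powr (p / 2))) = Lpow p u"
  by (simp add: sqnorm_def Lpow_def powr_half_square)

text \<open>Unit-scale increments of the rescaled function are increments of u of length at most s,
  so the symbol estimate applies with \<delta> = s. The Jacobian s^d occurs on both sides and
  cancels, leaving only s^(-2 \<alpha>).\<close>

lemma upper_bound_symbol:
  fixes K :: "'a::euclidean_space \<Rightarrow> complex"
  assumes K: "K \<in> schwartz" and p: "2 \<le> p" and \<alpha>: "0 \<le> \<alpha>" "\<alpha> \<le> 1"
  obtains C where "0 < C"
    "\<And>u h s. 0 < s \<Longrightarrow> u \<in> borel_measurable borel \<Longrightarrow> reproduces K p (\<lambda>x. u (s *\<^sub>R x)) \<Longrightarrow>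
       fourier_pair (\<lambda>x. of_real (norm (u x) powr (p / 2))) h \<Longrightarrow>
       sqnorm (\<lambda>\<xi>. of_real (norm \<xi> powr \<alpha>) * h \<xi>) \<le> ennreal (C * s powr (- 2 * \<alpha>)) * Lpow p u"
proof -
  obtain C where C: "0 \<le> C"
    "\<And>U k. reproduces K p U \<Longrightarrow> norm k \<le> 1 \<Longrightarrow>
       (\<integral>\<^sup>+x. ennreal ((norm (U (x + k)) powr (p/2) - norm (U x) powr (p/2))\<^sup>2) \<partial>lborel)
         \<le> ennreal (C * (norm k)\<^sup>2) * Lpow p U"
    using reproduces_upper[OF K p] by blast
  show ?thesis
  proof (rule that[of "1 + real DIM('a) * C"])
    show "0 < 1 + real DIM('a) * C" using C(1) by (intro add_pos_nonneg) auto
    fix u h s assume s: "0 < s" and u: "u \<in> borel_measurable borel" and U: "reproduces K p (\<lambda>x. u (s *\<^sub>R x))"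
      and h: "fourier_pair (\<lambda>x. of_real (norm (u x) powr (p / 2))) h"
    have "sqnorm (\<lambda>x. of_real (norm (u (x + k)) powr (p/2)) - of_real (norm (u x) powr (p/2)))
      \<le> ennreal (C * (norm k)\<^sup>2 / s\<^sup>2) * sqnorm (\<lambda>x. of_real (norm (u x) powr (p/2)))" if k: "norm k \<le> s" for k
    proof -
      have ks: "norm (k /\<^sub>R s) \<le> 1" "C * (norm (k /\<^sub>R s))\<^sup>2 = C * (norm k)\<^sup>2 / s\<^sup>2"
        using k s by (auto simp: field_simps power_mult_distrib)
      have "sqnorm (\<lambda>x. of_real (norm (u (x + k)) powr (p/2)) - of_real (norm (u x) powr (p/2)))
        \<le> ennreal (s ^ DIM('a)) * (ennreal (C * (norm (k /\<^sub>R s))\<^sup>2) * Lpow p (\<lambda>x. u (s *\<^sub>R x)))"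
        unfolding sqnorm_difference_rescale[OF u s] by (intro mult_left_mono C(2)[OF U ks(1)]) simp
      also have "\<dots> = ennreal (C * (norm k)\<^sup>2 / s\<^sup>2) * Lpow p u"
        unfolding Lpow_rescale[OF u s] ks(2) by (simp only: mult_ac)
      finally show ?thesis unfolding sqnorm_abs_powr_half .
    qed
    from sqnorm_symbol_le[OF h s \<alpha> C(1) this]
    show "sqnorm (\<lambda>\<xi>. of_real (norm \<xi> powr \<alpha>) * h \<xi>) \<le> ennreal ((1 + real DIM('a) * C) * s powr (- 2 * \<alpha>)) * Lpow p u"
      unfolding sqnorm_abs_powr_half by blast
  qed
qed

text \<open>An increment k of the rescaled function is the increment s k of u, which the symbol
  controls with the factor 4 (s R)^(2 \<alpha>) uniformly for norm k \<le> R. Integrating over these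
  k costs the volume of the ball.\<close>

lemma lower_bound_symbol:
  fixes K :: "'a::euclidean_space \<Rightarrow> complex"
  assumes K: "K \<in> schwartz" "(LINT z|lborel. K z) = 0" and p: "2 \<le> p" and \<alpha>: "0 \<le> \<alpha>" "\<alpha> \<le> 1"
  obtains C where "0 < C"
    "\<And>u h s. 0 < s \<Longrightarrow> u \<in> borel_measurable borel \<Longrightarrow> reproduces K p (\<lambda>x. u (s *\<^sub>R x)) \<Longrightarrow> (\<And>x. u x \<in> \<real>) \<Longrightarrow>
       fourier_pair (\<lambda>x. of_real (norm (u x) powr (p / 2))) h \<Longrightarrow>
       Lpow p u \<le> ennreal (C * s powr (2 * \<alpha>)) * sqnorm (\<lambda>\<xi>. of_real (norm \<xi> powr \<alpha>) * h \<xi>)"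
proof -
  obtain R C where R: "0 \<le> R" and C: "0 \<le> C"
    "\<And>U. reproduces K p U \<Longrightarrow> (\<And>x. U x \<in> \<real>) \<Longrightarrow>
       Lpow p U \<le> ennreal C * (\<integral>\<^sup>+x. (\<integral>\<^sup>+k. indicator (cball 0 R) k *
          ennreal ((norm (U (x + k)) powr (p/2) - norm (U x) powr (p/2))\<^sup>2) \<partial>lborel) \<partial>lborel)"
    using reproduces_lower[OF K p] by blast
  define vol where "vol = measure lborel (cball (0::'a) R)"
  have vol: "emeasure lborel (cball (0::'a) R) = ennreal vol" "0 \<le> vol"
    unfolding vol_def using emeasure_bounded_finite[of "cball (0::'a) R"]
    by (auto intro!: emeasure_eq_ennreal_measure)
  let ?C = "C * (4 * (R powr \<alpha>)\<^sup>2 * vol)"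
  show ?thesis
  \<comment> \<open>The 1 is added only to have a strictly positive constant, whose negative power
    is taken later.\<close>
  proof (rule that[of "?C + 1"])
    show "0 < ?C + 1" using C(1) vol(2) by (intro add_nonneg_pos mult_nonneg_nonneg) auto
    fix u h s assume s: "0 < s" and u: "u \<in> borel_measurable borel" and U: "reproduces K p (\<lambda>x. u (s *\<^sub>R x))"
      and real: "\<And>x. u x \<in> \<real>" and h: "fourier_pair (\<lambda>x. of_real (norm (u x) powr (p / 2))) h"
    have [measurable]: "u \<in> borel_measurable borel" by (rule u)
    have [measurable]: "cball (0::'a) R \<in> sets borel" by simp
    let ?H = "sqnorm (\<lambda>\<xi>. of_real (norm \<xi> powr \<alpha>) * h \<xi>)"
    let ?G = "\<lambda>k x. ennreal ((norm (u (s *\<^sub>R (x + k))) powr (p/2) - norm (u (s *\<^sub>R x)) powr (p/2))\<^sup>2)"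
    have G: "ennreal (s ^ DIM('a)) * (\<integral>\<^sup>+x. ?G k x \<partial>lborel) \<le> ennreal (4 * ((s * R) powr \<alpha>)\<^sup>2) * ?H" if k: "norm k \<le> R" for k
    proof -
      have "ennreal (s ^ DIM('a)) * (\<integral>\<^sup>+x. ?G k x \<partial>lborel)
        = sqnorm (\<lambda>x. of_real (norm (u (x + s *\<^sub>R k)) powr (p/2)) - of_real (norm (u x) powr (p/2)))"
        using s by (subst sqnorm_difference_rescale[OF u s]) simp
      also have "\<dots> \<le> ennreal (4 * (norm (s *\<^sub>R k) powr \<alpha>)\<^sup>2) * ?H"
        by (rule sqnorm_difference_le[OF h \<alpha>])
      also have "\<dots> \<le> ennreal (4 * ((s * R) powr \<alpha>)\<^sup>2) * ?H"
        using s k \<alpha> by (intro mult_right_mono ennreal_leI mult_left_mono power_mono powr_mono2) auto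
      finally show ?thesis .
    qed
    have "Lpow p u \<le> ennreal (s ^ DIM('a)) * (ennreal C * (\<integral>\<^sup>+x. (\<integral>\<^sup>+k. indicator (cball 0 R) k * ?G k x \<partial>lborel) \<partial>lborel))"
      unfolding Lpow_rescale[OF u s] by (intro mult_left_mono C(2)[OF U] real) simp
    also have "(\<integral>\<^sup>+x. (\<integral>\<^sup>+k. indicator (cball 0 R) k * ?G k x \<partial>lborel) \<partial>lborel) = (\<integral>\<^sup>+k. (\<integral>\<^sup>+x. indicator (cball 0 R) k * ?G k x \<partial>lborel) \<partial>lborel)"
      by (rule lborel_pair.Fubini') measurable
    also have "ennreal (s ^ DIM('a)) * (ennreal C * (\<integral>\<^sup>+k. (\<integral>\<^sup>+x. indicator (cball 0 R) k * ?G k x \<partial>lborel) \<partial>lborel))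
      = ennreal C * (\<integral>\<^sup>+k. ennreal (s ^ DIM('a)) * (\<integral>\<^sup>+x. indicator (cball 0 R) k * ?G k x \<partial>lborel) \<partial>lborel)"
      by (subst (2) nn_integral_cmult) (measurable, simp only: mult.left_commute)
    also have "\<dots> \<le> ennreal C * (\<integral>\<^sup>+k. ennreal (4 * ((s * R) powr \<alpha>)\<^sup>2) * ?H * indicator (cball (0::'a) R) k \<partial>lborel)"
    proof (intro mult_left_mono nn_integral_mono)
      fix k :: 'a
      show "ennreal (s ^ DIM('a)) * (\<integral>\<^sup>+x. indicator (cball 0 R) k * ?G k x \<partial>lborel) \<le> ennreal (4 * ((s * R) powr \<alpha>)\<^sup>2) * ?H * indicator (cball (0::'a) R) k"
        using G[of k] by (cases "norm k \<le> R") (simp_all add: indicator_def)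
    qed simp
    also have "\<dots> = ennreal C * (ennreal (4 * ((s * R) powr \<alpha>)\<^sup>2) * ?H * ennreal vol)"
      by (subst nn_integral_cmult_indicator) (simp_all add: vol)
    also have "\<dots> = ennreal (?C * s powr (2 * \<alpha>)) * ?H"
    proof -
      have sq: "s powr (2 * \<alpha>) = (s powr \<alpha>)\<^sup>2"
        by (simp add: power2_eq_square flip: powr_add)
      have "(s * R) powr \<alpha> = s powr \<alpha> * R powr \<alpha>" using s R by (intro powr_mult)
      then have "?C * s powr (2 * \<alpha>) = C * (4 * ((s * R) powr \<alpha>)\<^sup>2) * vol"
        unfolding sq by (simp only: power_mult_distrib mult_ac)
      moreover have "ennreal (C * (4 * ((s * R) powr \<alpha>)\<^sup>2) * vol) = ennreal C * ennreal (4 * ((s * R) powr \<alpha>)\<^sup>2) * ennreal vol"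
        using C(1) vol(2) by (simp add: ennreal_mult)
      ultimately have "ennreal (?C * s powr (2 * \<alpha>)) = ennreal C * ennreal (4 * ((s * R) powr \<alpha>)\<^sup>2) * ennreal vol"
        by (simp only:)
      then show ?thesis by (simp only: mult_ac)
    qed
    also have "\<dots> \<le> ennreal ((?C + 1) * s powr (2 * \<alpha>)) * ?H"
      by (intro mult_right_mono ennreal_leI) auto
    finally show "Lpow p u \<le> ennreal ((?C + 1) * s powr (2 * \<alpha>)) * ?H" .
  qed
qed

theorem theorem1p1:
  fixes chi \<phi> :: "'a::euclidean_space \<Rightarrow> real" and p \<alpha> :: real
  assumes "littlewood_paley chi \<phi>"
    and "2 \<le> p" and "0 \<le> \<alpha>" and "\<alpha> \<le> 1"
  shows "\<exists>c>0. \<exists>C>0. \<forall>(f :: 'a functional) (j :: int). tempered_distribution f \<longrightarrow>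
     (real_distribution f \<longrightarrow>
        ennreal (c * 2 powr (2 * \<alpha> * real_of_int j / p)) * dist_Lp_norm p (LP_block \<phi> j f)
          \<le> ennreal_powr (Lambda_L2_norm \<alpha> (abs_powr_dist (LP_block \<phi> j f) (p / 2))) (2 / p)) \<and>
     ennreal_powr (Lambda_L2_norm \<alpha> (abs_powr_dist (LP_block \<phi> j f) (p / 2))) (2 / p)
       \<le> ennreal (C * 2 powr (2 * \<alpha> * real_of_int j / p)) * dist_Lp_norm p (LP_block \<phi> j f)"
proof -
  note p = assms(2) and \<alpha> = assms(3,4)
  obtain K :: "'a \<Rightarrow> complex" where K: "K \<in> schwartz" "(LINT z|lborel. K z) = 0"
    and block: "\<And>f j. tempered_distribution f \<Longrightarrow> \<exists>u. represents (LP_block \<phi> j f) u \<and> moderate u \<and>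
       (\<forall>x. u (2 powi (- j) *\<^sub>R x) = (LINT z|lborel. K z * u (2 powi (- j) *\<^sub>R (x - z)))) \<and>
       (real_distribution f \<longrightarrow> (\<forall>x. u x \<in> \<real>))"
    using LP_block_structure[OF assms(1)] by blast
  obtain Cu where Cu: "0 < Cu"
    "\<And>u h s. 0 < s \<Longrightarrow> u \<in> borel_measurable borel \<Longrightarrow> reproduces K p (\<lambda>x. u (s *\<^sub>R x)) \<Longrightarrow>
       fourier_pair (\<lambda>x. of_real (norm (u x) powr (p / 2))) h \<Longrightarrow>
       sqnorm (\<lambda>\<xi>. of_real (norm \<xi> powr \<alpha>) * h \<xi>) \<le> ennreal (Cu * s powr (- 2 * \<alpha>)) * Lpow p u"
    using upper_bound_symbol[OF K(1) p \<alpha>] by blast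
  obtain Cl where Cl: "0 < Cl"
    "\<And>u h s. 0 < s \<Longrightarrow> u \<in> borel_measurable borel \<Longrightarrow> reproduces K p (\<lambda>x. u (s *\<^sub>R x)) \<Longrightarrow> (\<And>x. u x \<in> \<real>) \<Longrightarrow>
       fourier_pair (\<lambda>x. of_real (norm (u x) powr (p / 2))) h \<Longrightarrow>
       Lpow p u \<le> ennreal (Cl * s powr (2 * \<alpha>)) * sqnorm (\<lambda>\<xi>. of_real (norm \<xi> powr \<alpha>) * h \<xi>)"
    using lower_bound_symbol[OF K p \<alpha>] by blast
  \<comment> \<open>The constants are p-th roots of those for the symbol. The lower one is inverted
    because there the power integral of the block is bounded by the symbol norm.\<close>
  have bounds: "(real_distribution f \<longrightarrow>
        ennreal (Cl powr (- 1 / p) * 2 powr (2 * \<alpha> * real_of_int j / p)) * dist_Lp_norm p (LP_block \<phi> j f)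
          \<le> ennreal_powr (Lambda_L2_norm \<alpha> (abs_powr_dist (LP_block \<phi> j f) (p / 2))) (2 / p)) \<and>
     ennreal_powr (Lambda_L2_norm \<alpha> (abs_powr_dist (LP_block \<phi> j f) (p / 2))) (2 / p)
       \<le> ennreal (Cu powr (1 / p) * 2 powr (2 * \<alpha> * real_of_int j / p)) * dist_Lp_norm p (LP_block \<phi> j f)"
    if f: "tempered_distribution f" for f :: "'a functional" and j
  proof -
    define s :: real where "s = 2 powi (- j)"
    have s: "0 < s" by (simp add: s_def)
    obtain u where u: "represents (LP_block \<phi> j f) u" "moderate u"
      "\<forall>x. u (s *\<^sub>R x) = (LINT z|lborel. K z * u (s *\<^sub>R (x - z)))" "real_distribution f \<longrightarrow> (\<forall>x. u x \<in> \<real>)"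
      using block[OF f, of j] unfolding s_def by blast
    have um [measurable]: "u \<in> borel_measurable borel" using u(1) by (simp add: represents_def)
    define v where "v x = complex_of_real (norm (u x) powr (p / 2))" for x
    define g where "g = abs_powr_dist (LP_block \<phi> j f) (p / 2)"
    have v: "v \<in> borel_measurable borel" "moderate v"
      unfolding v_def using moderate_abs_powr[OF u(2), of "p / 2"] p by auto
    have g: "g \<psi> = fun_dist v \<psi>" if "\<psi> \<in> schwartz" for \<psi>
      unfolding g_def v_def by (rule abs_powr_dist_eq[OF u(1) that])
    have vu: "sqnorm v = Lpow p u" unfolding v_def by (rule sqnorm_abs_powr_half)
    have norm_u: "dist_Lp_norm p (LP_block \<phi> j f) = ennreal_powr (Lpow p u) (1 / p)"
      by (rule dist_Lp_norm_eq[OF u(1)])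
    \<comment> \<open>The convolution identity holds for every tempered f; finiteness of the norm is
      the only part of \<open>reproduces\<close> that depends on the case at hand.\<close>
    have rep: "reproduces K p (\<lambda>x. u (s *\<^sub>R x))" if fin: "Lpow p u < \<infinity>"
    proof -
      have m: "(\<lambda>x. u (s *\<^sub>R x)) \<in> borel_measurable borel" by measurable
      have "Lpow p (\<lambda>x. u (s *\<^sub>R x)) < \<infinity>"
        using fin s unfolding Lpow_rescale[OF um s, of p] by (auto simp: ennreal_mult_less_top)
      with m u(3) show ?thesis unfolding reproduces_def by (intro conjI)
    qed
    \<comment> \<open>The norm of the image under \<open>Lambda\<close> is the power 1/2 of the
      weighted square integral, and (1/2) (2/p) = 1/p.\<close>
    have val: "ennreal_powr (Lambda_L2_norm \<alpha> g) (2 / p) = ennreal_powr (sqnorm (\<lambda>\<xi>. of_real (norm \<xi> powr \<alpha>) * h \<xi>)) (1 / p)"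
      if "fourier_pair v h" "sqnorm h < \<infinity>" for h
      using Lambda_L2_norm_eq[OF v g that \<alpha>] by (simp add: ennreal_powr_powr)
    have scale: "(s powr (- 2 * \<alpha>)) powr (1 / p) = 2 powr (2 * \<alpha> * real_of_int j / p)"
      by (simp add: s_def two_powi_powr powr_powr)
    have "ennreal_powr (Lambda_L2_norm \<alpha> g) (2 / p) \<le> ennreal (Cu powr (1 / p) * 2 powr (2 * \<alpha> * real_of_int j / p)) * ennreal_powr (Lpow p u) (1 / p)"
    proof (cases "Lpow p u < \<infinity>")
      case True
      then obtain h where h: "fourier_pair v h" "sqnorm h \<le> Lpow p u"
        using exists_fourier_pair[OF v(1)] unfolding vu by blast
      have "ennreal_powr (Lambda_L2_norm \<alpha> g) (2 / p) = ennreal_powr (sqnorm (\<lambda>\<xi>. of_real (norm \<xi> powr \<alpha>) * h \<xi>)) (1 / p)"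
        by (rule val[OF h(1) order_le_less_trans[OF h(2) True]])
      also have "\<dots> \<le> ennreal_powr (ennreal (Cu * s powr (- 2 * \<alpha>)) * Lpow p u) (1 / p)"
        using p by (intro ennreal_powr_mono Cu(2)[OF s um rep[OF True] h(1)[unfolded v_def[abs_def]]]) auto
      also have "\<dots> = ennreal ((Cu * s powr (- 2 * \<alpha>)) powr (1 / p)) * ennreal_powr (Lpow p u) (1 / p)"
        using Cu(1) s by (intro ennreal_powr_mult) auto
      also have "(Cu * s powr (- 2 * \<alpha>)) powr (1 / p) = Cu powr (1 / p) * 2 powr (2 * \<alpha> * real_of_int j / p)"
        using Cu(1) by (simp only: powr_mult scale)
      finally show ?thesis .
    next
      case False
      then show ?thesis using Cu(1) by (simp add: less_top[symmetric] ennreal_powr_def ennreal_mult_top)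
    qed
    \<comment> \<open>Outside the domain of \<open>Lambda\<close> the right side is infinite by
      definition. Inside it, Plancherel makes the p-th power integral of u finite, which is what the
      absorption argument behind \<open>Cl\<close> presupposes.\<close>
    moreover have "ennreal (Cl powr (- 1 / p) * 2 powr (2 * \<alpha> * real_of_int j / p)) * ennreal_powr (Lpow p u) (1 / p) \<le> ennreal_powr (Lambda_L2_norm \<alpha> g) (2 / p)"
      if real: "real_distribution f"
    proof (cases "Lambda_domain g")
      case False
      then show ?thesis by (simp add: Lambda_L2_norm_def ennreal_powr_def)
    next
      case True
      then obtain h where h: "fourier_pair v h" "sqnorm h < \<infinity>"
        using Lambda_domain_iff[OF v g] by blast
      have fin: "Lpow p u < \<infinity>" using fourier_pair_sqnorm[OF h(1)] h(2) by (simp add: vu)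
      let ?X = "ennreal_powr (sqnorm (\<lambda>\<xi>. of_real (norm \<xi> powr \<alpha>) * h \<xi>)) (1 / p)"
      have "ennreal_powr (Lpow p u) (1 / p) \<le> ennreal_powr (ennreal (Cl * s powr (2 * \<alpha>)) * sqnorm (\<lambda>\<xi>. of_real (norm \<xi> powr \<alpha>) * h \<xi>)) (1 / p)"
        using p by (intro ennreal_powr_mono Cl(2)[OF s um rep[OF fin] u(4)[rule_format, OF real] h(1)[unfolded v_def[abs_def]]]) auto
      also have "\<dots> = ennreal ((Cl * s powr (2 * \<alpha>)) powr (1 / p)) * ?X"
        using Cl(1) s by (intro ennreal_powr_mult) auto
      finally have "ennreal (Cl powr (- 1 / p) * 2 powr (2 * \<alpha> * real_of_int j / p)) * ennreal_powr (Lpow p u) (1 / p)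
        \<le> ennreal (Cl powr (- 1 / p) * 2 powr (2 * \<alpha> * real_of_int j / p)) * (ennreal ((Cl * s powr (2 * \<alpha>)) powr (1 / p)) * ?X)"
        by (rule mult_left_mono) simp
      also have "\<dots> = ?X"
      proof -
        have "(Cl * s powr (2 * \<alpha>)) powr (1 / p) = Cl powr (1 / p) * 2 powr (- (2 * \<alpha> * real_of_int j / p))"
          using Cl(1) by (simp add: powr_mult s_def two_powi_powr powr_powr)
        moreover have "Cl powr (- 1 / p) * Cl powr (1 / p) = 1"
          using Cl(1) by (simp add: powr_add[symmetric])
        moreover have "2 powr (2 * \<alpha> * real_of_int j / p) * 2 powr (- (2 * \<alpha> * real_of_int j / p)) = (1::real)"
          by (simp add: powr_add[symmetric])
        moreover have "a * b * (c * d) = (a * c) * (b * d)" for a b c d :: real by (simp only: mult_ac)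
        ultimately have "Cl powr (- 1 / p) * 2 powr (2 * \<alpha> * real_of_int j / p) * (Cl * s powr (2 * \<alpha>)) powr (1 / p) = 1"
          by (simp only: mult_1_right)
        then have "ennreal (Cl powr (- 1 / p) * 2 powr (2 * \<alpha> * real_of_int j / p)) * ennreal ((Cl * s powr (2 * \<alpha>)) powr (1 / p)) = 1"
          by (simp add: ennreal_mult[symmetric])
        then show ?thesis by (simp only: mult.assoc[symmetric] mult_1_left)
      qed
      also have "?X = ennreal_powr (Lambda_L2_norm \<alpha> g) (2 / p)" by (rule val[OF h, symmetric])
      finally show ?thesis .
    qed
    ultimately show ?thesis unfolding norm_u g_def[symmetric] by blast
  qed
  have "0 < Cl powr (- 1 / p)" "0 < Cu powr (1 / p)" using Cl(1) Cu(1) by auto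
  with bounds show ?thesis by blast
qed

end
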